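(* Let $p\in(1,2]$ and let $\gamma$ be a $p$-elastica in $\mathbb{R}^2$. Then, up to similarity (i.e., translation, rotation, reflection, and dilation) and reparametrization, the curve $\gamma$ is represented by $\gamma(s)=\gamma_*(s+s_0)$ with some $s_0\in\mathbb{R}$, where $\gamma_*:\mathbb{R}\to\mathbb{R}^2$ is one of the following five arclength parametrizations: (Case I, linear $p$-elastica) $\gamma_\ell(s)=(s,0)$, where $k_\ell\equiv0$. (Case II, wavelike $p$-elastica) For some $q\in(0,1)$, $$\gamma_w(s,q)=\begin{pmatrix}2\mathrm{E}_{1,p}(\mathrm{am}_{1,p}(s,q),q)-s\\ -q\frac{p}{p-1}|\mathrm{cn}_p(s,q)|^{p-2}\mathrm{cn}_p(s,q)\end{pmatrix}.$$ In this case $\theta_w(s)=2\arcsin(q\,\mathrm{sn}_p(s,q))$ and $k_w(s)=2q\,\mathrm{cn}_p(s,q)$. (Case III, borderline $p$-elastica) $$\gamma_b(s)=\begin{pmatrix}2\tanh_p s-s\\ -\frac{p}{p-1}(\mathrm{sech}_p s)^{p-1}\end{pmatrix}.$$ In this case $\theta_b(s)=2\,\mathrm{am}_{1,p}(s,1)=2\,\mathrm{am}_{2,p}(s,1)$ and $k_b(s)=2\,\mathrm{sech}_p s$. (Case IV, orbitlike $p$-elastica) For some $q\in(0,1)$, $$\gamma_o(s,q)=\frac1{q^2}\begin{pmatrix}2\mathrm{E}_{2,\frac{p}{p-1}}(\mathrm{am}_{2,p}(s,q),q)+(q^2-2)s\\ -\frac{p}{p-1}\mathrm{dn}_p(s,q)^{p-1}\end{pmatrix}.$$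 In this case $\theta_o(s)=2\,\mathrm{am}_{2,p}(s,q)$ and $k_o(s)=2\,\mathrm{dn}_p(s,q)$. (Case V, circular $p$-elastica) $\gamma_c(s)=(\cos s,\sin s)$, where $k_c\equiv1$. Here $\theta_*$ denotes the tangential angle, $\partial_s\gamma_*=(\cos\theta_*,\sin\theta_* )$, and $k_*$ the (counterclockwise) signed curvature, $k_*=\partial_s\theta_*$.
   Context: **$p$-elastica.** Let $p\in(1,\infty)$. For an immersed curve $\gamma\in W^{2,p}(0,1;\mathbb{R}^2)$ (i.e. $\gamma'(t)\ne0$ for all $t\in[0,1]$), let $\mathcal{B}_p[\gamma]=\int_\gamma|k|^p\,ds$ with $s$ the arclength parameter and $k$ the signed curvature, and let $\mathcal{L}[\gamma]$ be the length. The curve $\gamma$ is a $p$-elastica if there is $\lambda\in\mathbb{R}$ such that $\frac{d}{d\varepsilon}\big(\mathcal{B}_p[\gamma+\varepsilon\eta]+\lambda\mathcal{L}[\gamma+\varepsilon\eta]\big)\big|_{\varepsilon=0}=0$ for all $\eta\in C^\infty_{\rm c}(0,1;\mathbb{R}^2)$. **"Represented up to similarity and reparametrization"** means: there are a length $\ell>0$, a reparametrization of $\gamma$ over $[0,\ell]$ (composition with a $C^1$-diffeomorphism $[0,\ell]\to[0,1]$) and a similarity of $\mathbb{R}^2$ (a composition of translations, rotations, reflections, dilations) such that the resulting curve equals $s\mapsto\gamma_*(s+s_0)$ on $[0,\ell]$. **$p$-elliptic integrals.** For $p\in(1,\infty)$, $q\in[0,1)$, $x\in\mathbb{R}$: $$\mathrm{F}_{1,p}(x,q)=\int_0^x\frac{|\cos\theta|^{1-\frac2p}}{\sqrt{1-q^2\sin^2\theta}}\,d\theta,\qquad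 \mathrm{F}_{2,p}(x,q)=\int_0^x\frac{d\theta}{\sqrt[p]{1-q^2\sin^2\theta}}.$$ For $q=1$: $\mathrm{F}_{1,p}(x,1)=\mathrm{F}_{2,p}(x,1)=\int_0^x|\cos\theta|^{-2/p}\,d\theta$, for $x\in(-\frac\pi2,\frac\pi2)$ if $1<p\le2$ and $x\in\mathbb{R}$ if $p>2$. Set $\mathrm{K}_p(1)=\infty$ if $1<p\le2$ and $\mathrm{K}_p(1)=\int_0^{\pi/2}(\cos\theta)^{-2/p}\,d\theta<\infty$ if $p>2$. For $q\in[0,1]$, $x\in\mathbb{R}$: $$\mathrm{E}_{1,p}(x,q)=\int_0^x\sqrt{1-q^2\sin^2\theta}\,|\cos\theta|^{1-\frac2p}\,d\theta,\qquad \mathrm{E}_{2,p}(x,q)=\int_0^x\sqrt[p]{1-q^2\sin^2\theta}\,d\theta$$ (so $\mathrm{E}_{2,\frac p{p-1}}$ is the latter with $p$ replaced by $\frac p{p-1}$). **$p$-elliptic functions.** For $q\in[0,1]$ and $i=1,2$, $\mathrm{am}_{i,p}(\cdot,q)$ is the inverse function of $\mathrm{F}_{i,p}(\cdot,q)$, defined on $\mathbb{R}$. For $x\in\mathbb{R}$: $\mathrm{sn}_p(x,q)=\sin\mathrm{am}_{1,p}(x,q)$, $\ \mathrm{cn}_p(x,q)=|\cos\mathrm{am}_{1,p}(x,q)|^{\frac2p-1}\cos\mathrm{am}_{1,p}(x,q)$, $\ \mathrm{dn}_p(x,q)=\sqrt[p]{1-q^2\sin^2(\mathrm{am}_{2,p}(x,q))}$.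 Also $\mathrm{sech}_p x=\mathrm{cn}_p(x,1)=\mathrm{dn}_p(x,1)$ for $x\in(-\mathrm{K}_p(1),\mathrm{K}_p(1))$ and $\mathrm{sech}_p x=0$ otherwise (for $1<p\le2$ the interval is $\mathbb{R}$), and $\tanh_p x=\int_0^x(\mathrm{sech}_p t)^p\,dt$. Expressions $|x|^{a}x$ with $a>-1$ are read as $0$ at $x=0$. *)

theory Defs
  imports "HOL-Analysis.Analysis"
begin

section \<open>Sobolev curves on the unit interval\<close>

definition vderiv :: "(real \<Rightarrow> 'a::real_normed_vector) \<Rightarrow> real \<Rightarrow> 'a" where
  "vderiv f t = vector_derivative f (at t)"

definition smooth :: "(real \<Rightarrow> 'a::real_normed_vector) \<Rightarrow> bool" where
  "smooth f \<longleftrightarrow> (\<forall>n t. (vderiv ^^ n) f differentiable (at t))"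

text \<open>The space \<open>C\<^sub>c\<^sup>\<infinity>(0,1)\<close>; its elements are extended by zero to the whole real line.\<close>

definition test_function :: "(real \<Rightarrow> 'a::real_normed_vector) \<Rightarrow> bool" where
  "test_function \<phi> \<longleftrightarrow> smooth \<phi> \<and>
     compact (closure {t. \<phi> t \<noteq> 0}) \<and> closure {t. \<phi> t \<noteq> 0} \<subseteq> {0<..<1}"

definition in_Lp :: "real \<Rightarrow> (real \<Rightarrow> 'a::euclidean_space) \<Rightarrow> bool" where
  "in_Lp p f \<longleftrightarrow> set_borel_measurable lebesgue {0<..<1} f \<and>
     set_integrable lebesgue {0<..<1} (\<lambda>t. norm (f t) powr p)"

definition locally_integrable :: "(real \<Rightarrow> 'a::euclidean_space) \<Rightarrow> bool" where
  "locally_integrable f \<longleftrightarrow>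
     (\<forall>a b. 0 < a \<and> a < b \<and> b < 1 \<longrightarrow> set_integrable lebesgue {a..b} f)"

definition has_weak_deriv ::
    "nat \<Rightarrow> (real \<Rightarrow> 'a::euclidean_space) \<Rightarrow> (real \<Rightarrow> 'a) \<Rightarrow> bool" where
  "has_weak_deriv k f g \<longleftrightarrow> locally_integrable f \<and> locally_integrable g \<and>
     (\<forall>\<phi> :: real \<Rightarrow> real. test_function \<phi> \<longrightarrow>
        (LINT t:{0<..<1}|lebesgue. (vderiv ^^ k) \<phi> t *\<^sub>R f t) =
        (- 1) ^ k *\<^sub>R (LINT t:{0<..<1}|lebesgue. \<phi> t *\<^sub>R g t))"

text \<open>A representative of the weak derivative. It is unique only up to null sets, and it is
  used below only under integrals.\<close>

definition weak_deriv :: "nat \<Rightarrow> (real \<Rightarrow> 'a::euclidean_space) \<Rightarrow> real \<Rightarrow> 'a" where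
  "weak_deriv k f = (SOME g. has_weak_deriv k f g)"

definition in_W2p :: "real \<Rightarrow> (real \<Rightarrow> 'a::euclidean_space) \<Rightarrow> bool" where
  "in_W2p p f \<longleftrightarrow> in_Lp p f \<and>
     (\<exists>g. has_weak_deriv 1 f g \<and> in_Lp p g) \<and> (\<exists>g. has_weak_deriv 2 f g \<and> in_Lp p g)"

text \<open>Pointwise differentiability on the closed interval selects the \<open>C\<^sup>1\<close> representative
  of the Sobolev class.\<close>

definition immersed_W2p :: "real \<Rightarrow> (real \<Rightarrow> real^2) \<Rightarrow> bool" where
  "immersed_W2p p \<gamma> \<longleftrightarrow> in_W2p p \<gamma> \<and>
     (\<forall>t\<in>{0..1}. \<exists>v. (\<gamma> has_vector_derivative v) (at t within {0..1}) \<and> v \<noteq> 0)"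


section \<open>Elastica\<close>

definition signed_curvature :: "(real \<Rightarrow> real^2) \<Rightarrow> real \<Rightarrow> real" where
  "signed_curvature \<gamma> t =
     (vderiv \<gamma> t $ 1 * weak_deriv 2 \<gamma> t $ 2 - vderiv \<gamma> t $ 2 * weak_deriv 2 \<gamma> t $ 1)
       / norm (vderiv \<gamma> t) ^ 3"

definition bending_energy :: "real \<Rightarrow> (real \<Rightarrow> real^2) \<Rightarrow> real" where
  "bending_energy p \<gamma> =
     (LINT t:{0<..<1}|lebesgue. \<bar>signed_curvature \<gamma> t\<bar> powr p * norm (vderiv \<gamma> t))"

definition curve_length :: "(real \<Rightarrow> real^2) \<Rightarrow> real" where
  "curve_length \<gamma> = (LINT t:{0<..<1}|lebesgue. norm (vderiv \<gamma> t))"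

definition p_elastica :: "real \<Rightarrow> (real \<Rightarrow> real^2) \<Rightarrow> bool" where
  "p_elastica p \<gamma> \<longleftrightarrow> immersed_W2p p \<gamma> \<and>
     (\<exists>lam::real. \<forall>\<eta> :: real \<Rightarrow> real^2. test_function \<eta> \<longrightarrow>
        ((\<lambda>\<epsilon>. bending_energy p (\<lambda>t. \<gamma> t + \<epsilon> *\<^sub>R \<eta> t)
              + lam * curve_length (\<lambda>t. \<gamma> t + \<epsilon> *\<^sub>R \<eta> t))
           has_real_derivative 0) (at 0))"


section \<open>Similarities and reparametrizations\<close>

text \<open>In the plane, the orthogonal matrices of determinant \<open>-1\<close> (the rotoinversions) are
  exactly the reflections across lines through the origin.\<close>

inductive similarity :: "(real^2 \<Rightarrow> real^2) \<Rightarrow> bool" where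
  translation: "similarity (\<lambda>x. x + a)"
| rotation: "rotation_matrix Q \<Longrightarrow> similarity (\<lambda>x. Q *v x)"
| reflection: "rotoinversion_matrix Q \<Longrightarrow> similarity (\<lambda>x. Q *v x)"
| dilation: "c > 0 \<Longrightarrow> similarity (\<lambda>x. c *\<^sub>R x)"
| composition: "similarity f \<Longrightarrow> similarity g \<Longrightarrow> similarity (f \<circ> g)"

text \<open>One-sided derivatives at the endpoints, unlike \<^const>\<open>C1_differentiable_on\<close>.\<close>

definition C1_within :: "real set \<Rightarrow> (real \<Rightarrow> real) \<Rightarrow> bool" where
  "C1_within A f \<longleftrightarrow>
     (\<exists>D. continuous_on A D \<and> (\<forall>x\<in>A. (f has_real_derivative D x) (at x within A)))"

definition C1_diffeo :: "real set \<Rightarrow> real set \<Rightarrow> (real \<Rightarrow> real) \<Rightarrow> bool" where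
  "C1_diffeo A B \<phi> \<longleftrightarrow> (\<exists>\<psi>. homeomorphism A B \<phi> \<psi> \<and> C1_within A \<phi> \<and> C1_within B \<psi>)"

definition represented_by :: "(real \<Rightarrow> real^2) \<Rightarrow> (real \<Rightarrow> real^2) \<Rightarrow> bool" where
  "represented_by \<gamma> \<gamma>' \<longleftrightarrow>
     (\<exists>s0 l \<phi> S. l > 0 \<and> C1_diffeo {0..l} {0..1} \<phi> \<and> similarity S \<and>
        (\<forall>s\<in>{0..l}. S (\<gamma> (\<phi> s)) = \<gamma>' (s + s0)))"


section \<open>p-elliptic integrals and functions\<close>

text \<open>In Isabelle \<open>0 powr a = 0\<close> for every \<open>a\<close>. In the integrals below this affects the
  integrand only on a null set; in the products \<open>\<bar>x\<bar> powr a * x\<close> it is the intended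
  convention. The integrals \<open>LBINT \<theta>=0..x\<close> are oriented. For \<open>q = 1\<close> the two integrals of the
  first kind are meaningful only on \<open>F_dom p 1\<close>.\<close>

definition F1 :: "real \<Rightarrow> real \<Rightarrow> real \<Rightarrow> real" where
  "F1 p x q =
     (if q = 1 then (LBINT \<theta>=0..x. \<bar>cos \<theta>\<bar> powr (- 2 / p))
      else (LBINT \<theta>=0..x. \<bar>cos \<theta>\<bar> powr (1 - 2 / p) / sqrt (1 - q\<^sup>2 * (sin \<theta>)\<^sup>2)))"

definition F2 :: "real \<Rightarrow> real \<Rightarrow> real \<Rightarrow> real" where
  "F2 p x q =
     (if q = 1 then (LBINT \<theta>=0..x. \<bar>cos \<theta>\<bar> powr (- 2 / p))
      else (LBINT \<theta>=0..x. 1 / (1 - q\<^sup>2 * (sin \<theta>)\<^sup>2) powr (1 / p)))"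

definition F_dom :: "real \<Rightarrow> real \<Rightarrow> real set" where
  "F_dom p q = (if q = 1 \<and> p \<le> 2 then {- (pi / 2)<..<pi / 2} else UNIV)"

definition K_one :: "real \<Rightarrow> ereal" where
  "K_one p = (if p \<le> 2 then \<infinity> else ereal (LBINT \<theta>=0..pi / 2. cos \<theta> powr (- 2 / p)))"

definition E1 :: "real \<Rightarrow> real \<Rightarrow> real \<Rightarrow> real" where
  "E1 p x q = (LBINT \<theta>=0..x. sqrt (1 - q\<^sup>2 * (sin \<theta>)\<^sup>2) * \<bar>cos \<theta>\<bar> powr (1 - 2 / p))"

definition E2 :: "real \<Rightarrow> real \<Rightarrow> real \<Rightarrow> real" where
  "E2 p x q = (LBINT \<theta>=0..x. (1 - q\<^sup>2 * (sin \<theta>)\<^sup>2) powr (1 / p))"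

definition am1 :: "real \<Rightarrow> real \<Rightarrow> real \<Rightarrow> real" where
  "am1 p x q = inv_into (F_dom p q) (\<lambda>y. F1 p y q) x"

definition am2 :: "real \<Rightarrow> real \<Rightarrow> real \<Rightarrow> real" where
  "am2 p x q = inv_into (F_dom p q) (\<lambda>y. F2 p y q) x"

definition sn :: "real \<Rightarrow> real \<Rightarrow> real \<Rightarrow> real" where
  "sn p x q = sin (am1 p x q)"

definition cn :: "real \<Rightarrow> real \<Rightarrow> real \<Rightarrow> real" where
  "cn p x q = \<bar>cos (am1 p x q)\<bar> powr (2 / p - 1) * cos (am1 p x q)"

definition dn :: "real \<Rightarrow> real \<Rightarrow> real \<Rightarrow> real" where
  "dn p x q = (1 - q\<^sup>2 * (sin (am2 p x q))\<^sup>2) powr (1 / p)"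

definition sech_p :: "real \<Rightarrow> real \<Rightarrow> real" where
  "sech_p p x = (if ereal \<bar>x\<bar> < K_one p then cn p x 1 else 0)"

definition tanh_p :: "real \<Rightarrow> real \<Rightarrow> real" where
  "tanh_p p x = (LBINT t=0..x. sech_p p t powr p)"


section \<open>The model curves\<close>

definition linear_curve :: "real \<Rightarrow> real^2" where
  "linear_curve s = vector [s, 0]"

definition wavelike_curve :: "real \<Rightarrow> real \<Rightarrow> real \<Rightarrow> real^2" where
  "wavelike_curve p q s = vector
     [2 * E1 p (am1 p s q) q - s,
      - q * (p / (p - 1)) * (\<bar>cn p s q\<bar> powr (p - 2) * cn p s q)]"

definition borderline_curve :: "real \<Rightarrow> real \<Rightarrow> real^2" where
  "borderline_curve p s = vector
     [2 * tanh_p p s - s, - (p / (p - 1)) * sech_p p s powr (p - 1)]"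

definition orbitlike_curve :: "real \<Rightarrow> real \<Rightarrow> real \<Rightarrow> real^2" where
  "orbitlike_curve p q s = (1 / q\<^sup>2) *\<^sub>R vector
     [2 * E2 (p / (p - 1)) (am2 p s q) q + (q\<^sup>2 - 2) * s,
      - (p / (p - 1)) * dn p s q powr (p - 1)]"

definition circular_curve :: "real \<Rightarrow> real^2" where
  "circular_curve s = vector [cos s, sin s]"

text \<open>In particular such a curve is parametrized by arclength.\<close>

definition has_angle_curvature ::
    "(real \<Rightarrow> real^2) \<Rightarrow> (real \<Rightarrow> real) \<Rightarrow> (real \<Rightarrow> real) \<Rightarrow> bool" where
  "has_angle_curvature \<gamma> \<theta> k \<longleftrightarrow>
     (\<forall>s. (\<gamma> has_vector_derivative vector [cos (\<theta> s), sin (\<theta> s)]) (at s) \<and>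
          (\<theta> has_real_derivative k s) (at s))"

end

theory Submission
  imports Defs
begin

text \<open>The first variation in direction \<open>\<eta>\<close> is linear in \<open>\<eta>'\<close> and \<open>\<eta>''\<close>. By du Bois-Reymond the
  coefficient of \<open>\<eta>''\<close>, a multiple of \<open>u = |k|\<^sup>p\<^sup>-\<^sup>2 k\<close> times the normal, is absolutely continuous,
  and its derivative is the coefficient of \<open>\<eta>'\<close> up to a constant vector. In the normal component of
  this identity all terms containing \<open>k\<close> cancel, and it integrates once more: \<open>u\<close> is an affine
  function of the position. So the curvature of \<open>\<gamma>\<close> is a function of the position, and because
  \<open>p \<le> 2\<close> this function is locally Lipschitz: initial position and direction determine the curve.
  If \<open>u\<close> is constant, \<open>\<gamma>\<close> is a line or a circle. Otherwise a similarity achieves \<open>u = - a y\<close> with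
  \<open>a > 0\<close>. With \<open>p' = p / (p - 1)\<close>, the quantity \<open>h = |k|\<^sup>p / (a p') - cos \<theta>\<close> is conserved along the
  model curves and invariant under dilations. Its value relative to \<open>- 1\<close> and \<open>1\<close> selects the model
  and its modulus \<open>q\<close>, after which the initial data can be matched exactly.\<close>

text \<open>The obstacle is regularity. A curve of class W^{2,p} has a curvature only almost
  everywhere, so everything up to the equation of the unit tangent is done with absolutely
  continuous functions in the given parameter, and a continuous representative of the curvature
  emerges only from the formula for \<open>u\<close>. The wavelike model has its own defect: for p <
  2 its amplitude inverts an integral with infinite slopes, so derivatives are found off a discrete
  set of parameters and then extended by continuity. The nontrivial models generalize the motions of
  a pendulum, with \<open>|k|^p\<close> proportional to h + cos of the angle. For |h| < 1 the angle
  swings and the extreme values of sin(angle / 2) are q and -q, so q^2 = (1 + h) / 2; h = 1 is the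
  separatrix; for h > 1 the angle rotates and q^2 = 2 / (1 + h). The law for h is evaluated at one
  point only: with equal angles and nonnegative curvatures it makes the heights agree, a horizontal
  translation adjusts the other coordinate, and uniqueness does the rest.\<close>

section \<open>Signed powers\<close>

text \<open>The map |x|^(a-1) x of the Euler-Lagrange equation, in a form that is multiplicative and
  whose exponents multiply under composition; thus \<open>spow (1 / (p - 1))\<close> recovers the
  curvature from \<open>u\<close>.\<close>

definition spow :: "real \<Rightarrow> real \<Rightarrow> real" where
  "spow a x = sgn x * \<bar>x\<bar> powr a"

lemma abs_powr_times: "\<bar>x\<bar> powr a * x = spow (a + 1) x"
  by (cases "x = 0") (auto simp: spow_def powr_add sgn_if)

lemma spow_0 [simp]: "spow a 0 = 0"
  by (simp add: spow_def)

lemma spow_nonneg: "0 \<le> x \<Longrightarrow> spow a x = x powr a"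
  by (cases "x = 0") (auto simp: spow_def)

lemma spow_minus: "spow a (- x) = - spow a x"
  by (simp add: spow_def sgn_minus)

lemma spow_one: "spow 1 x = x"
  by (simp add: spow_def sgn_mult_abs)

lemma spow_mult: "spow a (x * y) = spow a x * spow a y"
  by (simp add: spow_def sgn_mult abs_mult powr_mult)

lemma abs_spow: "\<bar>spow a x\<bar> = \<bar>x\<bar> powr a"
  by (simp add: spow_def abs_mult sgn_if)

lemma sgn_spow: "sgn (spow a x) = sgn x"
  by (simp add: spow_def sgn_mult) (simp add: sgn_if)

lemma spow_spow: "spow a (spow b x) = spow (a * b) x"
  by (simp add: spow_def[of a] abs_spow sgn_spow powr_powr) (simp add: spow_def mult.commute)

lemma has_real_derivative_spow:
  assumes "x \<noteq> 0"
  shows "(spow a has_real_derivative a * \<bar>x\<bar> powr (a - 1)) (at x)"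
proof (cases "x > 0")
  case True
  have "((\<lambda>x. x powr a) has_real_derivative a * x powr (a - 1)) (at x)"
    using True by (auto intro!: derivative_eq_intros simp: powr_diff)
  moreover have "\<forall>\<^sub>F y in nhds x. spow a y = y powr a"
    using eventually_nhds_in_open[of "{0<..}" x] True
    by (auto elim!: eventually_mono simp: spow_nonneg)
  ultimately show ?thesis
    using True by (subst DERIV_cong_ev[OF refl _ refl]) auto
next
  case False
  then have neg: "x < 0" using assms by simp
  have "((\<lambda>x. - ((- x) powr a)) has_real_derivative a * \<bar>x\<bar> powr (a - 1)) (at x)"
    using neg by (auto intro!: derivative_eq_intros simp: powr_diff)
  moreover have "\<forall>\<^sub>F y in nhds x. spow a y = - ((- y) powr a)"
    using eventually_nhds_in_open[of "{..<0}" x] neg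
    by (auto elim!: eventually_mono simp: spow_def)
  ultimately show ?thesis
    by (subst DERIV_cong_ev[OF refl _ refl]) auto
qed

lemma DERIV_spow:
  assumes "(g has_real_derivative d) (at x within S)" "g x \<noteq> 0"
  shows "((\<lambda>x. spow a (g x)) has_real_derivative a * \<bar>g x\<bar> powr (a - 1) * d) (at x within S)"
  using DERIV_chain2[where f = "spow a" and g = g] has_real_derivative_spow[of "g x" a] assms by blast

lemma DERIV_powr_const:
  fixes g :: "real \<Rightarrow> real"
  assumes "(g has_real_derivative d) (at x)" "g x > 0"
  shows "((\<lambda>x. g x powr a) has_real_derivative a * g x powr (a - 1) * d) (at x)"
  using DERIV_fun_powr[OF assms, of a] by simp

lemma continuous_on_spow:
  assumes "a > 0"
  shows "continuous_on A (spow a)"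
proof -
  have "isCont (spow a) x" for x
  proof (cases "x = 0")
    case True
    have "((\<lambda>x::real. \<bar>x\<bar> powr a) \<longlongrightarrow> \<bar>0\<bar> powr a) (at 0)"
      using assms by (intro tendsto_powr' tendsto_intros) auto
    then have "((\<lambda>x::real. \<bar>spow a x\<bar>) \<longlongrightarrow> 0) (at 0)"
      by (simp add: abs_spow)
    then show ?thesis
      by (simp add: True isCont_def tendsto_rabs_zero_iff)
  next
    case False
    then show ?thesis
      using DERIV_isCont has_real_derivative_spow by blast
  qed
  then show ?thesis
    by (simp add: continuous_at_imp_continuous_on)
qed

lemma spow_lipschitz:
  assumes "a \<ge> 1" "\<bar>x\<bar> \<le> B" "\<bar>y\<bar> \<le> B"
  shows "\<bar>spow a x - spow a y\<bar> \<le> a * B powr (a - 1) * \<bar>x - y\<bar>"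
proof -
  \<comment> \<open>The mean value theorem is used on one side of 0 only, because
    \<open>has_real_derivative_spow\<close> leaves out 0; the general case is split at 0
    below.\<close>
  have main: "\<bar>spow a x - spow a y\<bar> \<le> a * B powr (a - 1) * (x - y)"
    if xy: "y \<le> x" "\<bar>x\<bar> \<le> B" "\<bar>y\<bar> \<le> B" and s: "0 \<le> y \<or> x \<le> 0" for x y
  proof (cases "x = y")
    case False
    then have "y < x" using xy by simp
    moreover have "(spow a has_real_derivative a * \<bar>z\<bar> powr (a - 1)) (at z)" if "y < z" "z < x" for z
      using has_real_derivative_spow[of z] that s by auto
    moreover have "continuous_on {y..x} (spow a)" using continuous_on_spow assms by simp
    ultimately obtain z where z: "z \<in> {y<..<x}"
        "spow a x - spow a y = a * \<bar>z\<bar> powr (a - 1) * (x - y)"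
      using mvt[of y x "spow a" "\<lambda>z. (*) (a * \<bar>z\<bar> powr (a - 1))"]
      unfolding has_field_derivative_def by (metis greaterThanLessThan_iff)
    have "\<bar>z\<bar> \<le> B" using z xy by auto
    then have "\<bar>z\<bar> powr (a - 1) \<le> B powr (a - 1)"
      using assms by (intro powr_mono2) auto
    then have "(x - y) * (a * \<bar>z\<bar> powr (a - 1)) \<le> (x - y) * (a * B powr (a - 1))"
      using assms \<open>y < x\<close> by (intro mult_left_mono) auto
    moreover have "0 \<le> (x - y) * (a * \<bar>z\<bar> powr (a - 1))" using assms \<open>y < x\<close> by simp
    ultimately show ?thesis using z by (simp add: mult_ac)
  qed simp
  have le: "\<bar>spow a x - spow a y\<bar> \<le> a * B powr (a - 1) * (x - y)"
    if xy: "y \<le> x" "\<bar>x\<bar> \<le> B" "\<bar>y\<bar> \<le> B" for x y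
  proof (cases "0 \<le> y \<or> x \<le> 0")
    case False
    have "\<bar>spow a x - spow a y\<bar> \<le> \<bar>spow a x - spow a 0\<bar> + \<bar>spow a 0 - spow a y\<bar>" by simp
    also have "\<dots> \<le> a * B powr (a - 1) * (x - 0) + a * B powr (a - 1) * (0 - y)"
      using False xy by (intro add_mono main) auto
    finally show ?thesis by (simp add: algebra_simps)
  qed (use main xy in blast)
  show ?thesis
  proof (cases "y \<le> x")
    case True then show ?thesis using le[of y x] assms by simp
  next
    case False then show ?thesis using le[of x y] assms by (simp add: abs_minus_commute)
  qed
qed

section \<open>Integrals from 0 as functions of the upper endpoint\<close>

text \<open>Nonnegativity makes gauge integrability absolute, and Borel measurability carries it
  from \<open>lebesgue\<close> to \<open>lborel\<close>. This opens the gauge calculus for the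
  oriented integrals of the definitions, also for unbounded integrands. \<open>D\<close> will be the
  whole line or, for the modulus 1, an open interval.\<close>

lemma interval_integral_diff:
  fixes f :: "real \<Rightarrow> real"
  assumes "is_interval D" "0 \<in> D" and int: "\<And>a b. a \<in> D \<Longrightarrow> b \<in> D \<Longrightarrow> f integrable_on {a..b}"
    and nn: "\<And>x. 0 \<le> f x" and meas: "f \<in> borel_measurable borel"
    and ab: "a \<in> D" "b \<in> D" "a \<le> b"
  shows "(LBINT t=0..b. f t) - (LBINT t=0..a. f t) = integral {a..b} f"
proof -
  have si: "set_integrable lborel {x..y} f" if "x \<in> D" "y \<in> D" for x y
  proof -
    have "set_integrable lebesgue {x..y} f"
      using int[OF that] nn by (intro nonnegative_absolutely_integrable_1) auto
    then show ?thesis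
      unfolding set_integrable_def using meas
      by (subst (asm) integrable_completion) auto
  qed
  let ?m = "min 0 (min a b)" and ?M = "max 0 (max a b)"
  have mM: "?m \<in> D" "?M \<in> D" using ab assms(2) by (auto simp: min_def max_def)
  have "set_integrable lborel (einterval (ereal ?m) (ereal ?M)) f"
    by (rule set_integrable_subset[OF si[OF mM]])
      (auto simp: einterval_eq simp del: ereal_min ereal_max)
  moreover have "ereal ?m \<le> ereal ?M" unfolding ereal_less_eq by linarith
  ultimately have "interval_lebesgue_integrable lborel (ereal ?m) (ereal ?M) f"
    unfolding interval_lebesgue_integrable_def by presburger
  then have "interval_lebesgue_integrable lborel (min (ereal 0) (min (ereal a) (ereal b)))
      (max (ereal 0) (max (ereal a) (ereal b))) f"
    by simp
  then have "(LBINT t=ereal 0..a. f t) + (LBINT t=a..b. f t) = (LBINT t=ereal 0..b. f t)"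
    by (rule interval_integral_sum)
  moreover have "(LBINT t=a..b. f t) = integral {a..b} f"
    using ab si by (intro interval_integral_eq_integral) auto
  ultimately show ?thesis by (simp add: zero_ereal_def)
qed

lemma interval_integral_deriv:
  fixes f :: "real \<Rightarrow> real"
  assumes D: "is_interval D" "open D" "0 \<in> D" and int: "\<And>a b. a \<in> D \<Longrightarrow> b \<in> D \<Longrightarrow> f integrable_on {a..b}"
    and nn: "\<And>x. 0 \<le> f x" and meas: "f \<in> borel_measurable borel"
    and x: "x \<in> D" "isCont f x"
  shows "((\<lambda>x. LBINT t=0..x. f t) has_real_derivative f x) (at x)"
proof -
  obtain e where e: "e > 0" "cball x e \<subseteq> D"
    using D x open_contains_cball by blast
  \<comment> \<open>Based at x - e instead of 0, the integral has x inside its interval whatever the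
    sign of x.\<close>
  let ?a = "x - e" and ?b = "x + e"
  have sub: "{?a..?b} \<subseteq> D" using e by (auto simp: cball_def dist_real_def subset_eq)
  have ab: "?a \<in> D" "?b \<in> D" using sub e by auto
  have "((\<lambda>u. integral {?a..u} f) has_vector_derivative f x) (at x within ({?a..?b} - {}))"
    using e x int[OF ab] by (intro integral_has_vector_derivative_continuous_at) (auto intro: continuous_at_imp_continuous_within)
  then have "((\<lambda>u. integral {?a..u} f) has_real_derivative f x) (at x within {?a<..<?b})"
    by (auto simp: has_real_derivative_iff_has_vector_derivative intro: has_vector_derivative_within_subset)
  then have "((\<lambda>u. integral {?a..u} f) has_real_derivative f x) (at x)"
    using e by (subst (asm) at_within_open) auto
  then have "((\<lambda>u. (LBINT t=0..?a. f t) + integral {?a..u} f) has_real_derivative f x) (at x)"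
    by (auto intro!: derivative_eq_intros)
  then show ?thesis
  proof (rule has_field_derivative_transform_within_open[where S="{?a<..<?b}"])
    fix u assume u: "u \<in> {?a<..<?b}"
    then have "u \<in> D" using sub by auto
    then show "(LBINT t=0..?a. f t) + integral {?a..u} f = (LBINT t=0..u. f t)"
      using interval_integral_diff[OF D(1) D(3) int nn meas ab(1), of u] u by auto
  qed (use e in auto)
qed

lemma interval_integral_continuous_on:
  fixes f :: "real \<Rightarrow> real"
  assumes D: "is_interval D" "open D" "0 \<in> D" and int: "\<And>a b. a \<in> D \<Longrightarrow> b \<in> D \<Longrightarrow> f integrable_on {a..b}"
    and nn: "\<And>x. 0 \<le> f x" and meas: "f \<in> borel_measurable borel"
  shows "continuous_on D (\<lambda>x. LBINT t=0..x. f t)"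
proof -
  have "isCont (\<lambda>x::real. LBINT t=0..x. f t) x" if x: "x \<in> D" for x
  proof -
    obtain e where e: "e > 0" "cball x e \<subseteq> D"
      using D x open_contains_cball by blast
    let ?a = "x - e" and ?b = "x + e"
    have sub: "{?a..?b} \<subseteq> D" using e by (auto simp: cball_def dist_real_def subset_eq)
    have ab: "?a \<in> D" "?b \<in> D" using sub e by auto
    have "continuous_on {?a..?b} (\<lambda>u. (LBINT t=0..?a. f t) + integral {?a..u} f)"
      using int[OF ab] by (intro continuous_intros indefinite_integral_continuous_1)
    moreover have "(LBINT t=0..?a. f t) + integral {?a..u} f = (LBINT t=0..u. f t)"
      if "u \<in> {?a..?b}" for u
      using interval_integral_diff[OF D(1) D(3) int nn meas ab(1), of u] that sub by auto
    ultimately have "continuous_on {?a..?b} (\<lambda>u. LBINT t=0..u. f t)"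
      by (auto intro: continuous_on_eq)
    then have "continuous_on {?a<..<?b} (\<lambda>u. LBINT t=0..u. f t)"
      by (rule continuous_on_subset) auto
    then show ?thesis
      using e by (auto simp: continuous_on_eq_continuous_at)
  qed
  then show ?thesis by (simp add: continuous_at_imp_continuous_on)
qed

text \<open>This quantitative monotonicity survives points of infinite slope, where no derivative
  exists. The null set Z takes the zeros of the cosine, at which \<open>0 powr e = 0\<close>
  violates the bound on the integrand.\<close>

lemma interval_integral_expansive:
  fixes f :: "real \<Rightarrow> real"
  assumes D: "is_interval D" "0 \<in> D" and int: "\<And>a b. a \<in> D \<Longrightarrow> b \<in> D \<Longrightarrow> f integrable_on {a..b}"
    and nn: "\<And>x. 0 \<le> f x" and meas: "f \<in> borel_measurable borel"
    and Z: "negligible Z" "\<And>x. x \<in> D \<Longrightarrow> x \<notin> Z \<Longrightarrow> 1 \<le> f x"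
    and xy: "x \<in> D" "y \<in> D" "x \<le> y"
  shows "y - x \<le> (LBINT t=0..y. f t) - (LBINT t=0..x. f t)"
proof -
  have sub: "{x..y} \<subseteq> D" using mem_is_interval_1_I[OF D(1) xy(1,2)] by auto
  let ?g = "\<lambda>t. if t \<in> Z then 1 else f t"
  have g: "?g integrable_on {x..y}"
    by (rule integrable_spike[OF int[OF xy(1,2)] Z(1)]) simp
  have "integral {x..y} (\<lambda>t. 1) \<le> integral {x..y} ?g"
  proof (rule integral_le[OF _ g])
    show "1 \<le> ?g t" if "t \<in> {x..y}" for t using Z(2)[of t] sub that by auto
  qed (rule integrable_const_ivl)
  also have "\<dots> = integral {x..y} f"
    using Z(1) by (rule integral_spike[symmetric]) auto
  also have "\<dots> = (LBINT t=0..y. f t) - (LBINT t=0..x. f t)"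
    using interval_integral_diff[OF D int nn meas xy] by simp
  finally show ?thesis using xy by simp
qed

section \<open>Inverses of expansive functions\<close>

text \<open>Expansion of F is a Lipschitz bound with constant 1 for the inverse, which is therefore
  continuous whatever the regularity of F. The inverse function rule then asks only for a nonzero
  derivative of F at one point.\<close>

lemma expansive_inverse:
  fixes F :: "real \<Rightarrow> real"
  assumes exp: "\<And>x y. x \<in> D \<Longrightarrow> y \<in> D \<Longrightarrow> x \<le> y \<Longrightarrow> y - x \<le> F y - F x"
    and surj: "F ` D = UNIV"
  shows "inv_into D F s \<in> D" "F (inv_into D F s) = s" "x \<in> D \<Longrightarrow> inv_into D F (F x) = x"
    "continuous_on UNIV (inv_into D F)"
    "(F has_real_derivative d) (at (inv_into D F s)) \<Longrightarrow> d \<noteq> 0 \<Longrightarrow>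
      (inv_into D F has_real_derivative 1 / d) (at s)"
proof -
  let ?A = "inv_into D F"
  show A: "?A s \<in> D" "F (?A s) = s" for s
    using surj inv_into_into[of s F D] f_inv_into_f[of s F D] by auto
  have "inj_on F D"
    by (rule linorder_inj_onI) (use exp in force)+
  then show "x \<in> D \<Longrightarrow> ?A (F x) = x" by simp
  have "\<bar>?A s - ?A t\<bar> \<le> \<bar>s - t\<bar>" for s t
    using exp[OF A(1)[of s] A(1)[of t]] exp[OF A(1)[of t] A(1)[of s]] A(2)[of s] A(2)[of t] by linarith
  then have "1-lipschitz_on UNIV ?A"
    by (auto simp: lipschitz_on_def dist_real_def)
  then show c: "continuous_on UNIV ?A" by (rule lipschitz_on_continuous_on)
  assume "(F has_real_derivative d) (at (?A s))" "d \<noteq> 0"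
  then have "(?A has_real_derivative inverse d) (at s)"
    using A(2) c by (intro DERIV_inverse_function[where f = F and a = "s - 1" and b = "s + 1"])
      (auto simp: continuous_on_eq_continuous_at)
  then show "(?A has_real_derivative 1 / d) (at s)" by (simp add: divide_inverse)
qed

text \<open>Between 0 and x the function moves by at least |x|, so the value s is bracketed within
  distance |s - F 0| of the origin.\<close>

lemma expansive_surj:
  fixes F :: "real \<Rightarrow> real"
  assumes exp: "\<And>x y. x \<le> y \<Longrightarrow> y - x \<le> F y - F x" and "continuous_on UNIV F"
  shows "range F = UNIV"
proof -
  have "\<exists>x. F x = s" for s
  proof -
    let ?d = "\<bar>s - F 0\<bar>"
    have "F (- ?d) \<le> s" "s \<le> F ?d" using exp[of "- ?d" 0] exp[of 0 ?d] by linarith+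
    then show ?thesis
      using IVT'[of F "- ?d" s ?d] continuous_on_subset[OF assms(2), of "{- ?d..?d}"] by auto
  qed
  then show ?thesis unfolding surj_def by (intro allI) (blast intro: sym)
qed

text \<open>The fundamental theorem with exceptional points writes f as an integral of the
  continuous D, and such an integral is differentiable everywhere. Used at the parameters where the
  amplitude passes a zero of the cosine.\<close>

lemma has_real_derivative_off_discrete:
  fixes f :: "real \<Rightarrow> real"
  assumes "continuous_on UNIV f" "continuous_on UNIV D" and Z: "\<And>a b. finite (Z \<inter> {a..b})"
    and der: "\<And>x. x \<notin> Z \<Longrightarrow> (f has_real_derivative D x) (at x)"
  shows "(f has_real_derivative D x) (at x)"
proof -
  let ?a = "x - 1" and ?b = "x + 1"
  have I: "(D has_integral (f u - f ?a)) {?a..u}" if "?a \<le> u" for u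
  proof (rule fundamental_theorem_of_calculus_strong[of "Z \<inter> {?a..u}"])
    show "continuous_on {?a..u} f" using assms(1) by (rule continuous_on_subset) simp
    show "(f has_vector_derivative D y) (at y)" if "y \<in> {?a..u} - Z \<inter> {?a..u}" for y
      using der[of y] that by (auto simp: has_real_derivative_iff_has_vector_derivative)
  qed (use Z that in auto)
  have "((\<lambda>u. integral {?a..u} D) has_real_derivative D x) (at x within {?a..?b})"
    using assms(2) by (intro integral_has_real_derivative) (auto intro: continuous_on_subset)
  then have "((\<lambda>u. integral {?a..u} D) has_real_derivative D x) (at x)"
    using at_within_Icc_at[of ?a x ?b] by simp
  then have "((\<lambda>u. f ?a + integral {?a..u} D) has_real_derivative D x) (at x)"
    by (auto intro!: derivative_eq_intros)
  then show ?thesis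
  proof (rule has_field_derivative_transform_within_open[where S="{?a<..<?b}"])
    show "f ?a + integral {?a..u} D = f u" if "u \<in> {?a<..<?b}" for u
      using integral_unique[OF I[of u]] that by simp
  qed auto
qed

section \<open>Derivatives of plane curves; the line and the circle\<close>

lemma vector_2_eq: "vector [x, y] = (x *\<^sub>R axis 1 1 + y *\<^sub>R axis 2 1 :: real^2)"
  by (simp add: vec_eq_iff forall_2 axis_def)

lemma has_vector_derivative_vector_2:
  fixes f g :: "real \<Rightarrow> real"
  assumes "(f has_real_derivative a) F" "(g has_real_derivative b) F"
  shows "((\<lambda>s. vector [f s, g s] :: real^2) has_vector_derivative vector [a, b]) F"
  unfolding vector_2_eq
  using assms
  by (intro has_vector_derivative_add bounded_linear.has_vector_derivative[OF bounded_linear_scaleR_left])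
    (simp_all add: has_real_derivative_iff_has_vector_derivative)

lemma has_angle_curvature_linear: "has_angle_curvature linear_curve (\<lambda>s. 0) (\<lambda>s. 0)"
  unfolding has_angle_curvature_def linear_curve_def
  by (auto intro!: has_vector_derivative_vector_2 derivative_eq_intros)

lemma has_angle_curvature_circular: "has_angle_curvature circular_curve (\<lambda>s. s + pi / 2) (\<lambda>s. 1)"
  unfolding has_angle_curvature_def circular_curve_def
  by (auto intro!: has_vector_derivative_vector_2 derivative_eq_intros simp: sin_add cos_add)

section \<open>Integrability of powers of the cosine\<close>

definition cos_zeros :: "real set" where
  "cos_zeros = {x. cos x = 0}"

lemma finite_cos_zeros: "finite (cos_zeros \<inter> {a..b})"
proof -
  \<comment> \<open>The slack of 2 absorbs the shift by pi / 2 and the rounding.\<close>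
  have "cos_zeros \<inter> {a..b} \<subseteq> (\<lambda>n::int. of_int n * pi + pi / 2) ` {\<lfloor>a / pi\<rfloor> - 2..\<lceil>b / pi\<rceil> + 2}"
  proof
    fix x assume x: "x \<in> cos_zeros \<inter> {a..b}"
    then obtain n :: int where n: "x = of_int n * pi + pi / 2"
      using cos_zero_iff_int2[of x] by (auto simp: cos_zeros_def)
    have "x / pi = of_int n + 1 / 2" using n by (simp add: field_simps)
    moreover have "a / pi \<le> x / pi" "x / pi \<le> b / pi"
      using x pi_gt_zero by (auto intro: divide_right_mono)
    ultimately have "n \<in> {\<lfloor>a / pi\<rfloor> - 2..\<lceil>b / pi\<rceil> + 2}"
      by simp linarith
    with n show "x \<in> (\<lambda>n::int. of_int n * pi + pi / 2) ` {\<lfloor>a / pi\<rfloor> - 2..\<lceil>b / pi\<rceil> + 2}"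
      by blast
  qed
  then show ?thesis by (rule finite_subset) simp
qed

lemma negligible_cos_zeros: "negligible cos_zeros"
proof -
  have "cos_zeros = (\<Union>n::nat. cos_zeros \<inter> {- real n..real n})"
  proof (intro equalityI subsetI)
    fix x assume "x \<in> cos_zeros"
    moreover obtain n :: nat where "\<bar>x\<bar> \<le> real n" using real_arch_simple by blast
    ultimately show "x \<in> (\<Union>n::nat. cos_zeros \<inter> {- real n..real n})" by (force simp: abs_le_iff)
  qed auto
  moreover have "countable (\<Union>n::nat. cos_zeros \<inter> {- real n..real n})"
    by (intro countable_UN[OF countableI_type] countable_finite[OF finite_cos_zeros])
  ultimately have "cos_zeros \<in> null_sets lborel"
    using countable_imp_null_set_lborel by simp
  then show ?thesis by (simp add: negligible_iff_null_sets null_sets_completionI)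
qed

text \<open>Off the zeros of the cosine, \<open>(e + 1) \<bar>cos\<bar>\<^sup>e - (e + 2) \<bar>cos\<bar>\<^sup>e\<^sup>+\<^sup>2\<close> is the derivative of a continuous
  function, which gives integrability across the singularities without a comparison function.\<close>

lemma abs_cos_powr_integrable:
  fixes e :: real
  assumes "e > - 1"
  shows "(\<lambda>\<theta>. \<bar>cos \<theta>\<bar> powr e) integrable_on {a..b}"
proof (cases "a \<le> b")
  case True
  let ?W = "\<lambda>\<theta>. - spow (e + 1) (cos \<theta>) * sin \<theta>"
  let ?w = "\<lambda>\<theta>. (e + 1) * \<bar>cos \<theta>\<bar> powr e - (e + 2) * \<bar>cos \<theta>\<bar> powr (e + 2)"
  have "(?w has_integral (?W b - ?W a)) {a..b}"
  proof (rule fundamental_theorem_of_calculus_strong[of "cos_zeros \<inter> {a..b}"])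
    show "continuous_on {a..b} ?W"
      using assms by (intro continuous_intros continuous_on_compose2[OF continuous_on_spow[of "e + 1" UNIV]]) auto
    show "(?W has_vector_derivative ?w x) (at x)" if "x \<in> {a..b} - cos_zeros \<inter> {a..b}" for x
    proof -
      have nz: "cos x \<noteq> 0" using that by (auto simp: cos_zeros_def)
      have "(?W has_real_derivative
          - (((e + 1) * \<bar>cos x\<bar> powr (e + 1 - 1)) * - sin x) * sin x + - spow (e + 1) (cos x) * cos x) (at x)"
        by (rule derivative_eq_intros DERIV_spow refl nz | simp)+
      moreover have "- (((e + 1) * \<bar>cos x\<bar> powr (e + 1 - 1)) * - sin x) * sin x + - spow (e + 1) (cos x) * cos x = ?w x"
      proof -
        have 1: "spow (e + 1) (cos x) * cos x = \<bar>cos x\<bar> powr (e + 2)"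
          using nz by (simp add: spow_def powr_add sgn_if power2_eq_square)
        have 2: "\<bar>cos x\<bar> powr (e + 2) = \<bar>cos x\<bar> powr e * (cos x)\<^sup>2"
          using nz by (simp add: powr_add power2_eq_square)
        have 3: "sin x * sin x = 1 - (cos x)\<^sup>2" by (simp add: sin_squared_eq flip: power2_eq_square)
        have "- (((e + 1) * \<bar>cos x\<bar> powr (e + 1 - 1)) * - sin x) * sin x
            = (e + 1) * \<bar>cos x\<bar> powr e * (sin x * sin x)" by simp
        then show ?thesis using 1 2 3 by (simp add: algebra_simps)
      qed
      ultimately show ?thesis by (simp add: has_real_derivative_iff_has_vector_derivative)
    qed
  qed (use True finite_cos_zeros in auto)
  then have "?w integrable_on {a..b}" by blast
  \<comment> \<open>This term is continuous, as e + 2 > 0; adding it back isolates the singular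
    power.\<close>
  moreover have "(\<lambda>\<theta>. (e + 2) * \<bar>cos \<theta>\<bar> powr (e + 2)) integrable_on {a..b}"
    using assms by (intro integrable_continuous_interval continuous_intros continuous_on_powr') auto
  ultimately have "(\<lambda>\<theta>. ?w \<theta> + (e + 2) * \<bar>cos \<theta>\<bar> powr (e + 2)) integrable_on {a..b}"
    by (rule integrable_add)
  then have "(\<lambda>\<theta>. (e + 1) * \<bar>cos \<theta>\<bar> powr e) integrable_on {a..b}"
    by simp
  then show ?thesis using assms by (simp add: integrable_on_cmult_left_iff)
qed (simp add: integrable_on_empty)

lemma abs_cos_powr_mult_integrable:
  fixes e :: real
  assumes "e > - 1" "continuous_on UNIV h"
  shows "(\<lambda>\<theta>. h \<theta> * \<bar>cos \<theta>\<bar> powr e) integrable_on {a..b}"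
proof -
  have "(\<lambda>\<theta>. \<bar>cos \<theta>\<bar> powr e) absolutely_integrable_on {a..b}"
    by (intro nonnegative_absolutely_integrable_1 abs_cos_powr_integrable assms) simp
  moreover have h: "continuous_on {a..b} h" using assms(2) continuous_on_subset by blast
  then have "bounded (h ` {a..b})" by (intro compact_imp_bounded compact_continuous_image) auto
  ultimately have "(\<lambda>\<theta>. h \<theta> * \<bar>cos \<theta>\<bar> powr e) absolutely_integrable_on {a..b}"
    using h by (intro absolutely_integrable_bounded_measurable_product_real
      continuous_imp_measurable_on_sets_lebesgue) auto
  then show ?thesis by (rule absolutely_integrable_on_def[THEN iffD1, THEN conjunct1])
qed

lemma abs_cos_powr_ge_1:
  fixes e \<theta> :: real
  assumes "e \<le> 0" "cos \<theta> \<noteq> 0"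
  shows "1 \<le> \<bar>cos \<theta>\<bar> powr e"
proof -
  have "\<bar>cos \<theta>\<bar> powr 0 \<le> \<bar>cos \<theta>\<bar> powr e"
    using assms by (intro powr_mono') auto
  then show ?thesis using assms by simp
qed

lemma modulus_bounds:
  fixes q \<theta> :: real
  assumes "0 \<le> q" "q < 1"
  shows "0 < 1 - q\<^sup>2 * (sin \<theta>)\<^sup>2" "1 - q\<^sup>2 * (sin \<theta>)\<^sup>2 \<le> 1"
proof -
  have "q\<^sup>2 * (sin \<theta>)\<^sup>2 \<le> q\<^sup>2" using sin_squared_eq[of \<theta>] by (simp add: mult_left_le)
  moreover have "q\<^sup>2 < 1" using assms by (simp add: power_less_one_iff)
  ultimately show "0 < 1 - q\<^sup>2 * (sin \<theta>)\<^sup>2" by linarith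
qed simp

text \<open>The image of [a, b] is bounded, so it meets Z in finitely many points, and injectivity
  allows one preimage for each.\<close>

lemma finite_expansive_vimage:
  fixes A :: "real \<Rightarrow> real"
  assumes "continuous_on UNIV A" "inj A" "\<And>a b. finite (Z \<inter> {a..b})"
  shows "finite (A -` Z \<inter> {a..b})"
proof -
  have "compact (A ` {a..b})"
    using assms(1) by (intro compact_continuous_image) (auto intro: continuous_on_subset)
  then obtain c where c: "\<And>x. x \<in> A ` {a..b} \<Longrightarrow> \<bar>x\<bar> \<le> c"
    using compact_imp_bounded bounded_real by metis
  have "A -` Z \<inter> {a..b} = A -` (Z \<inter> {- c..c}) \<inter> {a..b}" using c by (force simp: abs_le_iff)
  then show ?thesis
    using finite_vimage_IntI[OF assms(3)] assms(2) by (metis inj_on_subset subset_UNIV)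
qed

section \<open>Wavelike curves\<close>

context
  fixes p q :: real
  assumes p: "1 < p" "p \<le> 2" and q: "0 < q" "q < 1"
begin

text \<open>The lower bound makes |cos|^(1 - 2/p) integrable across the zeros of the cosine; the
  upper one, which is p \<le> 2, makes it at least 1 elsewhere.\<close>

lemma exponent_bounds: "- 1 < 1 - 2 / p" "1 - 2 / p \<le> 0"
  using p by (auto simp: field_simps)

lemma modulus: "0 < 1 - q\<^sup>2 * (sin \<theta>)\<^sup>2" "1 - q\<^sup>2 * (sin \<theta>)\<^sup>2 \<le> 1"
  using modulus_bounds[of q] q by auto

lemma F1_eq: "F1 p x q = (LBINT \<theta>=0..x. 1 / sqrt (1 - q\<^sup>2 * (sin \<theta>)\<^sup>2) * \<bar>cos \<theta>\<bar> powr (1 - 2 / p))"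
  using q by (simp add: F1_def)

text \<open>Both factors of the integrand are at least 1 off the zeros of the cosine; this gives the
  expansion, and the expansion gives surjectivity.\<close>

lemma F1_props:
  shows "x \<le> y \<Longrightarrow> y - x \<le> F1 p y q - F1 p x q"
    and "range (\<lambda>x. F1 p x q) = UNIV"
    and "cos x \<noteq> 0 \<Longrightarrow> ((\<lambda>x. F1 p x q) has_real_derivative
           \<bar>cos x\<bar> powr (1 - 2 / p) / sqrt (1 - q\<^sup>2 * (sin x)\<^sup>2)) (at x)"
proof -
  let ?h = "\<lambda>\<theta>. 1 / sqrt (1 - q\<^sup>2 * (sin \<theta>)\<^sup>2)"
  let ?f = "\<lambda>\<theta>. ?h \<theta> * \<bar>cos \<theta>\<bar> powr (1 - 2 / p)"
  have h: "continuous_on UNIV ?h" using modulus(1) by (intro continuous_intros) (simp add: less_imp_neq[THEN not_sym])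
  have int: "?f integrable_on {a..b}" for a b
    using exponent_bounds h by (intro abs_cos_powr_mult_integrable) auto
  have nn: "0 \<le> ?f x" for x using modulus(1)[of x] by (simp add: less_imp_le)
  have meas: "?f \<in> borel_measurable borel" by measurable
  have ge1: "1 \<le> ?f x" if "x \<notin> cos_zeros" for x
  proof -
    have "1 \<le> \<bar>cos x\<bar> powr (1 - 2 / p)"
      using that exponent_bounds by (intro abs_cos_powr_ge_1) (auto simp: cos_zeros_def)
    moreover have "1 \<le> ?h x" using modulus[of x] by simp
    ultimately have "1 * 1 \<le> ?h x * \<bar>cos x\<bar> powr (1 - 2 / p)"
      using modulus[of x] by (intro mult_mono) auto
    then show ?thesis by simp
  qed
  note base = is_interval_univ open_UNIV UNIV_I[of 0]
  show e: "y - x \<le> F1 p y q - F1 p x q" if "x \<le> y" for x y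
    unfolding F1_eq 
    by (rule interval_integral_expansive[where D = UNIV and Z = cos_zeros])
      (rule base int nn meas negligible_cos_zeros ge1 that UNIV_I | assumption)+
  have c0: "continuous_on UNIV (\<lambda>x. F1 p x q)"
    unfolding F1_eq by (rule interval_integral_continuous_on[OF base int nn meas])
  show "range (\<lambda>x. F1 p x q) = UNIV"
    by (rule expansive_surj[of "\<lambda>x. F1 p x q"]) (rule e c0 | assumption)+
  assume x: "cos x \<noteq> 0"
  have "isCont ?f x"
    using x modulus(1)[of x] by (intro continuous_intros) auto
  then show "((\<lambda>x. F1 p x q) has_real_derivative
           \<bar>cos x\<bar> powr (1 - 2 / p) / sqrt (1 - q\<^sup>2 * (sin x)\<^sup>2)) (at x)"
    unfolding F1_eq using interval_integral_deriv[OF base int nn meas] by simp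
qed

lemma am1_eq: "am1 p s q = inv_into UNIV (\<lambda>x. F1 p x q) s"
  using q by (simp add: am1_def F_dom_def)

text \<open>The zeros of the cosine are left out of the derivative rule because for p < 2 the slope
  of \<open>F1\<close> is infinite there. By the last clause they occur at a discrete set of
  parameters, where continuity takes over.\<close>

lemma am1_props:
  shows "F1 p (am1 p s q) q = s" "am1 p (F1 p x q) q = x" "continuous_on UNIV (\<lambda>s. am1 p s q)"
    "cos (am1 p s q) \<noteq> 0 \<Longrightarrow> ((\<lambda>s. am1 p s q) has_real_derivative
        sqrt (1 - q\<^sup>2 * (sin (am1 p s q))\<^sup>2) * \<bar>cos (am1 p s q)\<bar> powr (2 / p - 1)) (at s)"
    "finite ({s. cos (am1 p s q) = 0} \<inter> {a..b})"
proof -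
  note inv = expansive_inverse[of UNIV "\<lambda>x. F1 p x q", OF F1_props(1,2), folded am1_eq]
  show F: "F1 p (am1 p s q) q = s" for s using inv(2) by simp
  show "am1 p (F1 p x q) q = x" using inv(3) by simp
  show c: "continuous_on UNIV (\<lambda>s. am1 p s q)" using inv(4) by (simp add: am1_eq)
  have "inj (\<lambda>s. am1 p s q)" by (metis F injI)
  from finite_expansive_vimage[OF c this finite_cos_zeros]
  show "finite ({s. cos (am1 p s q) = 0} \<inter> {a..b})" by (simp add: cos_zeros_def vimage_def)
  assume nz: "cos (am1 p s q) \<noteq> 0"
  let ?d = "\<bar>cos (am1 p s q)\<bar> powr (1 - 2 / p) / sqrt (1 - q\<^sup>2 * (sin (am1 p s q))\<^sup>2)"
  have "?d \<noteq> 0" using nz modulus(1)[of "am1 p s q"] by simp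
  then have "((\<lambda>s. am1 p s q) has_real_derivative 1 / ?d) (at s)"
    using expansive_inverse(5)[of UNIV "\<lambda>x. F1 p x q" ?d s, OF F1_props(1,2)] F1_props(3)[OF nz] by (simp add: am1_eq)
  moreover have "1 / ?d = sqrt (1 - q\<^sup>2 * (sin (am1 p s q))\<^sup>2) * \<bar>cos (am1 p s q)\<bar> powr (2 / p - 1)"
    using powr_minus_divide[of "\<bar>cos (am1 p s q)\<bar>" "1 - 2 / p"] by simp
  ultimately show "((\<lambda>s. am1 p s q) has_real_derivative
        sqrt (1 - q\<^sup>2 * (sin (am1 p s q))\<^sup>2) * \<bar>cos (am1 p s q)\<bar> powr (2 / p - 1)) (at s)" by simp
qed

lemma cn_eq: "cn p s q = spow (2 / p) (cos (am1 p s q))"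
  unfolding cn_def by (simp add: abs_powr_times)

lemma has_real_derivative_E1:
  assumes "cos x \<noteq> 0"
  shows "((\<lambda>x. E1 p x q) has_real_derivative sqrt (1 - q\<^sup>2 * (sin x)\<^sup>2) * \<bar>cos x\<bar> powr (1 - 2 / p)) (at x)"
  unfolding E1_def
proof (rule interval_integral_deriv[where D = UNIV])
  let ?h = "\<lambda>\<theta>. sqrt (1 - q\<^sup>2 * (sin \<theta>)\<^sup>2)"
  have h: "continuous_on UNIV ?h" by (intro continuous_intros)
  show "(\<lambda>\<theta>. ?h \<theta> * \<bar>cos \<theta>\<bar> powr (1 - 2 / p)) integrable_on {a..b}" for a b
    using exponent_bounds h by (intro abs_cos_powr_mult_integrable) auto
  show "0 \<le> ?h x * \<bar>cos x\<bar> powr (1 - 2 / p)" for x using modulus(1)[of x] by (simp add: less_imp_le)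
  show "isCont (\<lambda>\<theta>. ?h \<theta> * \<bar>cos \<theta>\<bar> powr (1 - 2 / p)) x"
    using assms by (intro continuous_intros) auto
qed auto

lemma continuous_on_E1: "continuous_on UNIV (\<lambda>x. E1 p x q)"
  unfolding E1_def
proof (rule interval_integral_continuous_on[where D = UNIV])
  let ?h = "\<lambda>\<theta>. sqrt (1 - q\<^sup>2 * (sin \<theta>)\<^sup>2)"
  have h: "continuous_on UNIV ?h" by (intro continuous_intros)
  show "(\<lambda>\<theta>. ?h \<theta> * \<bar>cos \<theta>\<bar> powr (1 - 2 / p)) integrable_on {a..b}" for a b
    using exponent_bounds h by (intro abs_cos_powr_mult_integrable) auto
  show "0 \<le> ?h x * \<bar>cos x\<bar> powr (1 - 2 / p)" for x using modulus(1)[of x] by (simp add: less_imp_le)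
qed auto

lemma abs_sn_less_1: "\<bar>q * sn p s q\<bar> < 1"
proof -
  have "(q * sn p s q)\<^sup>2 < 1" using modulus(1)[of "am1 p s q"] by (simp add: sn_def power_mult_distrib)
  then show ?thesis by (simp add: abs_square_less_1)
qed

text \<open>Off the zeros of the cosine, in both coordinates, the factor |cos|^(1 - 2/p) from the
  integrand or from the power cancels |cos|^(2/p - 1) from the derivative of the amplitude. The
  resulting formulas are continuous and extend through the zeros; so does the one for the
  angle.\<close>

lemma has_angle_curvature_wavelike:
  "has_angle_curvature (wavelike_curve p q) (\<lambda>s. 2 * arcsin (q * sn p s q)) (\<lambda>s. 2 * q * cn p s q)"
proof -
  let ?a = "\<lambda>s. am1 p s q"
  let ?D = "\<lambda>s. 1 - q\<^sup>2 * (sin (?a s))\<^sup>2"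
  let ?Z = "{s. cos (?a s) = 0}"
  note [continuous_intros] = am1_props(3) continuous_on_compose2[OF continuous_on_E1]
    continuous_on_compose2[OF continuous_on_spow[of _ UNIV]]
  have cD: "continuous_on UNIV (\<lambda>s. sqrt (?D s))" by (intro continuous_intros)
  have sn: "\<bar>q * sin (?a s)\<bar> < 1" for s using abs_sn_less_1[of s] by (simp add: sn_def)
  have sn': "- 1 < q * sin (?a s)" "q * sin (?a s) < 1" "- 1 \<le> q * sin (?a s)" "q * sin (?a s) \<le> 1" for s
    using sn[of s] by (auto simp: abs_less_iff)
  \<comment> \<open>With sin(angle / 2) = q sn, the root \<open>sqrt (?D s)\<close> is cos(angle /
    2), which is nonnegative on the range of arcsin.\<close>
  have s2: "sin (2 * arcsin (q * sin (?a s))) = 2 * q * sin (?a s) * sqrt (?D s)" for s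
    using sn'[of s] by (simp add: sin_double cos_arcsin power_mult_distrib)
  have c2: "cos (2 * arcsin (q * sin (?a s))) = 2 * ?D s - 1" for s
    using sn'[of s] by (simp add: cos_double_sin power_mult_distrib)
  have pw: "\<bar>cos (?a s)\<bar> powr (1 - 2 / p) * \<bar>cos (?a s)\<bar> powr (2 / p - 1) = 1" if "s \<notin> ?Z" for s
    using that by (simp flip: powr_add)
  have pos: "0 < ?D s" for s using modulus(1) by simp
  have X: "((\<lambda>s. 2 * E1 p (?a s) q - s) has_real_derivative 2 * ?D s - 1) (at s)" for s
  proof (rule has_real_derivative_off_discrete[where Z = ?Z])
    fix s assume s: "s \<notin> ?Z"
    have "((\<lambda>s. 2 * E1 p (?a s) q - s) has_real_derivative
        2 * ((sqrt (?D s) * \<bar>cos (?a s)\<bar> powr (1 - 2 / p)) * (sqrt (?D s) * \<bar>cos (?a s)\<bar> powr (2 / p - 1))) - 1) (at s)"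
      using s by (auto intro!: derivative_eq_intros DERIV_chain2[OF has_real_derivative_E1] am1_props(4))
    moreover have "(sqrt (?D s) * \<bar>cos (?a s)\<bar> powr (1 - 2 / p)) * (sqrt (?D s) * \<bar>cos (?a s)\<bar> powr (2 / p - 1))
      = (sqrt (?D s) * sqrt (?D s)) * (\<bar>cos (?a s)\<bar> powr (1 - 2 / p) * \<bar>cos (?a s)\<bar> powr (2 / p - 1))" by (simp only: mult_ac)
    ultimately show "((\<lambda>s. 2 * E1 p (?a s) q - s) has_real_derivative 2 * ?D s - 1) (at s)"
      using pw[OF s] pos[of s] by (simp add: less_imp_le)
  qed (auto intro!: continuous_intros am1_props(5))
  have yeq: "\<bar>cn p s q\<bar> powr (p - 2) * cn p s q = spow (2 - 2 / p) (cos (?a s))" for s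
  proof -
    have "(p - 2 + 1) * (2 / p) = 2 - 2 / p" using p by (simp add: field_simps)
    then show ?thesis unfolding abs_powr_times cn_eq spow_spow by simp
  qed
  have Y: "((\<lambda>s. - q * (p / (p - 1)) * (\<bar>cn p s q\<bar> powr (p - 2) * cn p s q)) has_real_derivative
      2 * q * sin (?a s) * sqrt (?D s)) (at s)" for s
    unfolding yeq
  proof (rule has_real_derivative_off_discrete[where Z = ?Z])
    have "0 < 2 - 2 / p" using p by (simp add: field_simps)
    then show "continuous_on UNIV (\<lambda>s. - q * (p / (p - 1)) * spow (2 - 2 / p) (cos (?a s)))"
      by (auto intro!: continuous_intros)
    fix s assume s: "s \<notin> ?Z"
    then have nz: "cos (?a s) \<noteq> 0" by simp
    have "((\<lambda>s. cos (?a s)) has_real_derivative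
        - sin (?a s) * (sqrt (?D s) * \<bar>cos (?a s)\<bar> powr (2 / p - 1))) (at s)"
      using nz by (auto intro!: derivative_eq_intros am1_props(4))
    from DERIV_cmult[OF DERIV_spow[OF this nz], of "- q * (p / (p - 1))" "2 - 2 / p"]
    have "((\<lambda>s. - q * (p / (p - 1)) * spow (2 - 2 / p) (cos (?a s))) has_real_derivative
      - q * (p / (p - 1)) * ((2 - 2 / p) * \<bar>cos (?a s)\<bar> powr (2 - 2 / p - 1) * (- sin (?a s) * (sqrt (?D s) * \<bar>cos (?a s)\<bar> powr (2 / p - 1))))) (at s)"
      by (simp only: mult.assoc)
    moreover have "- q * (p / (p - 1)) * ((2 - 2 / p) * \<bar>cos (?a s)\<bar> powr (2 - 2 / p - 1) * (- sin (?a s) * (sqrt (?D s) * \<bar>cos (?a s)\<bar> powr (2 / p - 1))))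
      = q * (p / (p - 1) * (2 - 2 / p)) * sin (?a s) * sqrt (?D s) * (\<bar>cos (?a s)\<bar> powr (1 - 2 / p) * \<bar>cos (?a s)\<bar> powr (2 / p - 1))"
      by (simp add: mult_ac)
    moreover have "p / (p - 1) * (2 - 2 / p) = 2" using p by (simp add: field_simps)
    ultimately show "((\<lambda>s. - q * (p / (p - 1)) * spow (2 - 2 / p) (cos (?a s))) has_real_derivative
      2 * q * sin (?a s) * sqrt (?D s)) (at s)"
      by (simp only: pw[OF s]) (simp add: mult_ac)
  qed (auto intro!: continuous_intros am1_props(5))
  have T: "((\<lambda>s. 2 * arcsin (q * sn p s q)) has_real_derivative 2 * q * cn p s q) (at s)" for s
    unfolding sn_def cn_eq
  proof (rule has_real_derivative_off_discrete[where Z = ?Z])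
    show "continuous_on UNIV (\<lambda>s. 2 * arcsin (q * sin (?a s)))"
      using sn' by (intro continuous_intros) auto
    show "continuous_on UNIV (\<lambda>s. 2 * q * spow (2 / p) (cos (?a s)))"
      using p by (intro continuous_intros) auto
    fix s assume s: "s \<notin> ?Z"
    have "((\<lambda>s. 2 * arcsin (q * sin (?a s))) has_real_derivative
       2 * (inverse (sqrt (1 - (q * sin (?a s))\<^sup>2)) * (q * (cos (?a s) * (sqrt (?D s) * \<bar>cos (?a s)\<bar> powr (2 / p - 1)))))) (at s)"
      using s sn'[of s] by (auto intro!: derivative_eq_intros DERIV_chain2[OF DERIV_arcsin] am1_props(4))
    moreover have "2 * (inverse (sqrt (1 - (q * sin (?a s))\<^sup>2)) * (q * (cos (?a s) * (sqrt (?D s) * \<bar>cos (?a s)\<bar> powr (2 / p - 1)))))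
       = 2 * q * (\<bar>cos (?a s)\<bar> powr (2 / p - 1) * cos (?a s))"
      using pos[of s] by (simp add: power_mult_distrib)
    ultimately show "((\<lambda>s. 2 * arcsin (q * sin (?a s))) has_real_derivative 2 * q * spow (2 / p) (cos (?a s))) (at s)"
      by (simp add: abs_powr_times)
  qed (rule am1_props(5))
  show ?thesis
    unfolding has_angle_curvature_def wavelike_curve_def
    using has_vector_derivative_vector_2[OF X Y] T by (simp add: sn_def s2 c2)
qed

end


section \<open>Orbitlike curves\<close>

context
  fixes p q :: real
  assumes p: "1 < p" "p \<le> 2" and q: "0 < q" "q < 1"
begin

lemma modulus_powr_neq_0: "(1 - q\<^sup>2 * (sin \<theta>)\<^sup>2) powr a \<noteq> 0"
  using modulus[OF p q, of \<theta>] by simp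

lemma continuous_on_modulus_powr: "continuous_on A (\<lambda>\<theta>. (1 - q\<^sup>2 * (sin \<theta>)\<^sup>2) powr a)"
proof -
  have "1 - q\<^sup>2 * (sin \<theta>)\<^sup>2 \<noteq> 0" for \<theta> using modulus[OF p q, of \<theta>] by simp
  then show ?thesis by (intro continuous_intros) simp
qed

lemma F2_eq: "F2 p x q = (LBINT \<theta>=0..x. 1 / (1 - q\<^sup>2 * (sin \<theta>)\<^sup>2) powr (1 / p))"
  using q by (simp add: F2_def)

text \<open>For a modulus below 1 the integrand is continuous and at least 1, so no exceptional set
  occurs.\<close>

lemma F2_props:
  shows "x \<le> y \<Longrightarrow> y - x \<le> F2 p y q - F2 p x q"
    and "range (\<lambda>x. F2 p x q) = UNIV"
    and "((\<lambda>x. F2 p x q) has_real_derivative 1 / (1 - q\<^sup>2 * (sin x)\<^sup>2) powr (1 / p)) (at x)"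
proof -
  let ?f = "\<lambda>\<theta>. 1 / (1 - q\<^sup>2 * (sin \<theta>)\<^sup>2) powr (1 / p)"
  have c: "continuous_on A ?f" for A
    using modulus_powr_neq_0 by (intro continuous_intros continuous_on_modulus_powr) auto
  then have int: "?f integrable_on {a..b}" for a b
    by (rule integrable_continuous_interval)
  have nn: "0 \<le> ?f x" for x by simp
  have meas: "?f \<in> borel_measurable borel" by measurable
  have ge1: "1 \<le> ?f x" for x
  proof -
    have "(1 - q\<^sup>2 * (sin x)\<^sup>2) powr (1 / p) \<le> 1"
      using modulus[OF p q, of x] p by (intro powr_le1) auto
    then show ?thesis using modulus_powr_neq_0[of x "1 / p"] by (simp add: le_less)
  qed
  note base = is_interval_univ open_UNIV UNIV_I[of 0]
  show e: "y - x \<le> F2 p y q - F2 p x q" if "x \<le> y" for x y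
    unfolding F2_eq
    by (rule interval_integral_expansive[where D = UNIV and Z = "{}"])
      (rule base int nn meas negligible_empty ge1 that UNIV_I | assumption)+
  have c0: "continuous_on UNIV (\<lambda>x. F2 p x q)"
    unfolding F2_eq by (rule interval_integral_continuous_on[OF base int nn meas])
  show "range (\<lambda>x. F2 p x q) = UNIV"
    by (rule expansive_surj[of "\<lambda>x. F2 p x q"]) (rule e c0 | assumption)+
  have "isCont ?f x" using c[of UNIV] by (simp add: continuous_on_eq_continuous_at)
  then show "((\<lambda>x. F2 p x q) has_real_derivative ?f x) (at x)"
    unfolding F2_eq using interval_integral_deriv[OF base int nn meas] by simp
qed

lemma am2_eq: "am2 p s q = inv_into UNIV (\<lambda>x. F2 p x q) s"
  using q by (simp add: am2_def F_dom_def)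

lemma am2_props:
  shows "F2 p (am2 p s q) q = s" "am2 p (F2 p x q) q = x"
    "((\<lambda>s. am2 p s q) has_real_derivative dn p s q) (at s)"
proof -
  note inv = expansive_inverse[of UNIV "\<lambda>x. F2 p x q", OF F2_props(1,2), folded am2_eq]
  show F: "F2 p (am2 p s q) q = s" for s using inv(2) by simp
  show "am2 p (F2 p x q) q = x" using inv(3) by simp
  let ?d = "1 / (1 - q\<^sup>2 * (sin (am2 p s q))\<^sup>2) powr (1 / p)"
  have "((\<lambda>s. am2 p s q) has_real_derivative 1 / ?d) (at s)"
    using expansive_inverse(5)[of UNIV "\<lambda>x. F2 p x q" ?d s, OF F2_props(1,2)] F2_props(3)
      modulus_powr_neq_0 by (simp add: am2_eq)
  then show "((\<lambda>s. am2 p s q) has_real_derivative dn p s q) (at s)" by (simp add: dn_def)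
qed

lemma has_real_derivative_E2:
  "((\<lambda>x. E2 (p / (p - 1)) x q) has_real_derivative (1 - q\<^sup>2 * (sin x)\<^sup>2) powr (1 - 1 / p)) (at x)"
proof -
  let ?f = "\<lambda>\<theta>. (1 - q\<^sup>2 * (sin \<theta>)\<^sup>2) powr (1 / (p / (p - 1)))"
  have "((\<lambda>x. E2 (p / (p - 1)) x q) has_real_derivative ?f x) (at x)"
    unfolding E2_def
  proof (rule interval_integral_deriv[where D = UNIV])
    show "?f integrable_on {a..b}" for a b
      by (rule integrable_continuous_interval, rule continuous_on_modulus_powr)
    show "isCont ?f x"
      using continuous_on_modulus_powr[of UNIV] by (simp add: continuous_on_eq_continuous_at)
  qed auto
  moreover have "1 / (p / (p - 1)) = 1 - 1 / p" using p by (simp add: field_simps)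
  ultimately show ?thesis by simp
qed

lemma has_angle_curvature_orbitlike:
  "has_angle_curvature (orbitlike_curve p q) (\<lambda>s. 2 * am2 p s q) (\<lambda>s. 2 * dn p s q)"
proof -
  let ?a = "\<lambda>s. am2 p s q"
  let ?D = "\<lambda>s. 1 - q\<^sup>2 * (sin (?a s))\<^sup>2"
  have pos: "0 < ?D s" for s using modulus[OF p q] by simp
  have X: "((\<lambda>s. 1 / q\<^sup>2 * (2 * E2 (p / (p - 1)) (?a s) q + (q\<^sup>2 - 2) * s)) has_real_derivative cos (2 * ?a s)) (at s)" for s
  proof -
    have "((\<lambda>s. 1 / q\<^sup>2 * (2 * E2 (p / (p - 1)) (?a s) q + (q\<^sup>2 - 2) * s)) has_real_derivative
        1 / q\<^sup>2 * (2 * (?D s powr (1 - 1 / p) * dn p s q) + (q\<^sup>2 - 2) * 1)) (at s)"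
      by (intro DERIV_cmult DERIV_add DERIV_ident DERIV_chain2[OF has_real_derivative_E2 am2_props(3)])
    \<comment> \<open>The exponents 1 - 1/p and 1/p add up to 1: this is why the dual exponent p /
      (p - 1) appears in the curve.\<close>
    moreover have "?D s powr (1 - 1 / p) * dn p s q = ?D s"
      using pos[of s] by (simp add: dn_def flip: powr_add)
    moreover have "1 / q\<^sup>2 * (2 * ?D s + (q\<^sup>2 - 2)) = cos (2 * ?a s)"
      using q by (simp add: cos_double_sin field_simps)
    ultimately show ?thesis by simp
  qed
  have Y: "((\<lambda>s. 1 / q\<^sup>2 * (- (p / (p - 1)) * dn p s q powr (p - 1))) has_real_derivative sin (2 * ?a s)) (at s)" for s
  proof -
    have eq: "dn p s q powr (p - 1) = ?D s powr (1 - 1 / p)" for s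
      using p by (simp add: dn_def powr_powr field_simps)
    have "(?D has_real_derivative - (q\<^sup>2 * (2 * (sin (?a s) * (cos (?a s) * dn p s q))))) (at s)"
      by (auto intro!: derivative_eq_intros am2_props(3))
    from DERIV_cmult[OF DERIV_cmult[OF DERIV_powr_const[OF this pos]], of "1 / q\<^sup>2" "- (p / (p - 1))" "1 - 1 / p"]
    have "((\<lambda>s. 1 / q\<^sup>2 * (- (p / (p - 1)) * ?D s powr (1 - 1 / p))) has_real_derivative
        1 / q\<^sup>2 * (- (p / (p - 1)) * ((1 - 1 / p) * ?D s powr (1 - 1 / p - 1) * (- (q\<^sup>2 * (2 * (sin (?a s) * (cos (?a s) * dn p s q)))))))) (at s)" .
    moreover have "1 / q\<^sup>2 * (- (p / (p - 1)) * ((1 - 1 / p) * ?D s powr (1 - 1 / p - 1) * (- (q\<^sup>2 * (2 * (sin (?a s) * (cos (?a s) * dn p s q)))))))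
       = (q\<^sup>2 / q\<^sup>2) * (p / (p - 1) * (1 - 1 / p)) * (2 * sin (?a s) * cos (?a s)) * (?D s powr (1 - 1 / p - 1) * dn p s q)"
      by (simp add: mult_ac)
    moreover have "p / (p - 1) * (1 - 1 / p) = 1" using p by (simp add: field_simps)
    moreover have "?D s powr (1 - 1 / p - 1) * dn p s q = 1"
      using pos[of s] by (simp add: dn_def flip: powr_add)
    moreover have "q\<^sup>2 / q\<^sup>2 = 1" using q by simp
    ultimately show ?thesis unfolding eq sin_double by (simp only: mult_1 mult_1_right)
  qed
  have "orbitlike_curve p q = (\<lambda>s. vector [1 / q\<^sup>2 * (2 * E2 (p / (p - 1)) (?a s) q + (q\<^sup>2 - 2) * s),
      1 / q\<^sup>2 * (- (p / (p - 1)) * dn p s q powr (p - 1))])"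
    by (rule ext) (simp add: orbitlike_curve_def vec_eq_iff forall_2)
  then show ?thesis
    unfolding has_angle_curvature_def
    using has_vector_derivative_vector_2[OF X Y] DERIV_cmult[OF am2_props(3), of 2] by simp
qed

end

section \<open>The borderline curve\<close>

context
  fixes p :: real
  assumes p: "1 < p" "p \<le> 2"
begin

lemma F1_1_eq: "F1 p x 1 = (LBINT \<theta>=0..x. \<bar>cos \<theta>\<bar> powr (- 2 / p))"
  by (simp add: F1_def)

lemma cos_pos: "x \<in> {- (pi / 2)<..<pi / 2} \<Longrightarrow> 0 < cos x"
  by (auto intro: cos_gt_zero_pi)

text \<open>On a bounded interval expansion does not give surjectivity. It comes from the divergence
  of the integral at both ends, by comparison with the case p = 2.\<close>

lemma F1_1_props:
  defines "D \<equiv> {- (pi / 2)<..<pi / 2}"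
  shows "x \<in> D \<Longrightarrow> y \<in> D \<Longrightarrow> x \<le> y \<Longrightarrow> y - x \<le> F1 p y 1 - F1 p x 1"
    and "(\<lambda>x. F1 p x 1) ` D = UNIV"
    and "x \<in> D \<Longrightarrow> ((\<lambda>x. F1 p x 1) has_real_derivative \<bar>cos x\<bar> powr (- 2 / p)) (at x)"
proof -
  let ?f = "\<lambda>\<theta>. \<bar>cos \<theta>\<bar> powr (- 2 / p)"
  have base: "is_interval D" "open D" "0 \<in> D" by (auto simp: D_def is_interval_oo)
  have cp: "0 < cos x" if "x \<in> D" for x using cos_pos that by (simp add: D_def)
  have c: "continuous_on D ?f"
    using cp by (intro continuous_intros) force
  have int: "?f integrable_on {a..b}" if "a \<in> D" "b \<in> D" for a b
    using c that by (intro integrable_continuous_interval) (auto simp: D_def intro: continuous_on_subset)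
  have nn: "0 \<le> ?f x" for x by simp
  have meas: "?f \<in> borel_measurable borel" by measurable
  have ge1: "1 \<le> ?f x" if "x \<in> D" for x
    using that cp[of x] p by (intro abs_cos_powr_ge_1) (auto simp: field_simps)
  show e: "y - x \<le> F1 p y 1 - F1 p x 1" if "x \<in> D" "y \<in> D" "x \<le> y" for x y
    unfolding F1_1_eq
    by (rule interval_integral_expansive[where D = D and Z = "{}"])
      (rule base int nn meas negligible_empty ge1 that | assumption)+
  show d: "((\<lambda>x. F1 p x 1) has_real_derivative ?f x) (at x)" if "x \<in> D" for x
  proof -
    have "isCont ?f x" using c base(2) that by (simp add: continuous_on_eq_continuous_at)
    then show ?thesis
      unfolding F1_1_eq using interval_integral_deriv[OF base int nn meas] that by simp
  qed
  have F0: "F1 p 0 1 = 0" by (simp add: F1_1_eq zero_ereal_def[symmetric])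
  \<comment> \<open>The integral of 1 / cos, which is the case p = 2. Since -2/p \<le> -1 and the
    cosine is at most 1, \<open>F1\<close> grows at least as fast.\<close>
  let ?L = "\<lambda>x. artanh (sin x)"
  have mono: "F1 p x 1 - ?L x \<le> F1 p y 1 - ?L y" if "x \<in> D" "y \<in> D" "x \<le> y" for x y
  proof (rule DERIV_nonneg_imp_nondecreasing[OF that(3)])
    fix z assume "x \<le> z" "z \<le> y"
    then have z: "z \<in> D" using that by (auto simp: D_def)
    have "0 < (cos z)\<^sup>2" using cp[OF z] by simp
    then have "(sin z)\<^sup>2 < 1" by (simp add: sin_squared_eq)
    then have "\<bar>sin z\<bar> < 1" by (simp add: abs_square_less_1)
    then have "((\<lambda>x. F1 p x 1 - ?L x) has_real_derivative ?f z - 1 / (1 - (sin z)\<^sup>2) * cos z) (at z)"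
      by (auto intro!: derivative_eq_intros d[OF z] DERIV_chain2[OF artanh_real_has_field_derivative])
    moreover have "1 / (1 - (sin z)\<^sup>2) * cos z = \<bar>cos z\<bar> powr (- 1)"
      unfolding cos_squared_eq[symmetric] using cp[OF z] by (simp add: powr_minus divide_simps power2_eq_square)
    moreover have "\<bar>cos z\<bar> powr (- 1) \<le> ?f z"
      using p by (intro powr_mono') (auto simp: field_simps)
    ultimately show "\<exists>d. ((\<lambda>x. F1 p x 1 - ?L x) has_real_derivative d) (at z) \<and> 0 \<le> d"
      by fastforce
  qed
  have "\<exists>x\<in>D. F1 p x 1 = s" for s
  proof -
    define r where "r = \<bar>s\<bar>"
    \<comment> \<open>The point at which the comparison function takes the value |s|.\<close>
    let ?x = "arcsin (tanh r)"
    have r: "0 \<le> r" "- r \<le> s" "s \<le> r" by (auto simp: r_def)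
    have t: "0 \<le> tanh r" "tanh r < 1" using r by (auto simp: tanh_real_lt_1)
    have x: "?x \<in> D" "- ?x \<in> D" "0 \<le> ?x"
      using arcsin_lt_bounded[of "tanh r"] t arcsin_le_arcsin[of 0 "tanh r"] by (auto simp: D_def)
    have L: "?L ?x = r" "?L (- ?x) = - r"
    proof -
      have sx: "sin ?x = tanh r" using t by (intro sin_arcsin) linarith+
      show "?L ?x = r" unfolding sx by (rule artanh_tanh_real)
      show "?L (- ?x) = - r"
        unfolding sin_minus sx using t artanh_minus_real[of "tanh r"] by (simp add: artanh_tanh_real)
    qed
    have "s \<le> F1 p ?x 1" "F1 p (- ?x) 1 \<le> s"
      using mono[of 0 ?x] mono[of "- ?x" 0] x base(3) F0 L r by auto
    moreover have "continuous_on {- ?x..?x} (\<lambda>x. F1 p x 1)"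
    proof (rule continuous_at_imp_continuous_on, rule ballI)
      fix y assume "y \<in> {- ?x..?x}"
      then have "y \<in> D" using x by (auto simp: D_def)
      then show "isCont (\<lambda>x. F1 p x 1) y" using d DERIV_isCont by blast
    qed
    ultimately obtain y where "- ?x \<le> y" "y \<le> ?x" "F1 p y 1 = s"
      using IVT'[of "\<lambda>x. F1 p x 1" "- ?x" s ?x] x by auto
    then show ?thesis using x by (intro bexI[of _ y]) (auto simp: D_def)
  qed
  then show "(\<lambda>x. F1 p x 1) ` D = UNIV" by (auto simp: image_iff) metis
qed

lemma am1_1_eq: "am1 p s 1 = inv_into {- (pi / 2)<..<pi / 2} (\<lambda>x. F1 p x 1) s"
  using p by (simp add: am1_def F_dom_def)

lemma am1_1_eq_am2: "am1 p s 1 = am2 p s 1"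
  by (simp add: am1_def am2_def F1_def F2_def)

lemma am1_1_props:
  shows "am1 p s 1 \<in> {- (pi / 2)<..<pi / 2}" "F1 p (am1 p s 1) 1 = s"
    "x \<in> {- (pi / 2)<..<pi / 2} \<Longrightarrow> am1 p (F1 p x 1) 1 = x"
    "((\<lambda>s. am1 p s 1) has_real_derivative cos (am1 p s 1) powr (2 / p)) (at s)"
proof -
  note inv = expansive_inverse[of "{- (pi / 2)<..<pi / 2}" "\<lambda>x. F1 p x 1", OF F1_1_props(1,2), folded am1_1_eq]
  show D: "am1 p s 1 \<in> {- (pi / 2)<..<pi / 2}" using inv(1) .
  show "F1 p (am1 p s 1) 1 = s" using inv(2) .
  show "x \<in> {- (pi / 2)<..<pi / 2} \<Longrightarrow> am1 p (F1 p x 1) 1 = x" using inv(3) .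
  have c: "0 < cos (am1 p s 1)" using cos_pos D .
  let ?d = "\<bar>cos (am1 p s 1)\<bar> powr (- 2 / p)"
  have "((\<lambda>s. am1 p s 1) has_real_derivative 1 / ?d) (at s)"
    using expansive_inverse(5)[of "{- (pi / 2)<..<pi / 2}" "\<lambda>x. F1 p x 1" ?d s, OF F1_1_props(1,2)]
      F1_1_props(3)[OF D] c by (simp add: am1_1_eq)
  moreover have "1 / ?d = cos (am1 p s 1) powr (2 / p)"
    using c powr_minus_divide[of "cos (am1 p s 1)" "- 2 / p"] by simp
  ultimately show "((\<lambda>s. am1 p s 1) has_real_derivative cos (am1 p s 1) powr (2 / p)) (at s)" by simp
qed

lemma sech_p_eq: "sech_p p s = cos (am1 p s 1) powr (2 / p)"
  using p cos_pos[OF am1_1_props(1)[of s]]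
  by (simp add: sech_p_def K_one_def cn_def powr_diff)

lemma has_real_derivative_tanh_p: "(tanh_p p has_real_derivative (cos (am1 p s 1))\<^sup>2) (at s)"
proof -
  have eq: "sech_p p t powr p = (cos (am1 p t 1))\<^sup>2" for t
    using p cos_pos[OF am1_1_props(1)[of t]] by (simp add: sech_p_eq powr_powr)
  have am: "isCont (\<lambda>s. am1 p s 1) s" for s using am1_1_props(4) DERIV_isCont by blast
  then have c: "continuous_on UNIV (\<lambda>t. (cos (am1 p t 1))\<^sup>2)"
    by (intro continuous_at_imp_continuous_on ballI continuous_intros)
  have "((\<lambda>x. LBINT t=0..x. (cos (am1 p t 1))\<^sup>2) has_real_derivative (cos (am1 p s 1))\<^sup>2) (at s)"
  proof (rule interval_integral_deriv[where D = UNIV])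
    show "(\<lambda>t. (cos (am1 p t 1))\<^sup>2) integrable_on {a..b}" for a b
      using c by (intro integrable_continuous_interval) (auto intro: continuous_on_subset)
    show "(\<lambda>t. (cos (am1 p t 1))\<^sup>2) \<in> borel_measurable borel"
      using c by (rule borel_measurable_continuous_onI)
    show "isCont (\<lambda>t. (cos (am1 p t 1))\<^sup>2) s"
      using c by (simp add: continuous_on_eq_continuous_at)
  qed auto
  then show ?thesis unfolding tanh_p_def[abs_def] eq .
qed

text \<open>The amplitude stays inside the open interval, where the cosine is positive, so the chain
  rule applies at every parameter.\<close>

lemma has_angle_curvature_borderline:
  "has_angle_curvature (borderline_curve p) (\<lambda>s. 2 * am1 p s 1) (\<lambda>s. 2 * sech_p p s)"
proof -
  let ?a = "\<lambda>s. am1 p s 1"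
  have pos: "0 < cos (?a s)" for s using cos_pos[OF am1_1_props(1)] .
  have X: "((\<lambda>s. 2 * tanh_p p s - s) has_real_derivative cos (2 * ?a s)) (at s)" for s
    by (auto intro!: derivative_eq_intros has_real_derivative_tanh_p simp: cos_double_cos)
  have Y: "((\<lambda>s. - (p / (p - 1)) * sech_p p s powr (p - 1)) has_real_derivative sin (2 * ?a s)) (at s)" for s
  proof -
    have eq: "sech_p p s powr (p - 1) = cos (?a s) powr (2 - 2 / p)" for s
      using p by (simp add: sech_p_eq powr_powr field_simps)
    have "((\<lambda>s. cos (?a s)) has_real_derivative - (sin (?a s) * cos (?a s) powr (2 / p))) (at s)"
      by (auto intro!: derivative_eq_intros am1_1_props(4))
    from DERIV_cmult[OF DERIV_powr_const[OF this pos], of "- (p / (p - 1))" "2 - 2 / p"]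
    have "((\<lambda>s. - (p / (p - 1)) * cos (?a s) powr (2 - 2 / p)) has_real_derivative
        - (p / (p - 1)) * ((2 - 2 / p) * cos (?a s) powr (2 - 2 / p - 1) * (- (sin (?a s) * cos (?a s) powr (2 / p))))) (at s)" .
    moreover have "- (p / (p - 1)) * ((2 - 2 / p) * cos (?a s) powr (2 - 2 / p - 1) * (- (sin (?a s) * cos (?a s) powr (2 / p))))
       = (p / (p - 1) * (2 - 2 / p)) * sin (?a s) * (cos (?a s) powr (2 - 2 / p - 1) * cos (?a s) powr (2 / p))"
      by (simp add: mult_ac)
    moreover have "p / (p - 1) * (2 - 2 / p) = 2" using p by (simp add: field_simps)
    moreover have "cos (?a s) powr (2 - 2 / p - 1) * cos (?a s) powr (2 / p) = cos (?a s)"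
      using pos[of s] by (simp flip: powr_add)
    ultimately show ?thesis unfolding eq sin_double by (simp only:)
  qed
  have T: "((\<lambda>s. 2 * ?a s) has_real_derivative 2 * sech_p p s) (at s)" for s
    unfolding sech_p_eq by (rule DERIV_cmult[OF am1_1_props(4)])
  show ?thesis
    unfolding has_angle_curvature_def borderline_curve_def
    using has_vector_derivative_vector_2[OF X Y] T by simp
qed

end

section \<open>Test functions\<close>

text \<open>The whole sequence of derivatives as a witness of smoothness; unlike the bare iterates
  of \<open>vderiv\<close> it carries the derivative statements with it.\<close>

definition derivs :: "(real \<Rightarrow> 'a::real_normed_vector) \<Rightarrow> (nat \<Rightarrow> real \<Rightarrow> 'a) \<Rightarrow> bool" where
  "derivs f D \<longleftrightarrow> D 0 = f \<and> (\<forall>n t. (D n has_vector_derivative D (Suc n) t) (at t))"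

lemma derivs_vderiv: "derivs f D \<Longrightarrow> (vderiv ^^ n) f = D n"
proof (induction n)
  case (Suc n)
  show ?case
  proof -
    have "vderiv (D n) = D (Suc n)"
      using Suc.prems by (auto simp: derivs_def vderiv_def fun_eq_iff intro!: vector_derivative_at)
    then show ?thesis using Suc by simp
  qed
qed (simp add: derivs_def)

lemma smooth_iff_derivs: "smooth f \<longleftrightarrow> (\<exists>D. derivs f D)"
proof
  assume "smooth f"
  then have "derivs f (\<lambda>n. (vderiv ^^ n) f)"
    unfolding derivs_def smooth_def by (auto simp: vderiv_def vector_derivative_works[symmetric])
  then show "\<exists>D. derivs f D" by blast
next
  assume "\<exists>D. derivs f D"
  then obtain D where D: "derivs f D" by blast
  then show "smooth f"
    unfolding smooth_def derivs_vderiv[OF D]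
    by (auto simp: derivs_def has_vector_derivative_def differentiable_def)
qed

text \<open>A coinduction rule: \<open>P\<close> is an invariant, and iterating a choice of
  derivatives inside it yields the whole sequence.\<close>

lemma smoothI:
  assumes "P f" "\<And>f. P f \<Longrightarrow> \<exists>f'. P f' \<and> (\<forall>t. (f has_vector_derivative f' t) (at t))"
  shows "smooth f"
proof -
  from assms(2) obtain d where d: "\<And>f. P f \<Longrightarrow> P (d f) \<and> (\<forall>t. (f has_vector_derivative d f t) (at t))"
    by metis
  have "P ((d ^^ n) f)" for n using assms(1) d by (induction n) auto
  then have "derivs f (\<lambda>n. (d ^^ n) f)" using d by (auto simp: derivs_def)
  then show ?thesis using smooth_iff_derivs by blast
qed

lemma smoothD:
  assumes "smooth f"
  shows "smooth (vderiv f)" "(f has_vector_derivative vderiv f t) (at t)"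
proof -
  show "smooth (vderiv f)"
    unfolding smooth_def
  proof (intro allI)
    fix n t
    have "(vderiv ^^ Suc n) f differentiable at t" using assms unfolding smooth_def by blast
    then show "(vderiv ^^ n) (vderiv f) differentiable at t" by (simp only: funpow_Suc_right o_apply)
  qed
  have "(vderiv ^^ 0) f differentiable (at t)" using assms unfolding smooth_def by blast
  then show "(f has_vector_derivative vderiv f t) (at t)"
    by (simp add: vderiv_def vector_derivative_works)
qed

lemma vderiv_eqI: "(\<And>t. (f has_vector_derivative f' t) (at t)) \<Longrightarrow> vderiv f = f'"
  by (auto simp: vderiv_def fun_eq_iff intro!: vector_derivative_at)

lemma smooth_from_deriv:
  assumes "\<And>t. (f has_vector_derivative f' t) (at t)" "smooth f'"
  shows "smooth f"
proof (rule smoothI[where P = "\<lambda>g. g = f \<or> smooth g"])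
  fix g assume "g = f \<or> smooth g"
  then show "\<exists>f'. (f' = f \<or> smooth f') \<and> (\<forall>t. (g has_vector_derivative f' t) (at t))"
    using assms smoothD by metis
qed simp

lemma smooth_continuous_on: "smooth f \<Longrightarrow> continuous_on A f"
  by (metis continuous_at_imp_continuous_on has_vector_derivative_continuous smoothD(2))

lemma smooth_add:
  assumes "smooth f" "smooth g"
  shows "smooth (\<lambda>t. f t + g t)"
proof (rule smoothI[where P = "\<lambda>h. \<exists>f g. smooth f \<and> smooth g \<and> h = (\<lambda>t. f t + g t)"])
  fix h :: "real \<Rightarrow> 'a" assume "\<exists>f g. smooth f \<and> smooth g \<and> h = (\<lambda>t. f t + g t)"
  then obtain f g where "smooth f" "smooth g" "h = (\<lambda>t. f t + g t)" by blast
  then show "\<exists>f'. (\<exists>f g. smooth f \<and> smooth g \<and> f' = (\<lambda>t. f t + g t)) \<and> (\<forall>t. (h has_vector_derivative f' t) (at t))"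
    by (intro exI[of _ "\<lambda>t. vderiv f t + vderiv g t"]) (auto intro!: smoothD has_vector_derivative_add)
qed (use assms in blast)

text \<open>Products are not closed under differentiation, so the proof goes through the class \<open>P n\<close> of
  functions that can be differentiated \<open>n\<close> times, which is closed under sums.\<close>

lemma smooth_mult:
  fixes f g :: "real \<Rightarrow> real"
  assumes "smooth f" "smooth g"
  shows "smooth (\<lambda>t. f t * g t)"
proof -
  define P where "P = rec_nat (\<lambda>h::real \<Rightarrow> real. True)
    (\<lambda>_ R h. \<exists>h'. (\<forall>t. (h has_vector_derivative h' t) (at t)) \<and> R h')"
  have P0: "P 0 h" and PS: "P (Suc n) h \<longleftrightarrow> (\<exists>h'. (\<forall>t. (h has_vector_derivative h' t) (at t)) \<and> P n h')" for n h
    by (simp_all add: P_def)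
  have Padd: "P n h \<Longrightarrow> P n k \<Longrightarrow> P n (\<lambda>t. h t + k t)" for n h k
  proof (induction n arbitrary: h k)
    case (Suc n)
    then obtain h' k' where "\<And>t. (h has_vector_derivative h' t) (at t)" "P n h'"
      "\<And>t. (k has_vector_derivative k' t) (at t)" "P n k'" by (auto simp: PS)
    then show ?case unfolding PS
      by (intro exI[of _ "\<lambda>t. h' t + k' t"]) (auto intro!: has_vector_derivative_add Suc.IH)
  qed (simp add: P0)
  \<comment> \<open>The factors vary in the induction, because the product rule replaces the pair by
    two new pairs.\<close>
  have Pmul: "smooth h \<Longrightarrow> smooth k \<Longrightarrow> P n (\<lambda>t. h t * k t)" for n h k
  proof (induction n arbitrary: h k)
    case (Suc n)
    have "((\<lambda>t. h t * k t) has_vector_derivative h t * vderiv k t + vderiv h t * k t) (at t)" for t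
      using smoothD(2)[OF Suc.prems(1)] smoothD(2)[OF Suc.prems(2)] by (rule has_vector_derivative_mult)
    moreover have "P n (\<lambda>t. h t * vderiv k t + vderiv h t * k t)"
      using Suc.prems smoothD(1) by (intro Padd Suc.IH) auto
    ultimately show ?case unfolding PS
      by (intro exI[of _ "\<lambda>t. h t * vderiv k t + vderiv h t * k t"]) simp
  qed (simp add: P0)
  have diff: "P (Suc n) h \<Longrightarrow> (vderiv ^^ n) h differentiable (at t)" for n h t
  proof (induction n arbitrary: h)
    case 0
    then show ?case by (auto simp: PS differentiable_def has_vector_derivative_def)
  next
    case (Suc n)
    then obtain h' where h': "\<And>t. (h has_vector_derivative h' t) (at t)" "P (Suc n) h'"
      unfolding PS[of "Suc n"] by blast
    have "(vderiv ^^ Suc n) h = (vderiv ^^ n) h'"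
      using vderiv_eqI[OF h'(1)] by (simp only: funpow_Suc_right o_apply)
    then show ?case using Suc.IH[OF h'(2)] by simp
  qed
  show ?thesis unfolding smooth_def using diff Pmul[OF assms] by blast
qed

lemma smooth_affine:
  assumes "smooth f"
  shows "smooth (\<lambda>t. f (a * t + b))"
proof (rule smoothI[where P = "\<lambda>h. \<exists>f c. smooth f \<and> h = (\<lambda>t. c *\<^sub>R f (a * t + b))"])
  show "\<exists>fa c. smooth fa \<and> (\<lambda>t. f (a * t + b)) = (\<lambda>t. c *\<^sub>R fa (a * t + b))"
    using assms by (intro exI[of _ f] exI[of _ 1]) auto
  fix h :: "real \<Rightarrow> 'a" assume "\<exists>f c. smooth f \<and> h = (\<lambda>t. c *\<^sub>R f (a * t + b))"
  then obtain f c where f: "smooth f" "h = (\<lambda>t. c *\<^sub>R f (a * t + b))" by blast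
  have "(h has_vector_derivative (c * a) *\<^sub>R vderiv f (a * t + b)) (at t)" for t
  proof -
    have "((\<lambda>t. a * t + b) has_vector_derivative a) (at t)"
      by (auto intro!: derivative_eq_intros simp: has_real_derivative_iff_has_vector_derivative[symmetric])
    from vector_diff_chain_at[OF this smoothD(2)[OF f(1)]]
    have "((\<lambda>t. f (a * t + b)) has_vector_derivative a *\<^sub>R vderiv f (a * t + b)) (at t)" by (simp add: o_def)
    then show ?thesis unfolding f(2)
      using bounded_linear.has_vector_derivative[OF bounded_linear_scaleR_right] by fastforce
  qed
  then show "\<exists>f'. (\<exists>f c. smooth f \<and> f' = (\<lambda>t. c *\<^sub>R f (a * t + b))) \<and> (\<forall>t. (h has_vector_derivative f' t) (at t))"
    using smoothD(1)[OF f(1)] by blast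
qed

lemma smooth_scaleR_const:
  fixes e :: "'a::real_normed_vector"
  assumes "smooth \<phi>"
  shows "smooth (\<lambda>t. \<phi> t *\<^sub>R e)" "vderiv (\<lambda>t. \<phi> t *\<^sub>R e) = (\<lambda>t. vderiv \<phi> t *\<^sub>R e)"
proof -
  have d: "((\<lambda>t. \<psi> t *\<^sub>R e) has_vector_derivative vderiv \<psi> t *\<^sub>R e) (at t)" if "smooth \<psi>" for \<psi> :: "real \<Rightarrow> real" and t
    using smoothD(2)[OF that] by (rule bounded_linear.has_vector_derivative[OF bounded_linear_scaleR_left])
  show "smooth (\<lambda>t. \<phi> t *\<^sub>R e)"
  proof (rule smoothI[where P = "\<lambda>h. \<exists>\<psi>. smooth \<psi> \<and> h = (\<lambda>t. \<psi> t *\<^sub>R e)"])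
    fix h :: "real \<Rightarrow> 'a" assume "\<exists>\<psi>. smooth \<psi> \<and> h = (\<lambda>t. \<psi> t *\<^sub>R e)"
    then show "\<exists>f'. (\<exists>\<psi>. smooth \<psi> \<and> f' = (\<lambda>t. \<psi> t *\<^sub>R e)) \<and> (\<forall>t. (h has_vector_derivative f' t) (at t))"
      using d smoothD(1) by blast
  qed (use assms in blast)
  show "vderiv (\<lambda>t. \<phi> t *\<^sub>R e) = (\<lambda>t. vderiv \<phi> t *\<^sub>R e)"
    by (rule vderiv_eqI) (rule d[OF assms])
qed

section \<open>Cutoff and bump functions\<close>

definition cutoff :: "real \<Rightarrow> real" where
  "cutoff t = (if t \<le> 0 then 0 else exp (- 1 / t))"

lemma smooth_cutoff: "smooth cutoff"
proof -
  \<comment> \<open>The functions q(1/t) exp(-1/t) with a polynomial q, extended by 0, form a class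
    closed under differentiation: the derivative belongs to the polynomial x^2 (q - q').\<close>
  define G :: "real poly \<Rightarrow> real \<Rightarrow> real" where
    "G = (\<lambda>q t. if t \<le> 0 then 0 else poly q (1 / t) * exp (- 1 / t))"
  have lim: "(G q \<longlongrightarrow> 0) (at 0)" for q
  proof -
    have "((\<lambda>x. \<Sum>i\<le>degree q. coeff q i * (x ^ i / exp x)) \<longlongrightarrow> (\<Sum>i\<le>degree q. coeff q i * 0)) at_top"
      by (intro tendsto_intros tendsto_power_div_exp_0)
    then have "((\<lambda>x. poly q x * exp (- x)) \<longlongrightarrow> 0) at_top"
      by (simp add: poly_altdef sum_distrib_right exp_minus divide_inverse mult.assoc)
    from filterlim_compose[OF this filterlim_inverse_at_top_right]
    have "((\<lambda>t. poly q (1 / t) * exp (- 1 / t)) \<longlongrightarrow> 0) (at_right 0)"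
      by (simp add: divide_inverse)
    then have "(G q \<longlongrightarrow> 0) (at_right 0)"
      by (rule Lim_transform_eventually) (auto simp: eventually_at_filter G_def)
    moreover have "(G q \<longlongrightarrow> 0) (at_left 0)"
      by (rule tendsto_eventually) (auto simp: eventually_at_filter G_def)
    ultimately show ?thesis by (simp add: filterlim_at_split)
  qed
  have der: "(G q has_real_derivative G ([:0, 0, 1:] * (q - pderiv q)) t) (at t)" for q t
  proof (cases t "0::real" rule: linorder_cases)
    case less
    have "((\<lambda>_. 0) has_real_derivative 0) (at t)" by simp
    then have "(G q has_real_derivative 0) (at t)"
      by (rule has_field_derivative_transform_within_open[where S = "{..<0}"]) (use less in \<open>auto simp: G_def\<close>)
    then show ?thesis using less by (simp add: G_def)
  next
    case equal
    \<comment> \<open>The difference quotient at 0 lies in the class again, with q multiplied by the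
      variable, so its limit is already known.\<close>
    have "((\<lambda>h. (G q (0 + h) - G q 0) / h) \<longlongrightarrow> 0) (at 0)"
    proof (rule Lim_transform_eventually[OF lim[of "[:0, 1:] * q"]])
      show "\<forall>\<^sub>F h in at 0. G ([:0, 1:] * q) h = (G q (0 + h) - G q 0) / h"
        by (auto simp: eventually_at_filter G_def)
    qed
    moreover have "G r 0 = 0" for r by (simp add: G_def)
    ultimately show ?thesis by (simp only: DERIV_def equal)
  next
    case greater
    have "((\<lambda>t. poly q (1 / t) * exp (- 1 / t)) has_real_derivative
        poly (pderiv q) (1 / t) * (- 1 / t\<^sup>2) * exp (- 1 / t) + poly q (1 / t) * (exp (- 1 / t) * (1 / t\<^sup>2))) (at t)"
      using greater
      by (auto intro!: derivative_eq_intros DERIV_chain2[OF poly_DERIV] simp: power2_eq_square divide_simps)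
    then have "((\<lambda>t. poly q (1 / t) * exp (- 1 / t)) has_real_derivative G ([:0, 0, 1:] * (q - pderiv q)) t) (at t)"
      by (rule DERIV_cong) (use greater in \<open>simp add: G_def field_simps power2_eq_square\<close>)
    then show ?thesis
      by (rule has_field_derivative_transform_within_open[where S = "{0<..}"]) (use greater in \<open>auto simp: G_def\<close>)
  qed
  have "smooth (G 1)"
  proof (rule smoothI[where P = "\<lambda>f. \<exists>q. f = G q"])
    fix f assume "\<exists>q. f = G q"
    then show "\<exists>f'. (\<exists>q. f' = G q) \<and> (\<forall>t. (f has_vector_derivative f' t) (at t))"
      using der by (auto simp: has_real_derivative_iff_has_vector_derivative)
  qed blast
  moreover have "G 1 = cutoff" by (auto simp: G_def cutoff_def fun_eq_iff)
  ultimately show ?thesis by simp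
qed

text \<open>The factor n steepens both flanks: with values in [0, 1] and smooth for every n, the
  functions tend pointwise to the indicator of the open interval, as dominated convergence
  wants.\<close>

definition bump :: "real \<Rightarrow> real \<Rightarrow> nat \<Rightarrow> real \<Rightarrow> real" where
  "bump a b n t = cutoff (real n * (t - a)) * cutoff (real n * (b - t))"

lemma test_functionI:
  assumes "smooth \<phi>" "0 < a" "b < 1" "\<And>t. t \<notin> {a..b} \<Longrightarrow> \<phi> t = 0"
  shows "test_function \<phi>"
proof -
  have "closure {t. \<phi> t \<noteq> 0} \<subseteq> {a..b}"
    using assms(4) by (intro closure_minimal subsetI) (blast, simp)
  moreover from this have "compact (closure {t. \<phi> t \<noteq> 0})"
    by (metis bounded_closed_interval bounded_subset closed_closure compact_eq_bounded_closed)
  ultimately show ?thesis using assms by (auto simp: test_function_def)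
qed

lemma test_functionE:
  assumes "test_function \<phi>"
  obtains a b where "0 < a" "a < b" "b < 1" "\<And>t. t \<notin> {a..b} \<Longrightarrow> \<phi> t = 0"
proof -
  let ?K = "closure {t. \<phi> t \<noteq> 0}"
  have K: "compact ?K" "?K \<subseteq> {0<..<1}" using assms by (auto simp: test_function_def)
  have sub: "\<phi> t \<noteq> 0 \<Longrightarrow> t \<in> ?K" for t using closure_subset[of "{t. \<phi> t \<noteq> 0}"] by blast
  show ?thesis
  proof (cases "?K = {}")
    case True
    then have "\<phi> t = 0" for t using sub by blast
    then show ?thesis using that[of "1/3" "1/2"] by simp
  next
    case False
    obtain a where a: "a \<in> ?K" "\<And>t. t \<in> ?K \<Longrightarrow> a \<le> t" using compact_attains_inf[OF K(1) False] by blast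
    obtain b where b: "b \<in> ?K" "\<And>t. t \<in> ?K \<Longrightarrow> t \<le> b" using compact_attains_sup[OF K(1) False] by blast
    have ab: "0 < a" "b < 1" "a \<le> b" using a b K by auto
    show ?thesis
    \<comment> \<open>Moving the right end halfway to 1 secures a strict inequality without asking
      whether the support has more than one point.\<close>
    proof (rule that[of "a" "(b + 1) / 2"])
      show "\<phi> t = 0" if "t \<notin> {a..(b + 1) / 2}" for t
      proof (rule ccontr)
        assume "\<phi> t \<noteq> 0"
        then have "a \<le> t" "t \<le> b" using sub a(2) b(2) by auto
        then show False using that ab by simp
      qed
    qed (use ab in auto)
  qed
qed

lemma test_function_smooth: "test_function \<phi> \<Longrightarrow> smooth \<phi>"
  by (simp add: test_function_def)

lemma bump_props:
  shows "smooth (bump a b n)" "t \<notin> {a..b} \<Longrightarrow> bump a b n t = 0" "0 \<le> bump a b n t" "bump a b n t \<le> 1"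
    and "a < t \<Longrightarrow> t < b \<Longrightarrow> 0 < n \<Longrightarrow> 0 < bump a b n t"
    and "(\<lambda>n. bump a b n t) \<longlonglongrightarrow> indicator {a<..<b} t"
proof -
  have c01: "0 \<le> cutoff t" "cutoff t \<le> 1" for t by (auto simp: cutoff_def)
  show "smooth (bump a b n)"
    unfolding bump_def[abs_def]
    using smooth_mult[OF smooth_affine[OF smooth_cutoff, of "real n" "- real n * a"]
        smooth_affine[OF smooth_cutoff, of "- real n" "real n * b"]]
    by (simp add: algebra_simps)
  have z: "bump a b n t = 0" if "t \<notin> {a<..<b}" for n t
    using that by (cases "t \<le> a") (auto simp: bump_def cutoff_def mult_nonneg_nonpos)
  then show "t \<notin> {a..b} \<Longrightarrow> bump a b n t = 0" by auto
  show "0 \<le> bump a b n t" "bump a b n t \<le> 1"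
    using c01 by (auto simp: bump_def intro: mult_le_one)
  show "a < t \<Longrightarrow> t < b \<Longrightarrow> 0 < n \<Longrightarrow> 0 < bump a b n t"
    by (auto simp: bump_def cutoff_def not_le mult_le_0_iff)
  have lim: "(\<lambda>n. cutoff (real n * c)) \<longlonglongrightarrow> 1" if "c > 0" for c
  proof -
    have "(\<lambda>n. exp (- 1 / c * inverse (real n))) \<longlonglongrightarrow> exp (- 1 / c * 0)"
      by (intro tendsto_intros LIMSEQ_inverse_real_of_nat[THEN LIMSEQ_imp_Suc] lim_inverse_n)
    then have "(\<lambda>n. exp (- 1 / c * inverse (real n))) \<longlonglongrightarrow> 1" by simp
    then show ?thesis
    proof (rule Lim_transform_eventually)
      show "\<forall>\<^sub>F n in sequentially. exp (- 1 / c * inverse (real n)) = cutoff (real n * c)"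
        by (rule eventually_mono[OF eventually_gt_at_top[of 0]])
          (use that in \<open>auto simp: cutoff_def mult_le_0_iff field_simps\<close>)
    qed
  qed
  show "(\<lambda>n. bump a b n t) \<longlonglongrightarrow> indicator {a<..<b} t"
  proof (cases "t \<in> {a<..<b}")
    case True
    then show ?thesis
      using tendsto_mult[OF lim[of "t - a"] lim[of "b - t"]] by (simp add: bump_def)
  next
    case False
    then show ?thesis using z by simp
  qed
qed

lemma test_function_bump: "0 < a \<Longrightarrow> b < 1 \<Longrightarrow> test_function (bump a b n)"
  using bump_props by (intro test_functionI) auto

section \<open>The fundamental lemma\<close>

abbreviation ae_unit :: "(real \<Rightarrow> bool) \<Rightarrow> bool" where
  "ae_unit P \<equiv> AE t in lebesgue. t \<in> {0<..<1} \<longrightarrow> P t"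

lemma integral_Ioo_unit_test:
  fixes f :: "real \<Rightarrow> 'a::euclidean_space"
  assumes "0 < a" "b < 1" "\<And>t. t \<notin> {a..b} \<Longrightarrow> \<phi> t = (0::real)"
  shows "(LINT t:{0<..<1}|lebesgue. \<phi> t *\<^sub>R f t) = (LINT t:{a..b}|lebesgue. \<phi> t *\<^sub>R f t)"
  unfolding set_lebesgue_integral_def
  by (rule Bochner_Integration.integral_cong) (use assms in \<open>auto simp: indicator_def\<close>)

text \<open>A Dynkin argument: half lines are stable under intersection and generate the Borel sets,
  while the sets of zero integral are closed under complements (by \<open>total\<close>) and
  countable disjoint unions. A Lebesgue set is a Borel set up to a null set, and uniqueness of
  densities concludes.\<close>

lemma AE_zero_if_Ioi_integrals_zero:
  fixes g :: "real \<Rightarrow> real"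
  assumes g: "integrable lebesgue g" and total: "(LINT t|lebesgue. g t) = 0"
    and Ioi: "\<And>x. (LINT t:{x<..}|lebesgue. g t) = 0"
  shows "AE t in lebesgue. g t = 0"
proof (rule density_unique_real[OF g integrable_zero])
  have si: "set_integrable lebesgue A g" if "A \<in> sets lebesgue" for A
    using integrable_mult_indicator[OF that g] by (simp add: set_integrable_def)
  have leb: "A \<in> sets lebesgue" if "A \<in> sets borel" for A :: "real set"
    using that by simp
  let ?G = "range (\<lambda>x::real. {x<..})"
  have eq: "sets borel = sigma_sets UNIV ?G"
    unfolding borel_Ioi by (rule sets_measure_of) simp
  have borel: "(LINT t:A|lebesgue. g t) = 0" if "A \<in> sigma_sets UNIV ?G" for A
  proof (rule sigma_sets_induct_disjoint[OF _ _ that])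
    show "Int_stable ?G" by (auto simp: Int_stable_def lessThan_Int_lessThan)
    show "(LINT t:A|lebesgue. g t) = 0" if "A \<in> ?G" for A using that Ioi by auto
    show "(LINT t:UNIV - A|lebesgue. g t) = 0"
      if A: "A \<in> sigma_sets UNIV ?G" "(LINT t:A|lebesgue. g t) = 0" for A
    proof -
      have m: "A \<in> sets lebesgue" "UNIV - A \<in> sets lebesgue" using A(1) leb[of A] leb[of "UNIV - A"] by (auto simp: eq[symmetric])
      have "(LINT t:A \<union> (UNIV - A)|lebesgue. g t) = (LINT t:A|lebesgue. g t) + (LINT t:UNIV - A|lebesgue. g t)"
        using m si by (intro set_integral_Un) auto
      then show ?thesis using A(2) total by (simp add: set_lebesgue_integral_def)
    qed
    show "(LINT t:(\<Union>i. A i)|lebesgue. g t) = 0"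
      if A: "disjoint_family A" "range A \<subseteq> sigma_sets UNIV ?G" "\<And>i. (LINT t:A i|lebesgue. g t) = 0" for A :: "nat \<Rightarrow> real set"
    proof -
      have m: "A i \<in> sets lebesgue" for i using A(2) leb[of "A i"] by (auto simp: eq[symmetric])
      have "(LINT t:(\<Union>i. A i)|lebesgue. g t) = (\<Sum>i. LINT t:A i|lebesgue. g t)"
        using m A(1) si[of "\<Union>i. A i"] by (intro lebesgue_integral_countable_add) (auto simp: disjoint_family_on_def)
      then show ?thesis using A(3) by simp
    qed
  qed (auto simp: set_lebesgue_integral_def)
  fix A :: "real set" assume A: "A \<in> sets lebesgue"
  then obtain S N N' where S: "S \<in> sets lborel" "A = S \<union> N" "N \<subseteq> N'" "N' \<in> null_sets lborel"
    by (auto elim: sets_completionE)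
  have "N' \<in> null_sets lebesgue" using S(4) by (rule null_sets_completionI)
  then have "AE t in lebesgue. indicator A t * g t = indicator S t * g t"
    by (rule AE_I') (use S in \<open>auto simp: indicator_def\<close>)
  then have "(LINT t:A|lebesgue. g t) = (LINT t:S|lebesgue. g t)"
    unfolding set_lebesgue_integral_def
    using si[OF A] si[OF leb[of S]] S(1) by (intro integral_cong_AE) (auto simp: set_integrable_def)
  then show "(LINT t:A|lebesgue. g t) = (LINT t:A|lebesgue. 0)" using borel[of S] S(1) eq by simp
qed

text \<open>Bump functions approximate indicators of intervals, so the integral over every open
  interval with closure in (0, 1) vanishes. As f is only locally integrable, such intervals are
  treated one by one and then exhaust (0, 1) countably.\<close>

lemma fundamental_lemma:
  fixes f :: "real \<Rightarrow> real"
  assumes "locally_integrable f"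
    and zero: "\<And>\<phi> :: real \<Rightarrow> real. test_function \<phi> \<Longrightarrow> (LINT t:{0<..<1}|lebesgue. \<phi> t *\<^sub>R f t) = 0"
  shows "ae_unit (\<lambda>t. f t = 0)"
proof -
  have z: "(LINT t:{a<..<b}|lebesgue. f t) = 0" if ab: "0 < a" "a < b" "b < 1" for a b
  proof -
    have f: "set_integrable lebesgue {a..b} f" using assms(1) ab by (auto simp: locally_integrable_def)
    then have fi: "integrable lebesgue (\<lambda>t. indicator {a..b} t * f t)" by (simp add: set_integrable_def)
    let ?s = "\<lambda>n t. bump a b n t * (indicator {a..b} t * f t)"
    have "(\<lambda>n. LINT t|lebesgue. ?s n t) \<longlonglongrightarrow> (LINT t|lebesgue. indicator {a<..<b} t * f t)"
    proof (rule integral_dominated_convergence)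
      show "integrable lebesgue (\<lambda>t. norm (indicator {a..b} t * f t))" using fi by (rule integrable_norm)
      show "?s n \<in> borel_measurable lebesgue" for n
      proof (rule borel_measurable_times)
        have "continuous_on UNIV (bump a b n)" by (rule smooth_continuous_on[OF bump_props(1)])
        then show "bump a b n \<in> borel_measurable lebesgue"
          by (intro measurable_completion) (simp add: borel_measurable_continuous_onI)
      qed (use fi in blast)
      show "AE t in lebesgue. (\<lambda>n. ?s n t) \<longlonglongrightarrow> indicator {a<..<b} t * f t"
      proof (rule AE_I2)
        fix t
        have "(\<lambda>n. ?s n t) \<longlonglongrightarrow> indicator {a<..<b} t * (indicator {a..b} t * f t)"
          by (intro tendsto_intros bump_props(6))
        then show "(\<lambda>n. ?s n t) \<longlonglongrightarrow> indicator {a<..<b} t * f t" by (auto simp: indicator_def split: if_splits)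
      qed
      show "AE t in lebesgue. norm (?s n t) \<le> norm (indicator {a..b} t * f t)" for n
        using bump_props(3,4)[of a b n] by (auto simp: abs_mult intro!: mult_left_le_one_le)
      show "(\<lambda>t. indicator {a<..<b} t * f t) \<in> borel_measurable lebesgue"
      proof -
        have "(\<lambda>t. indicator {a<..<b} t * (indicator {a..b} t * f t)) \<in> borel_measurable lebesgue"
          using borel_measurable_integrable[OF integrable_mult_indicator[OF _ fi, of "{a<..<b}"]] by simp
        moreover have "(\<lambda>t. indicator {a<..<b} t * (indicator {a..b} t * f t)) = (\<lambda>t. indicator {a<..<b} t * f t)"
          by (auto simp: indicator_def)
        ultimately show ?thesis by simp
      qed
    qed
    moreover have "(LINT t|lebesgue. ?s n t) = 0" for n
      using zero[OF test_function_bump[of a b n]] ab integral_Ioo_unit_test[of a b "bump a b n" f] bump_props(2)[of _ a b n]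
      by (simp add: set_lebesgue_integral_def mult_ac)
    ultimately have "(\<lambda>n. 0) \<longlonglongrightarrow> (LINT t|lebesgue. indicator {a<..<b} t * f t)" by simp
    then show ?thesis by (simp add: set_lebesgue_integral_def LIMSEQ_const_iff)
  qed
  have ae: "AE t in lebesgue. indicator {a<..<b} t * f t = 0" if ab: "0 < a" "a < b" "b < 1" for a b
  proof (rule AE_zero_if_Ioi_integrals_zero)
    have "set_integrable lebesgue {a..b} f" using assms(1) ab by (auto simp: locally_integrable_def)
    then have "set_integrable lebesgue {a<..<b} f" by (rule set_integrable_subset) auto
    then show "integrable lebesgue (\<lambda>t. indicator {a<..<b} t * f t)" by (simp add: set_integrable_def)
    show "(LINT t|lebesgue. indicator {a<..<b} t * f t) = 0"
      using z[OF ab] by (simp add: set_lebesgue_integral_def)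
    fix x :: real
    have "(LINT t:{x<..}|lebesgue. indicator {a<..<b} t * f t) = (LINT t:{max a x<..<b}|lebesgue. f t)"
      unfolding set_lebesgue_integral_def
      by (rule Bochner_Integration.integral_cong) (auto simp: indicator_def)
    also have "\<dots> = 0"
      using z[of "max a x" b] ab by (cases "max a x < b") (auto simp: set_lebesgue_integral_def)
    finally show "(LINT t:{x<..}|lebesgue. indicator {a<..<b} t * f t) = 0" .
  qed
  \<comment> \<open>With n + 3 the left end is at most 1/3 and the right end at least 2/3, so each
    interval is nonempty.\<close>
  have "AE t in lebesgue. \<forall>n::nat. indicator {1 / (real n + 3)<..<1 - 1 / (real n + 3)} t * f t = 0"
    unfolding AE_all_countable
  proof
    fix n :: nat
    have "1 / (real n + 3) \<le> 1 / 3" by (rule divide_left_mono) auto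
    then show "AE t in lebesgue. indicator {1 / (real n + 3)<..<1 - 1 / (real n + 3)} t * f t = 0"
      by (intro ae) auto
  qed
  then show ?thesis
  proof eventually_elim
    case (elim t)
    show ?case
    proof
      assume t: "t \<in> {0<..<1}"
      define m where "m = min t (1 - t)"
      have m: "0 < m" "m \<le> t" "m \<le> 1 - t" using t by (auto simp: m_def)
      obtain n :: nat where "1 / m < real n" using reals_Archimedean2 by blast
      then have "1 / m < real n + 3" by simp
      then have "1 / (real n + 3) < m" using m(1) by (simp add: field_simps)
      then show "f t = 0" using elim[rule_format, of n] m by (auto simp: indicator_def split: if_splits)
    qed
  qed
qed

section \<open>Absolutely continuous functions\<close>

text \<open>Absolute continuity encoded by the fundamental theorem itself: f' is part of the data
  and matters only up to null sets.\<close>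

definition AC :: "(real \<Rightarrow> real) \<Rightarrow> (real \<Rightarrow> real) \<Rightarrow> bool" where
  "AC f f' \<longleftrightarrow> f' absolutely_integrable_on {0..1} \<and> (\<forall>t\<in>{0..1}. f t = f 0 + integral {0..t} f')"

lemma absint_sub:
  fixes f :: "real \<Rightarrow> real"
  shows "f absolutely_integrable_on {0..1} \<Longrightarrow> 0 \<le> s \<Longrightarrow> t \<le> 1 \<Longrightarrow> f absolutely_integrable_on {s..t::real}"
  by (rule absolutely_integrable_on_subinterval) auto

lemma absint_integrable:
  fixes f :: "real \<Rightarrow> real"
  shows "f absolutely_integrable_on S \<Longrightarrow> f integrable_on S"
  by (simp add: absolutely_integrable_on_def)

lemma AC_absint: "AC f f' \<Longrightarrow> f' absolutely_integrable_on {0..1}"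
  by (simp add: AC_def)

lemma AC_at: "AC f f' \<Longrightarrow> t \<in> {0..1} \<Longrightarrow> f t = f 0 + integral {0..t} f'"
  unfolding AC_def by blast

lemma AC_diff:
  assumes "AC f f'" "0 \<le> s" "s \<le> t" "t \<le> 1"
  shows "f t - f s = integral {s..t} f'"
proof -
  have "integral {0..s} f' + integral {s..t} f' = integral {0..t} f'"
    using assms absint_integrable[OF absint_sub[OF AC_absint[OF assms(1)], of 0 t]]
    by (intro Henstock_Kurzweil_Integration.integral_combine) auto
  moreover have "f s = f 0 + integral {0..s} f'" "f t = f 0 + integral {0..t} f'"
    using AC_at[OF assms(1), of s] AC_at[OF assms(1), of t] assms(2-4) by simp_all
  ultimately show ?thesis by linarith
qed

lemma AC_continuous: "AC f f' \<Longrightarrow> continuous_on {0..1} f"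
proof -
  assume f: "AC f f'"
  have "continuous_on {0..1} (\<lambda>t. f 0 + integral {0..t} f')"
    using absint_integrable[OF AC_absint[OF f]] by (intro continuous_intros indefinite_integral_continuous_1)
  then show ?thesis by (rule continuous_on_eq) (rule AC_at[OF f, symmetric])
qed

text \<open>Over a partition of [0, t] finer than d the increments of V telescope, so |Z t - Z 0| is
  at most e (V t - V 0) for every e > 0.\<close>

lemma small_increments_imp_eq:
  fixes Z V :: "real \<Rightarrow> real"
  assumes small: "\<And>e. e > 0 \<Longrightarrow> \<exists>d>0. \<forall>s t. 0 \<le> s \<and> s \<le> t \<and> t \<le> 1 \<and> t - s < d \<longrightarrow> \<bar>Z t - Z s\<bar> \<le> e * (V t - V s)"
    and t: "0 \<le> t" "t \<le> 1"
  shows "Z t = Z 0"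
proof -
  have bound: "\<bar>Z t - Z 0\<bar> \<le> e * (V t - V 0)" if "e > 0" for e
  proof -
    obtain d where d: "d > 0" "\<And>s t. 0 \<le> s \<Longrightarrow> s \<le> t \<Longrightarrow> t \<le> 1 \<Longrightarrow> t - s < d \<Longrightarrow> \<bar>Z t - Z s\<bar> \<le> e * (V t - V s)"
      using small[OF \<open>e > 0\<close>] by blast
    obtain n :: nat where n: "1 / d < real n" using reals_Archimedean2 by blast
    have n0: "0 < real n" using n d(1) by (meson divide_pos_pos less_trans zero_less_one)
    have nd: "1 / real n < d" using n n0 d(1) by (simp add: field_simps)
    let ?x = "\<lambda>k. real k * t / real n"
    have "k \<le> n \<Longrightarrow> \<bar>Z (?x k) - Z 0\<bar> \<le> e * (V (?x k) - V 0)" for k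
    proof (induction k)
      case (Suc k)
      have "real (Suc k) * t \<le> real n * 1" using Suc.prems t by (intro mult_mono) auto
      then have 1: "?x (Suc k) \<le> 1" using n0 by simp
      have "?x (Suc k) - ?x k = t / real n" by (simp add: distrib_right add_divide_distrib)
      moreover have "t / real n \<le> 1 / real n" using t n0 by (intro divide_right_mono) auto
      moreover have "0 \<le> t / real n" using t by simp
      ultimately have 2: "?x k \<le> ?x (Suc k)" "?x (Suc k) - ?x k < d" using nd by linarith+
      have "\<bar>Z (?x (Suc k)) - Z (?x k)\<bar> \<le> e * (V (?x (Suc k)) - V (?x k))"
        using t by (intro d(2) 1 2) simp
      moreover have "\<bar>Z (?x k) - Z 0\<bar> \<le> e * (V (?x k) - V 0)" using Suc by simp
      ultimately show ?case unfolding right_diff_distrib by linarith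
    qed simp
    from this[of n] show ?thesis using n0 by simp
  qed
  show ?thesis
  proof (rule ccontr)
    assume "Z t \<noteq> Z 0"
    then have p: "0 < \<bar>Z t - Z 0\<bar>" by simp
    \<comment> \<open>The bound with e = 1 makes this difference positive; it can then be the
      denominator of an e for which |Z t - Z 0| is at most half of itself.\<close>
    have "0 < V t - V 0" using bound[of 1] p by simp
    then have "\<bar>Z t - Z 0\<bar> \<le> \<bar>Z t - Z 0\<bar> / (2 * (V t - V 0)) * (V t - V 0)"
      using p by (intro bound) simp
    moreover have "x / (2 * D) * D = x / 2" if "0 < D" for x D :: real using that by simp
    from this[OF \<open>0 < V t - V 0\<close>] have "\<bar>Z t - Z 0\<bar> / (2 * (V t - V 0)) * (V t - V 0) = \<bar>Z t - Z 0\<bar> / 2" .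
    ultimately show False using p by simp
  qed
qed

text \<open>The product and chain rules come from comparing increments over short intervals: errors
  that are small relative to the additive quantity \<open>integral {s..t} W\<close> cannot
  accumulate. Points of differentiability never enter.\<close>

lemma AC_by_increments:
  assumes h': "h' absolutely_integrable_on {0..1}" and W: "W integrable_on {0..1}"
    and small: "\<And>e. e > 0 \<Longrightarrow> \<exists>d>0. \<forall>s t. 0 \<le> s \<and> s \<le> t \<and> t \<le> 1 \<and> t - s < d \<longrightarrow>
      \<bar>h t - h s - integral {s..t} h'\<bar> \<le> e * integral {s..t} W"
  shows "AC h h'"
proof -
  let ?Z = "\<lambda>t. h t - integral {0..t} h'" and ?V = "\<lambda>t. integral {0..t} W"
  have comb: "integral {0..t} f - integral {0..s} f = integral {s..t} f"
    if "f integrable_on {0..1}" "0 \<le> s" "s \<le> t" "t \<le> 1" for s t and f :: "real \<Rightarrow> real"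
  proof -
    have "f integrable_on {0..t}" using that by (auto intro: integrable_on_subinterval)
    then show ?thesis
      using Henstock_Kurzweil_Integration.integral_combine[of 0 s t f] that by simp
  qed
  have Z0: "?Z t = ?Z 0" if "t \<in> {0..1}" for t
  proof (rule small_increments_imp_eq[where V = ?V])
    fix e :: real assume "e > 0"
    from small[OF this] obtain d where d: "d > 0"
      "\<And>s t. 0 \<le> s \<and> s \<le> t \<and> t \<le> 1 \<and> t - s < d \<Longrightarrow> \<bar>h t - h s - integral {s..t} h'\<bar> \<le> e * integral {s..t} W" by blast
    show "\<exists>d>0. \<forall>s t. 0 \<le> s \<and> s \<le> t \<and> t \<le> 1 \<and> t - s < d \<longrightarrow> \<bar>?Z t - ?Z s\<bar> \<le> e * (?V t - ?V s)"
    proof (intro exI[of _ d] conjI allI impI d(1))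
      fix s t assume st: "0 \<le> s \<and> s \<le> t \<and> t \<le> 1 \<and> t - s < d"
      have "?Z t - ?Z s = h t - h s - integral {s..t} h'"
        using comb[OF absint_integrable[OF h'], of s t] st by linarith
      moreover have "?V t - ?V s = integral {s..t} W"
        using comb[OF W, of s t] st by linarith
      ultimately show "\<bar>?Z t - ?Z s\<bar> \<le> e * (?V t - ?V s)" using d(2)[OF st] by simp
    qed
  qed (use that in auto)
  have "h t = h 0 + integral {0..t} h'" if "t \<in> {0..1}" for t
  proof -
    have "?Z t = ?Z 0" by (rule Z0[OF that])
    then show ?thesis by simp
  qed
  with h' show ?thesis unfolding AC_def by blast
qed

lemma absint_mult_continuous:
  fixes f g :: "real \<Rightarrow> real"
  assumes "f absolutely_integrable_on {a..b}" "continuous_on {a..b} g"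
  shows "(\<lambda>t. g t * f t) absolutely_integrable_on {a..b}"
proof -
  have "bounded (g ` {a..b})" using assms(2) by (intro compact_imp_bounded compact_continuous_image) auto
  then show ?thesis
    using assms by (intro absolutely_integrable_bounded_measurable_product_real
      continuous_imp_measurable_on_sets_lebesgue) auto
qed

lemma continuous_small_oscillation:
  fixes f :: "real \<Rightarrow> real"
  assumes "continuous_on {0..1} f" "e > 0"
  obtains d where "d > 0" "\<And>x y. x \<in> {0..1} \<Longrightarrow> y \<in> {0..1} \<Longrightarrow> \<bar>x - y\<bar> < d \<Longrightarrow> \<bar>f x - f y\<bar> \<le> e"
proof -
  have "uniformly_continuous_on {0..1} f" using assms by (intro compact_uniformly_continuous) auto
  then show ?thesis using assms(2) that unfolding uniformly_continuous_on_def dist_real_def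
    by (metis less_imp_le)
qed

lemma AC_mult:
  assumes f: "AC f f'" and g: "AC g g'"
  shows "AC (\<lambda>t. f t * g t) (\<lambda>t. f' t * g t + f t * g' t)"
proof (rule AC_by_increments)
  note cf = AC_continuous[OF f] and cg = AC_continuous[OF g]
  have 1: "(\<lambda>t. g t * f' t) absolutely_integrable_on {0..1}" using AC_absint[OF f] cg by (rule absint_mult_continuous)
  have 2: "(\<lambda>t. f t * g' t) absolutely_integrable_on {0..1}" using AC_absint[OF g] cf by (rule absint_mult_continuous)
  show h': "(\<lambda>t. f' t * g t + f t * g' t) absolutely_integrable_on {0..1}"
    using set_integral_add(1)[OF 1 2] by (simp add: mult.commute)
  show "(\<lambda>t. \<bar>f' t\<bar> + \<bar>g' t\<bar>) integrable_on {0..1}"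
    using f g by (intro integrable_add) (auto simp: AC_def absolutely_integrable_on_def)
  fix e :: real assume e: "e > 0"
  obtain d1 where d1: "d1 > 0" "\<And>x y. x \<in> {0..1} \<Longrightarrow> y \<in> {0..1} \<Longrightarrow> \<bar>x - y\<bar> < d1 \<Longrightarrow> \<bar>f x - f y\<bar> \<le> e" by (rule continuous_small_oscillation[OF cf e]) blast
  obtain d2 where d2: "d2 > 0" "\<And>x y. x \<in> {0..1} \<Longrightarrow> y \<in> {0..1} \<Longrightarrow> \<bar>x - y\<bar> < d2 \<Longrightarrow> \<bar>g x - g y\<bar> \<le> e" by (rule continuous_small_oscillation[OF cg e]) blast
  show "\<exists>d>0. \<forall>s t. 0 \<le> s \<and> s \<le> t \<and> t \<le> 1 \<and> t - s < d \<longrightarrow>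
      \<bar>f t * g t - f s * g s - integral {s..t} (\<lambda>t. f' t * g t + f t * g' t)\<bar> \<le> e * integral {s..t} (\<lambda>t. \<bar>f' t\<bar> + \<bar>g' t\<bar>)"
  proof (intro exI[of _ "min d1 d2"] conjI allI impI)
    fix s t assume st: "0 \<le> s \<and> s \<le> t \<and> t \<le> 1 \<and> t - s < min d1 d2"
    note sub = absint_integrable[OF absint_sub]
    have i: "f' integrable_on {s..t}" "g' integrable_on {s..t}"
      "(\<lambda>t. f' t * g t + f t * g' t) integrable_on {s..t}"
      "(\<lambda>t. \<bar>f' t\<bar> + \<bar>g' t\<bar>) integrable_on {s..t}"
      using st sub[OF AC_absint[OF f]] sub[OF AC_absint[OF g]] sub[OF h']
        absint_sub[OF AC_absint[OF f], of s t] absint_sub[OF AC_absint[OF g], of s t]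
      by (auto intro!: integrable_add simp: absolutely_integrable_on_def)
    \<comment> \<open>With g frozen at s and f frozen at t, the increment of the product is exactly
      the integral of \<open>?r\<close>; unfreezing costs the oscillations of f and g, which are at
      most e.\<close>
    let ?r = "\<lambda>\<tau>. f' \<tau> * g s + f t * g' \<tau>"
    have ir: "?r integrable_on {s..t}"
      using i by (intro integrable_add integrable_on_mult_left integrable_on_mult_right)
    have "f t * g t - f s * g s = (f t - f s) * g s + f t * (g t - g s)" by (simp add: algebra_simps)
    also have "\<dots> = integral {s..t} f' * g s + f t * integral {s..t} g'"
      using AC_diff[OF f] AC_diff[OF g] st by simp
    also have "\<dots> = integral {s..t} ?r"
      using i by (subst Henstock_Kurzweil_Integration.integral_add)
        (auto intro: integrable_on_mult_left integrable_on_mult_right)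
    finally have "f t * g t - f s * g s - integral {s..t} (\<lambda>t. f' t * g t + f t * g' t)
        = integral {s..t} (\<lambda>\<tau>. ?r \<tau> - (f' \<tau> * g \<tau> + f \<tau> * g' \<tau>))"
      using ir i by (simp add: Henstock_Kurzweil_Integration.integral_diff)
    also have "\<bar>\<dots>\<bar> \<le> integral {s..t} (\<lambda>\<tau>. e * (\<bar>f' \<tau>\<bar> + \<bar>g' \<tau>\<bar>))"
    proof (rule integral_norm_bound_integral[where 'a = real, unfolded real_norm_def])
      show "(\<lambda>\<tau>. ?r \<tau> - (f' \<tau> * g \<tau> + f \<tau> * g' \<tau>)) integrable_on {s..t}"
        using ir i(3) by (rule integrable_diff)
      show "(\<lambda>\<tau>. e * (\<bar>f' \<tau>\<bar> + \<bar>g' \<tau>\<bar>)) integrable_on {s..t}"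
        using i(4) by (rule integrable_on_mult_right)
      fix \<tau> assume \<tau>: "\<tau> \<in> {s..t}"
      have "\<bar>g s - g \<tau>\<bar> \<le> e" using st \<tau> by (intro d2(2)) auto
      moreover have "\<bar>f t - f \<tau>\<bar> \<le> e" using st \<tau> by (intro d1(2)) auto
      ultimately have "\<bar>f' \<tau>\<bar> * \<bar>g s - g \<tau>\<bar> + \<bar>f t - f \<tau>\<bar> * \<bar>g' \<tau>\<bar> \<le> \<bar>f' \<tau>\<bar> * e + e * \<bar>g' \<tau>\<bar>"
        by (intro add_mono mult_left_mono mult_right_mono) auto
      moreover have "?r \<tau> - (f' \<tau> * g \<tau> + f \<tau> * g' \<tau>) = f' \<tau> * (g s - g \<tau>) + (f t - f \<tau>) * g' \<tau>"
        by (simp add: algebra_simps)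
      moreover have "\<bar>f' \<tau> * (g s - g \<tau>) + (f t - f \<tau>) * g' \<tau>\<bar> \<le> \<bar>f' \<tau>\<bar> * \<bar>g s - g \<tau>\<bar> + \<bar>f t - f \<tau>\<bar> * \<bar>g' \<tau>\<bar>"
        by (metis abs_mult abs_triangle_ineq)
      ultimately show "\<bar>?r \<tau> - (f' \<tau> * g \<tau> + f \<tau> * g' \<tau>)\<bar> \<le> e * (\<bar>f' \<tau>\<bar> + \<bar>g' \<tau>\<bar>)"
        by (simp add: algebra_simps)
    qed
    finally show "\<bar>f t * g t - f s * g s - integral {s..t} (\<lambda>t. f' t * g t + f t * g' t)\<bar> \<le> e * integral {s..t} (\<lambda>t. \<bar>f' t\<bar> + \<bar>g' t\<bar>)"
      by simp
  qed (use d1 d2 in auto)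
qed

lemma AC_chain:
  assumes f: "AC f f'" and S: "is_interval S" "f ` {0..1} \<subseteq> S"
    and F: "\<And>y. y \<in> S \<Longrightarrow> (F has_real_derivative F' y) (at y)" "continuous_on S F'"
  shows "AC (\<lambda>t. F (f t)) (\<lambda>t. F' (f t) * f' t)"
proof (rule AC_by_increments)
  note cf = AC_continuous[OF f]
  have cF: "continuous_on {0..1} (\<lambda>t. F' (f t))"
    using F(2) cf S(2) by (rule continuous_on_compose2)
  show h': "(\<lambda>t. F' (f t) * f' t) absolutely_integrable_on {0..1}"
    using AC_absint[OF f] cF by (rule absint_mult_continuous)
  show "(\<lambda>t. \<bar>f' t\<bar>) integrable_on {0..1}"
    using f by (auto simp: AC_def absolutely_integrable_on_def)
  fix e :: real assume e: "e > 0"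
  obtain d where d: "d > 0" "\<And>x y. x \<in> {0..1} \<Longrightarrow> y \<in> {0..1} \<Longrightarrow> \<bar>x - y\<bar> < d \<Longrightarrow> \<bar>F' (f x) - F' (f y)\<bar> \<le> e" by (rule continuous_small_oscillation[OF cF e]) blast
  show "\<exists>d>0. \<forall>s t. 0 \<le> s \<and> s \<le> t \<and> t \<le> 1 \<and> t - s < d \<longrightarrow>
      \<bar>F (f t) - F (f s) - integral {s..t} (\<lambda>t. F' (f t) * f' t)\<bar> \<le> e * integral {s..t} (\<lambda>t. \<bar>f' t\<bar>)"
  proof (intro exI[of _ d] conjI allI impI d(1))
    fix s t assume st: "0 \<le> s \<and> s \<le> t \<and> t \<le> 1 \<and> t - s < d"
    have mvt: "\<exists>y\<in>{min a b..max a b}. F b - F a = F' y * (b - a)" if "a \<in> S" "b \<in> S" for a b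
    proof -
      have sub: "{min a b..max a b} \<subseteq> S"
        using that mem_is_interval_1_I[OF S(1), of "min a b" "max a b"] by (auto simp: min_def max_def split: if_splits)
      show ?thesis
      proof (cases a b rule: linorder_cases)
        case less
        then obtain z where "a < z" "z < b" "F b - F a = (b - a) * F' z"
        proof -
          have "(F has_real_derivative F' x) (at x)" if "a \<le> x" "x \<le> b" for x
            using that sub less by (intro F(1)) auto
          from MVT2[OF less this] show ?thesis using that by auto
        qed
        then show ?thesis using less by (intro bexI[of _ z]) auto
      next
        case greater
        then obtain z where "b < z" "z < a" "F a - F b = (a - b) * F' z"
        proof -
          have "(F has_real_derivative F' x) (at x)" if "b \<le> x" "x \<le> a" for x
            using that sub greater by (intro F(1)) auto
          from MVT2[OF greater this] show ?thesis using that by auto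
        qed
        then show ?thesis using greater by (intro bexI[of _ z]) (auto simp: algebra_simps)
      qed simp
    qed
    have fst: "f s \<in> S" "f t \<in> S" using st S(2) by (auto simp: image_subset_iff)
    obtain y where y: "y \<in> {min (f s) (f t)..max (f s) (f t)}" "F (f t) - F (f s) = F' y * (f t - f s)"
      using mvt[OF fst] by blast
    have cst: "continuous_on {s..t} f" using cf st by (auto intro: continuous_on_subset)
    \<comment> \<open>The mean value y lies between f s and f t, so it is attained at a parameter in
      [s, t], within reach of the oscillation bound for \<open>F' (f t)\<close>.\<close>
    obtain \<sigma> where \<sigma>: "\<sigma> \<in> {s..t}" "f \<sigma> = y"
    proof (cases "f s \<le> f t")
      case True
      then show ?thesis using IVT'[of f s y t] y st cst that by auto
    next
      case False
      then show ?thesis using IVT2'[of f t y s] y st cst that by auto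
    qed
    note sub = absint_integrable[OF absint_sub]
    have i: "f' integrable_on {s..t}" "(\<lambda>t. F' (f t) * f' t) integrable_on {s..t}" "(\<lambda>t. \<bar>f' t\<bar>) integrable_on {s..t}"
      using st sub[OF AC_absint[OF f]] sub[OF h'] absint_sub[OF AC_absint[OF f], of s t]
      by (auto simp: absolutely_integrable_on_def)
    have ir: "(\<lambda>\<tau>. F' (f \<sigma>) * f' \<tau>) integrable_on {s..t}" using i by (intro integrable_on_mult_right)
    have "F (f t) - F (f s) = integral {s..t} (\<lambda>\<tau>. F' (f \<sigma>) * f' \<tau>)"
      using y(2) \<sigma>(2) AC_diff[OF f] st by simp
    then have "F (f t) - F (f s) - integral {s..t} (\<lambda>t. F' (f t) * f' t)
        = integral {s..t} (\<lambda>\<tau>. F' (f \<sigma>) * f' \<tau> - F' (f \<tau>) * f' \<tau>)"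
      using ir i by (simp add: Henstock_Kurzweil_Integration.integral_diff)
    also have "\<bar>\<dots>\<bar> \<le> integral {s..t} (\<lambda>\<tau>. e * \<bar>f' \<tau>\<bar>)"
    proof (rule integral_norm_bound_integral[where 'a = real, unfolded real_norm_def])
      show "(\<lambda>\<tau>. F' (f \<sigma>) * f' \<tau> - F' (f \<tau>) * f' \<tau>) integrable_on {s..t}"
        using ir i(2) by (rule integrable_diff)
      show "(\<lambda>\<tau>. e * \<bar>f' \<tau>\<bar>) integrable_on {s..t}"
        using i(3) by (rule integrable_on_mult_right)
      fix \<tau> assume \<tau>: "\<tau> \<in> {s..t}"
      have "\<bar>F' (f \<sigma>) - F' (f \<tau>)\<bar> \<le> e" using st \<tau> \<sigma> by (intro d(2)) auto
      then show "\<bar>F' (f \<sigma>) * f' \<tau> - F' (f \<tau>) * f' \<tau>\<bar> \<le> e * \<bar>f' \<tau>\<bar>"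
        by (simp add: abs_mult mult_right_mono flip: left_diff_distrib)
    qed
    finally show "\<bar>F (f t) - F (f s) - integral {s..t} (\<lambda>t. F' (f t) * f' t)\<bar> \<le> e * integral {s..t} (\<lambda>t. \<bar>f' t\<bar>)"
      by simp
  qed
qed

lemma AC_add: "AC f f' \<Longrightarrow> AC g g' \<Longrightarrow> AC (\<lambda>t. f t + g t) (\<lambda>t. f' t + g' t)"
  unfolding AC_def
proof (intro conjI ballI)
  assume a: "f' absolutely_integrable_on {0..1} \<and> (\<forall>t\<in>{0..1}. f t = f 0 + integral {0..t} f')"
    "g' absolutely_integrable_on {0..1} \<and> (\<forall>t\<in>{0..1}. g t = g 0 + integral {0..t} g')"
  then show "(\<lambda>t. f' t + g' t) absolutely_integrable_on {0..1}" by (intro set_integral_add) auto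
  fix t :: real assume t: "t \<in> {0..1}"
  have "f' integrable_on {0..t}" "g' integrable_on {0..t}"
    using a t absint_integrable[OF absint_sub, of f' 0 t] absint_integrable[OF absint_sub, of g' 0 t] by auto
  then show "f t + g t = f 0 + g 0 + integral {0..t} (\<lambda>t. f' t + g' t)"
    using bspec[OF conjunct2[OF a(1)] t] bspec[OF conjunct2[OF a(2)] t]
    by (simp only: Henstock_Kurzweil_Integration.integral_add)
qed

lemma AC_C1:
  assumes "\<And>t. t \<in> {0..1} \<Longrightarrow> (f has_real_derivative f' t) (at t within {0..1})" "continuous_on {0..1} f'"
  shows "AC f f'"
  unfolding AC_def
proof (intro conjI ballI)
  show "f' absolutely_integrable_on {0..1}"
    using assms(2) by (rule absolutely_integrable_continuous_real)
  fix t :: real assume t: "t \<in> {0..1}"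
  have "(f' has_integral (f t - f 0)) {0..t}"
  proof (rule fundamental_theorem_of_calculus)
    fix x assume x: "x \<in> {0..t}"
    then have "(f has_vector_derivative f' x) (at x within {0..1})"
      using assms(1)[of x] t by (simp add: has_real_derivative_iff_has_vector_derivative)
    then show "(f has_vector_derivative f' x) (at x within {0..t})"
      by (rule has_vector_derivative_within_subset) (use t in auto)
  qed (use t in simp)
  from integral_unique[OF this] show "f t = f 0 + integral {0..t} f'" by simp
qed

lemma AC_cmult: "AC f f' \<Longrightarrow> AC (\<lambda>t. c * f t) (\<lambda>t. c * f' t)"
  using AC_mult[OF AC_C1[of "\<lambda>_. c" "\<lambda>_. 0"], of f f'] by simp

lemma ae_unitE:
  assumes "ae_unit P"
  obtains N where "negligible N" "\<And>t. t \<in> {0..1} \<Longrightarrow> t \<notin> N \<Longrightarrow> P t"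
proof -
  from assms obtain N where N: "N \<in> null_sets lebesgue" "{t. \<not> (t \<in> {0<..<1} \<longrightarrow> P t)} \<subseteq> N"
    by (auto simp: eventually_ae_filter)
  show ?thesis
  proof (rule that[of "N \<union> {0, 1}"])
    show "negligible (N \<union> {0, 1})" using N(1) by (simp add: negligible_iff_null_sets[symmetric] negligible_Un)
    fix t :: real assume "t \<in> {0..1}" "t \<notin> N \<union> {0, 1}"
    then have "t \<notin> N" "t \<in> {0<..<1}" by auto
    then show "P t" using N(2) by blast
  qed
qed

lemma AC_cong_ae:
  assumes "AC f f'" "ae_unit (\<lambda>t. f' t = g' t)"
  shows "AC f g'"
proof -
  obtain N where N: "negligible N" "\<And>t. t \<in> {0..1} \<Longrightarrow> t \<notin> N \<Longrightarrow> f' t = g' t"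
    using ae_unitE[OF assms(2)] by blast
  have "g' absolutely_integrable_on {0..1}"
    by (rule absolutely_integrable_spike[OF AC_absint[OF assms(1)] N(1)]) (use N in auto)
  moreover have "integral {0..t} g' = integral {0..t} f'" if "t \<in> {0..1}" for t
    by (rule integral_spike[OF N(1)]) (use N that in auto)
  ultimately show ?thesis
    unfolding AC_def using AC_at[OF assms(1)] by metis
qed

text \<open>A continuous derivative turns absolute continuity into C^1 up to the endpoints; this is
  how identities that hold almost everywhere become classical ones.\<close>

lemma AC_has_derivative:
  assumes "AC f f'" "continuous_on {0..1} f'" "t \<in> {0..1}"
  shows "(f has_real_derivative f' t) (at t within {0..1})"
proof -
  have "((\<lambda>u. integral {0..u} f') has_real_derivative f' t) (at t within {0..1})"
    using assms by (intro integral_has_real_derivative) auto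
  then have "((\<lambda>u. f 0 + integral {0..u} f') has_real_derivative f' t) (at t within {0..1})"
    by (auto intro!: derivative_eq_intros)
  then show ?thesis
    by (rule has_field_derivative_transform_within[of _ _ _ _ 1]) (use assms AC_at[OF assms(1), symmetric] in auto)
qed

section \<open>Weak derivatives\<close>

lemma absint_Ioo_iff:
  fixes g :: "real \<Rightarrow> 'a::euclidean_space"
  shows "set_integrable lebesgue {0<..<1} g \<longleftrightarrow> g absolutely_integrable_on {0..1}"
  by (rule absolutely_integrable_on_Icc_iff_Ioo[symmetric])

lemma LINT_unit:
  fixes g :: "real \<Rightarrow> 'a::euclidean_space"
  assumes "g absolutely_integrable_on {0..1}"
  shows "(LINT t:{0<..<1}|lebesgue. g t) = integral {0..1} g"
  using assms set_lebesgue_integral_eq_integral(2)[of "{0<..<1}" g] integral_open_interval_real[of 0 1 g]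
  by (simp add: absint_Ioo_iff)

lemma test_function_vderiv:
  assumes "test_function \<phi>"
  shows "test_function (vderiv \<phi>)"
proof -
  obtain a b where ab: "0 < a" "a < b" "b < 1" "\<And>t. t \<notin> {a..b} \<Longrightarrow> \<phi> t = 0"
    by (rule test_functionE[OF assms]) blast
  have sm: "smooth \<phi>" using assms by (rule test_function_smooth)
  have "vderiv \<phi> t = 0" if "t \<notin> {a..b}" for t
  proof -
    have "((\<lambda>_. 0) has_vector_derivative 0) (at t)" by simp
    then have "(\<phi> has_vector_derivative 0) (at t)"
      by (rule has_vector_derivative_transform_within_open[where S = "- {a..b}"]) (use that ab(4) in auto)
    then show ?thesis by (simp add: vderiv_def vector_derivative_at)
  qed
  then show ?thesis using smoothD(1)[OF sm] ab by (intro test_functionI) auto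
qed

lemma test_function_combine:
  fixes \<phi> \<psi> :: "real \<Rightarrow> real"
  assumes "test_function \<phi>" "test_function \<psi>"
  shows "test_function (\<lambda>t. \<phi> t + c * \<psi> t)" "vderiv (\<lambda>t. \<phi> t + c * \<psi> t) = (\<lambda>t. vderiv \<phi> t + c * vderiv \<psi> t)"
proof -
  obtain a b where ab: "0 < a" "a < b" "b < 1" "\<And>t. t \<notin> {a..b} \<Longrightarrow> \<phi> t = 0"
    by (rule test_functionE[OF assms(1)]) blast
  obtain a' b' where ab': "0 < a'" "a' < b'" "b' < 1" "\<And>t. t \<notin> {a'..b'} \<Longrightarrow> \<psi> t = 0"
    by (rule test_functionE[OF assms(2)]) blast
  note sm = test_function_smooth[OF assms(1)] test_function_smooth[OF assms(2)]
  have "smooth (\<lambda>_. c)" by (rule smoothI[where P = "\<lambda>f. \<exists>c. f = (\<lambda>_. c)"])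
      (auto intro!: exI[of _ "\<lambda>_. 0"])
  then have "smooth (\<lambda>t. \<phi> t + c * \<psi> t)" using sm by (intro smooth_add smooth_mult)
  then show "test_function (\<lambda>t. \<phi> t + c * \<psi> t)"
  proof (rule test_functionI[of _ "min a a'" "max b b'"])
    fix t assume "t \<notin> {min a a'..max b b'}"
    then have "t \<notin> {a..b}" "t \<notin> {a'..b'}" by (auto simp: min_le_iff_disj le_max_iff_disj)
    then show "\<phi> t + c * \<psi> t = 0" using ab(4)[of t] ab'(4)[of t] by simp
  qed (use ab ab' in auto)
  show "vderiv (\<lambda>t. \<phi> t + c * \<psi> t) = (\<lambda>t. vderiv \<phi> t + c * vderiv \<psi> t)"
    using smoothD(2)[OF sm(1)] smoothD(2)[OF sm(2)]
    by (intro vderiv_eqI has_vector_derivative_add has_vector_derivative_mult_right)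
qed

lemma test_function_AC:
  fixes \<phi> :: "real \<Rightarrow> real"
  assumes "test_function \<phi>"
  shows "AC \<phi> (vderiv \<phi>)" "\<phi> 0 = 0" "\<phi> 1 = 0" "continuous_on A \<phi>" "\<phi> absolutely_integrable_on {0..1}"
proof -
  note sm = test_function_smooth[OF assms]
  show "AC \<phi> (vderiv \<phi>)"
    using smoothD[OF sm] smooth_continuous_on
    by (intro AC_C1) (auto simp: has_real_derivative_iff_has_vector_derivative intro: has_vector_derivative_at_within)
  obtain a b where ab: "0 < a" "a < b" "b < 1" "\<And>t. t \<notin> {a..b} \<Longrightarrow> \<phi> t = 0"
    by (rule test_functionE[OF assms]) blast
  show "\<phi> 0 = 0" "\<phi> 1 = 0" using ab by (auto intro!: ab(4))
  show c: "continuous_on A \<phi>" for A using sm by (rule smooth_continuous_on)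
  show "\<phi> absolutely_integrable_on {0..1}" using c by (rule absolutely_integrable_continuous_real)
qed

lemma test_mult_absint:
  fixes \<phi> :: "real \<Rightarrow> real"
  assumes "test_function \<phi>" "g absolutely_integrable_on {0..1}"
  shows "(\<lambda>t. \<phi> t * g t) absolutely_integrable_on {0..1}" "(\<lambda>t. \<phi> t * g t) integrable_on {0..1}"
  using absint_mult_continuous[OF assms(2) test_function_AC(4)[OF assms(1)]] absint_integrable by auto

lemma test_parts:
  fixes \<phi> :: "real \<Rightarrow> real"
  assumes "test_function \<phi>" "AC f f'"
  shows "integral {0..1} (\<lambda>t. vderiv \<phi> t * f t) = - integral {0..1} (\<lambda>t. \<phi> t * f' t)"
proof -
  note \<phi> = test_function_AC[OF assms(1)]
  have "AC (\<lambda>t. \<phi> t * f t) (\<lambda>t. vderiv \<phi> t * f t + \<phi> t * f' t)"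
    by (rule AC_mult[OF \<phi>(1) assms(2)])
  from AC_at[OF this, of 1] have "integral {0..1} (\<lambda>t. vderiv \<phi> t * f t + \<phi> t * f' t) = 0"
    using \<phi>(2,3) by simp
  moreover have "f absolutely_integrable_on {0..1}"
    using AC_continuous[OF assms(2)] by (rule absolutely_integrable_continuous_real)
  ultimately show ?thesis
    using test_mult_absint(2)[OF test_function_vderiv[OF assms(1)], of f] test_mult_absint(2)[OF assms(1) AC_absint[OF assms(2)]]
    by (simp add: Henstock_Kurzweil_Integration.integral_add)
qed

lemma exists_normalized_test_function:
  obtains \<rho> :: "real \<Rightarrow> real" where "test_function \<rho>" "integral {0..1} \<rho> = 1"
proof -
  let ?b = "bump (1/3) (2/3) 1"
  have t: "test_function ?b" by (rule test_function_bump) auto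
  have "integral {0..1} ?b \<noteq> 0"
  proof
    assume "integral {0..1} ?b = 0"
    then have "(?b has_integral 0) (cbox 0 1)"
      using absint_integrable[OF test_function_AC(5)[OF t]] by (simp add: has_integral_integral)
    then have "?b (1/2) = 0"
      using test_function_AC(4)[OF t] bump_props(3) by (intro has_integral_0_cbox_imp_0[of 0 1 ?b]) auto
    moreover have "?b (1/2) > 0" by (rule bump_props(5)) auto
    ultimately show False by simp
  qed
  then obtain c where c: "c * integral {0..1} ?b = 1" by (metis nonzero_eq_divide_eq)
  \<comment> \<open>Multiplication by c is written as a sum to fit
    \<open>test_function_combine\<close>.\<close>
  have "test_function (\<lambda>t. ?b t + (c - 1) * ?b t)"
    using t by (intro test_function_combine)
  moreover have "(\<lambda>t. ?b t + (c - 1) * ?b t) = (\<lambda>t. c * ?b t)"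
    by (simp add: algebra_simps)
  ultimately show ?thesis
    using c by (intro that[of "\<lambda>t. c * ?b t"]) simp_all
qed

text \<open>The primitive from 0 vanishes to the left of the support and, because the mean is zero,
  also to the right.\<close>

lemma test_function_antiderivative:
  fixes \<psi> :: "real \<Rightarrow> real"
  assumes \<psi>: "test_function \<psi>" and zero: "integral {0..1} \<psi> = 0"
  obtains \<Psi> where "test_function \<Psi>" "vderiv \<Psi> = \<psi>"
proof -
  obtain a b where ab: "0 < a" "a < b" "b < 1" "\<And>t. t \<notin> {a..b} \<Longrightarrow> \<psi> t = 0"
    by (rule test_functionE[OF \<psi>]) blast
  let ?\<Psi> = "\<lambda>t. integral {0..t} \<psi>"
  have int: "\<psi> integrable_on {c..d}" for c d
    using test_function_AC(4)[OF \<psi>] by (rule integrable_continuous_interval)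
  have left: "?\<Psi> t = 0" if "t \<le> a" for t
  proof -
    have "?\<Psi> t = integral {0..t} (\<lambda>_. 0)"
      by (rule integral_spike[of "{a}"]) (use that ab in auto)
    then show ?thesis by simp
  qed
  have right: "?\<Psi> t = 0" if "b \<le> t" for t
  proof -
    have "integral {0..b} \<psi> + integral {b..d} \<psi> = integral {0..d} \<psi>" if "b \<le> d" for d
      using that ab int by (intro Henstock_Kurzweil_Integration.integral_combine) auto
    moreover have "integral {b..d} \<psi> = integral {b..d} (\<lambda>_. 0)" for d
      by (rule integral_spike[of "{b}"]) (use ab in auto)
    ultimately have "integral {0..d} \<psi> = integral {0..b} \<psi>" if "b \<le> d" for d using that by fastforce
    from this[OF that] this[of 1] zero ab show ?thesis by simp
  qed
  have der: "(?\<Psi> has_vector_derivative \<psi> t) (at t)" for t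
  proof -
    consider "t < a" | "b < t" | "t \<in> {0<..<1}" using ab by fastforce
    then show ?thesis
    proof cases
      case 1
      have "((\<lambda>_. 0) has_vector_derivative 0) (at t)" by simp
      then have "(?\<Psi> has_vector_derivative 0) (at t)"
        by (rule has_vector_derivative_transform_within_open[where S = "{..<a}"]) (use 1 left in auto)
      then show ?thesis using ab(4)[of t] 1 by simp
    next
      case 2
      have "((\<lambda>_. 0) has_vector_derivative 0) (at t)" by simp
      then have "(?\<Psi> has_vector_derivative 0) (at t)"
        by (rule has_vector_derivative_transform_within_open[where S = "{b<..}"]) (use 2 right in auto)
      then show ?thesis using ab(4)[of t] 2 by simp
    next
      case 3
      have "(?\<Psi> has_vector_derivative \<psi> t) (at t within {0..1})"
        using 3 test_function_AC(4)[OF \<psi>] by (intro integral_has_vector_derivative) auto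
      then show ?thesis using 3 at_within_Icc_at[of 0 t 1] by simp
    qed
  qed
  show ?thesis
  proof (rule that)
    show "vderiv ?\<Psi> = \<psi>" using der by (rule vderiv_eqI)
    show "test_function ?\<Psi>"
      using smooth_from_deriv[OF der test_function_smooth[OF \<psi>]] ab left right
      by (intro test_functionI[of _ a b]) auto
  qed
qed

lemma integral_combine_test:
  fixes \<phi> \<rho> :: "real \<Rightarrow> real"
  assumes "test_function \<phi>" "test_function \<rho>" "g absolutely_integrable_on {0..1}"
  shows "integral {0..1} (\<lambda>t. (\<phi> t + c * \<rho> t) * g t)
    = integral {0..1} (\<lambda>t. \<phi> t * g t) + c * integral {0..1} (\<lambda>t. \<rho> t * g t)"
proof -
  have "(\<lambda>t. (\<phi> t + c * \<rho> t) * g t) = (\<lambda>t. \<phi> t * g t + c * (\<rho> t * g t))"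
    by (simp add: algebra_simps)
  then show ?thesis
    using test_mult_absint(2)[OF assms(1,3)] test_mult_absint(2)[OF assms(2,3)]
    by (simp add: Henstock_Kurzweil_Integration.integral_add integrable_on_mult_right)
qed

lemma absint_locally_integrable:
  fixes f :: "real \<Rightarrow> real"
  shows "f absolutely_integrable_on {0..1} \<Longrightarrow> locally_integrable f"
  unfolding locally_integrable_def by (auto intro: absint_sub)

text \<open>Subtracting from a test function its integral times a fixed \<open>\<rho>\<close> of
  mass 1 gives mean zero, hence the derivative of a test function. Using this twice removes both
  derivatives from \<open>\<phi>\<close>.\<close>

lemma dubois_reymond:
  assumes g: "g absolutely_integrable_on {0..1}"
    and zero: "\<And>\<phi>. test_function \<phi> \<Longrightarrow> integral {0..1} (\<lambda>t. vderiv (vderiv \<phi>) t * g t) = 0"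
  obtains d m :: real where "ae_unit (\<lambda>t. g t = d + m * t)"
proof -
  obtain \<rho> :: "real \<Rightarrow> real" where \<rho>: "test_function \<rho>" "integral {0..1} \<rho> = 1"
    using exists_normalized_test_function .
  have anti: "\<exists>\<Psi>. test_function \<Psi> \<and> vderiv \<Psi> = (\<lambda>t. \<phi> t + (- integral {0..1} \<phi>) * \<rho> t)"
    if \<phi>: "test_function \<phi>" for \<phi>
  proof -
    have "integral {0..1} (\<lambda>t. \<phi> t + (- integral {0..1} \<phi>) * \<rho> t) = 0"
      using integral_combine_test[OF \<phi> \<rho>(1), of "\<lambda>_. 1" "- integral {0..1} \<phi>"] \<rho>(2) by simp
    with test_function_antiderivative[OF test_function_combine(1)[OF \<phi> \<rho>(1)]] show ?thesis by metis
  qed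
  define \<mu> where "\<mu> = integral {0..1} (\<lambda>t. vderiv \<rho> t * g t)"
  have first: "integral {0..1} (\<lambda>t. vderiv \<phi> t * g t) = integral {0..1} \<phi> * \<mu>" if \<phi>: "test_function \<phi>" for \<phi>
  proof -
    obtain \<Psi> where \<Psi>: "test_function \<Psi>" "vderiv \<Psi> = (\<lambda>t. \<phi> t + (- integral {0..1} \<phi>) * \<rho> t)"
      using anti[OF \<phi>] by blast
    have "vderiv (vderiv \<Psi>) = (\<lambda>t. vderiv \<phi> t + (- integral {0..1} \<phi>) * vderiv \<rho> t)"
      unfolding \<Psi>(2) using \<phi> \<rho>(1) by (rule test_function_combine)
    then show ?thesis
      using zero[OF \<Psi>(1)] integral_combine_test[OF test_function_vderiv[OF \<phi>] test_function_vderiv[OF \<rho>(1)] g, of "- integral {0..1} \<phi>"]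
      by (simp add: \<mu>_def)
  qed
  \<comment> \<open>By \<open>first\<close> the weak derivative of g is the constant -\<mu>; adding
    \<mu> t makes it 0.\<close>
  let ?h = "\<lambda>t. g t + \<mu> * t"
  have lin: "AC (\<lambda>t. \<mu> * t) (\<lambda>_. \<mu>)" by (rule AC_C1) (auto intro!: derivative_eq_intros)
  have lini: "(\<lambda>t. \<mu> * t) absolutely_integrable_on {0..1}"
    by (intro absolutely_integrable_continuous_real continuous_intros)
  have h: "?h absolutely_integrable_on {0..1}" using g lini by (rule set_integral_add)
  have second: "integral {0..1} (\<lambda>t. vderiv \<phi> t * ?h t) = 0" if \<phi>: "test_function \<phi>" for \<phi>
  proof -
    have "integral {0..1} (\<lambda>t. vderiv \<phi> t * ?h t)
      = integral {0..1} (\<lambda>t. vderiv \<phi> t * g t) + integral {0..1} (\<lambda>t. vderiv \<phi> t * (\<mu> * t))"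
      unfolding distrib_left
      using test_mult_absint(2)[OF test_function_vderiv[OF \<phi>]] g lini by (intro Henstock_Kurzweil_Integration.integral_add) auto
    also have "\<dots> = integral {0..1} \<phi> * \<mu> - integral {0..1} (\<lambda>t. \<phi> t * \<mu>)"
      using first[OF \<phi>] test_parts[OF \<phi> lin] by simp
    finally show ?thesis by simp
  qed
  define c where "c = integral {0..1} (\<lambda>t. \<rho> t * ?h t)"
  have hc: "(\<lambda>t. ?h t - c) absolutely_integrable_on {0..1}"
    using h by (intro set_integral_diff) (auto intro: absolutely_integrable_continuous_real)
  have third: "integral {0..1} (\<lambda>t. \<phi> t * (?h t - c)) = 0" if \<phi>: "test_function \<phi>" for \<phi>
  proof -
    obtain \<Psi> where \<Psi>: "test_function \<Psi>" "vderiv \<Psi> = (\<lambda>t. \<phi> t + (- integral {0..1} \<phi>) * \<rho> t)"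
      using anti[OF \<phi>] by blast
    have "integral {0..1} (\<lambda>t. \<phi> t * ?h t) = integral {0..1} \<phi> * c"
      using second[OF \<Psi>(1)] integral_combine_test[OF \<phi> \<rho>(1) h, of "- integral {0..1} \<phi>"] by (simp add: \<Psi>(2) c_def)
    moreover have "integral {0..1} (\<lambda>t. \<phi> t * (?h t - c)) = integral {0..1} (\<lambda>t. \<phi> t * ?h t) - integral {0..1} (\<lambda>t. \<phi> t * c)"
      unfolding right_diff_distrib
      using test_mult_absint(2)[OF \<phi> h] absint_integrable[OF test_function_AC(5)[OF \<phi>]]
      by (intro Henstock_Kurzweil_Integration.integral_diff integrable_on_mult_left) auto
    ultimately show ?thesis by simp
  qed
  have "ae_unit (\<lambda>t. ?h t - c = 0)"
  proof (rule fundamental_lemma)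
    show "locally_integrable (\<lambda>t. ?h t - c)" using hc by (rule absint_locally_integrable)
    fix \<phi> :: "real \<Rightarrow> real" assume \<phi>: "test_function \<phi>"
    show "(LINT t:{0<..<1}|lebesgue. \<phi> t *\<^sub>R (?h t - c)) = 0"
      using LINT_unit[OF test_mult_absint(1)[OF \<phi> hc]] third[OF \<phi>] by simp
  qed
  then have "ae_unit (\<lambda>t. g t = c + (- \<mu>) * t)" by eventually_elim auto
  then show ?thesis by (rule that)
qed

text \<open>Integration by parts replaces A by its primitive, now multiplied by the second
  derivative of \<open>\<phi>\<close>; so B minus the primitive of A is affine by du Bois-Reymond,
  and m is its slope.\<close>

lemma weak_euler_lagrange:
  assumes A: "A absolutely_integrable_on {0..1}" and B: "B absolutely_integrable_on {0..1}"
    and zero: "\<And>\<phi>. test_function \<phi> \<Longrightarrow>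
      integral {0..1} (\<lambda>t. vderiv \<phi> t * A t + vderiv (vderiv \<phi>) t * B t) = 0"
  obtains P and m :: real where "AC P (\<lambda>t. A t + m)" "ae_unit (\<lambda>t. B t = P t)"
proof -
  let ?A = "\<lambda>t. integral {0..t} A"
  have AA: "AC ?A A" using A by (simp add: AC_def)
  have Ai: "?A absolutely_integrable_on {0..1}"
    using AC_continuous[OF AA] by (rule absolutely_integrable_continuous_real)
  have BA: "(\<lambda>t. B t - ?A t) absolutely_integrable_on {0..1}" using B Ai by (rule set_integral_diff)
  obtain d m where dm: "ae_unit (\<lambda>t. B t - ?A t = d + m * t)"
  proof (rule dubois_reymond[OF BA])
    fix \<phi> :: "real \<Rightarrow> real" assume \<phi>: "test_function \<phi>"
    note \<phi>1 = test_function_vderiv[OF \<phi>] and \<phi>2 = test_function_vderiv[OF test_function_vderiv[OF \<phi>]]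
    have "integral {0..1} (\<lambda>t. vderiv (vderiv \<phi>) t * (B t - ?A t))
      = integral {0..1} (\<lambda>t. vderiv (vderiv \<phi>) t * B t) - integral {0..1} (\<lambda>t. vderiv (vderiv \<phi>) t * ?A t)"
      unfolding right_diff_distrib
      using test_mult_absint(2)[OF \<phi>2 B] test_mult_absint(2)[OF \<phi>2 Ai] by (rule Henstock_Kurzweil_Integration.integral_diff)
    also have "\<dots> = integral {0..1} (\<lambda>t. vderiv (vderiv \<phi>) t * B t) + integral {0..1} (\<lambda>t. vderiv \<phi> t * A t)"
      using test_parts[OF \<phi>1 AA] by simp
    also have "\<dots> = 0"
      using zero[OF \<phi>] test_mult_absint(2)[OF \<phi>2 B] test_mult_absint(2)[OF \<phi>1 A]
      by (simp add: Henstock_Kurzweil_Integration.integral_add)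
    finally show "integral {0..1} (\<lambda>t. vderiv (vderiv \<phi>) t * (B t - ?A t)) = 0" .
  qed
  have "AC (\<lambda>t. d + m * t) (\<lambda>_. m)" by (rule AC_C1) (auto intro!: derivative_eq_intros)
  from AC_add[OF AA this] have "AC (\<lambda>t. ?A t + (d + m * t)) (\<lambda>t. A t + m)" .
  moreover have "ae_unit (\<lambda>t. B t = ?A t + (d + m * t))" using dm by eventually_elim auto
  ultimately show ?thesis by (rule that)
qed

lemma continuous_ae_eq:
  assumes "continuous_on {0..1} f" "continuous_on {0..1} g" "ae_unit (\<lambda>t. f t = (g t :: real))" "t \<in> {0..1}"
  shows "f t = g t"
proof -
  have c: "continuous_on (cbox 0 1) (\<lambda>t. \<bar>f t - g t\<bar>)" using assms(1,2) by (auto intro!: continuous_intros)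
  obtain N where N: "negligible N" "\<And>t. t \<in> {0..1} \<Longrightarrow> t \<notin> N \<Longrightarrow> f t = g t"
    using ae_unitE[OF assms(3)] by blast
  have "((\<lambda>t. \<bar>f t - g t\<bar>) has_integral 0) (cbox 0 1)"
    by (rule has_integral_spike[OF N(1), of _ _ "\<lambda>_. 0"]) (use N in auto)
  then have "\<bar>f t - g t\<bar> = 0"
    using assms(4) by (intro has_integral_0_cbox_imp_0[OF c]) auto
  then show ?thesis by simp
qed

text \<open>The second primitive of w has the same weak second derivative as f, so they differ by an
  affine function, almost everywhere at first and everywhere by continuity.\<close>

lemma weak_second_derivative_C1:
  assumes f: "continuous_on {0..1} f" and w: "w absolutely_integrable_on {0..1}"
    and weak: "\<And>\<phi>. test_function \<phi> \<Longrightarrow>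
      integral {0..1} (\<lambda>t. vderiv (vderiv \<phi>) t * f t) = integral {0..1} (\<lambda>t. \<phi> t * w t)"
  obtains v :: "real \<Rightarrow> real" where "AC v w" "\<And>t. t \<in> {0..1} \<Longrightarrow> (f has_real_derivative v t) (at t within {0..1})"
proof -
  let ?v = "\<lambda>t. integral {0..t} w"
  let ?F = "\<lambda>t. integral {0..t} ?v"
  have v: "AC ?v w" using w by (simp add: AC_def)
  have vc: "continuous_on {0..1} ?v" by (rule AC_continuous[OF v])
  have F: "AC ?F ?v" using absolutely_integrable_continuous_real[OF vc] by (simp add: AC_def)
  have Fi: "?F absolutely_integrable_on {0..1}" using AC_continuous[OF F] by (rule absolutely_integrable_continuous_real)
  have fi: "f absolutely_integrable_on {0..1}" using f by (rule absolutely_integrable_continuous_real)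
  obtain d m where dm: "ae_unit (\<lambda>t. f t - ?F t = d + m * t)"
  proof (rule dubois_reymond)
    show "(\<lambda>t. f t - ?F t) absolutely_integrable_on {0..1}" using fi Fi by (rule set_integral_diff)
    fix \<phi> :: "real \<Rightarrow> real" assume \<phi>: "test_function \<phi>"
    note \<phi>1 = test_function_vderiv[OF \<phi>] and \<phi>2 = test_function_vderiv[OF test_function_vderiv[OF \<phi>]]
    have "integral {0..1} (\<lambda>t. vderiv (vderiv \<phi>) t * (f t - ?F t))
      = integral {0..1} (\<lambda>t. vderiv (vderiv \<phi>) t * f t) - integral {0..1} (\<lambda>t. vderiv (vderiv \<phi>) t * ?F t)"
      unfolding right_diff_distrib
      using test_mult_absint(2)[OF \<phi>2 fi] test_mult_absint(2)[OF \<phi>2 Fi] by (rule Henstock_Kurzweil_Integration.integral_diff)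
    then show "integral {0..1} (\<lambda>t. vderiv (vderiv \<phi>) t * (f t - ?F t)) = 0"
      using weak[OF \<phi>] test_parts[OF \<phi>1 F] test_parts[OF \<phi> v] by simp
  qed
  have eq: "f t = ?F t + (d + m * t)" if "t \<in> {0..1}" for t
  proof (rule continuous_ae_eq[OF f _ _ that])
    show "continuous_on {0..1} (\<lambda>t. ?F t + (d + m * t))"
      using AC_continuous[OF F] by (intro continuous_intros)
    show "ae_unit (\<lambda>t. f t = ?F t + (d + m * t))" using dm by eventually_elim auto
  qed
  show ?thesis
  proof (rule that)
    have "AC (\<lambda>_. m) (\<lambda>_. 0)" by (rule AC_C1) auto
    from AC_add[OF v this] show "AC (\<lambda>t. ?v t + m) w" by simp
    fix t :: real assume t: "t \<in> {0..1}"
    have "((\<lambda>t. ?F t + (d + m * t)) has_real_derivative ?v t + m) (at t within {0..1})"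
      using AC_has_derivative[OF F vc t] by (auto intro!: derivative_eq_intros)
    then show "(f has_real_derivative ?v t + m) (at t within {0..1})"
      by (rule has_field_derivative_transform_within[of _ _ _ _ 1]) (use eq t in auto)
  qed
qed

section \<open>First variation\<close>

text \<open>At 0 the difference quotient is \<open>spow (p - 1)\<close> itself, which tends to 0 for
  p > 1.\<close>

lemma has_real_derivative_abs_powr:
  assumes "1 < p"
  shows "((\<lambda>x::real. \<bar>x\<bar> powr p) has_real_derivative p * spow (p - 1) x) (at x)"
proof (cases "x = 0")
  case False
  have eq: "\<bar>y\<bar> powr p = y * spow (p - 1) y" for y :: real
    using abs_powr_times[of y "p - 2"] assms
    by (cases "y = 0") (auto simp: spow_def powr_diff field_simps sgn_if)
  have "((\<lambda>y. y * spow (p - 1) y) has_real_derivative 1 * spow (p - 1) x + (p - 1) * \<bar>x\<bar> powr (p - 1 - 1) * 1 * x) (at x)"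
    by (rule DERIV_mult[OF DERIV_ident DERIV_spow[OF DERIV_ident False]])
  moreover have "\<bar>x\<bar> powr (p - 1 - 1) * x = spow (p - 1) x"
    using abs_powr_times[of x "p - 1 - 1"] by simp
  ultimately show ?thesis unfolding eq by (simp add: algebra_simps)
next
  case True
  have "isCont (spow (p - 1)) 0"
    using continuous_on_spow[of "p - 1" UNIV] assms by (simp add: continuous_on_eq_continuous_at)
  then have "((\<lambda>h. spow (p - 1) h) \<longlongrightarrow> spow (p - 1) 0) (at 0)"
    unfolding isCont_def .
  moreover have "\<forall>\<^sub>F h in at 0. spow (p - 1) h = (\<bar>0 + h\<bar> powr p - \<bar>0\<bar> powr p) / h"
    by (auto simp: eventually_at_filter spow_def powr_diff sgn_if field_simps)
  ultimately show ?thesis using True by (simp add: DERIV_def Lim_transform_eventually)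
qed

text \<open>If the first and second derivatives of a curve are both perturbed along one fixed vector
  e, their cross product has no term quadratic in \<epsilon>, because e x e = 0; hence the affine
  expression X0 + \<epsilon> X1.\<close>

lemma variation_integrand_deriv:
  fixes p lam X0 X1 a1 a2 b1 b2 :: real
  defines "Q \<equiv> \<lambda>\<epsilon>. (a1 + \<epsilon> * b1)\<^sup>2 + (a2 + \<epsilon> * b2)\<^sup>2"
    and "Q' \<equiv> \<lambda>\<epsilon>. 2 * (a1 + \<epsilon> * b1) * b1 + 2 * (a2 + \<epsilon> * b2) * b2"
  assumes p: "1 < p" and Q: "0 < Q \<epsilon>"
  shows "((\<lambda>\<epsilon>. \<bar>X0 + \<epsilon> * X1\<bar> powr p * Q \<epsilon> powr s + lam * sqrt (Q \<epsilon>)) has_real_derivative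
    (p * spow (p - 1) (X0 + \<epsilon> * X1) * X1 * Q \<epsilon> powr s
      + \<bar>X0 + \<epsilon> * X1\<bar> powr p * (s * Q \<epsilon> powr (s - 1) * Q' \<epsilon>)
      + lam * (Q' \<epsilon> / (2 * sqrt (Q \<epsilon>))))) (at \<epsilon>)"
proof -
  have dQ: "(Q has_real_derivative Q' \<epsilon>) (at \<epsilon>)"
    unfolding Q_def Q'_def by (auto intro!: derivative_eq_intros simp: algebra_simps)
  have dX: "((\<lambda>\<epsilon>. X0 + \<epsilon> * X1) has_real_derivative X1) (at \<epsilon>)"
    by (auto intro!: derivative_eq_intros)
  have A: "((\<lambda>\<epsilon>. \<bar>X0 + \<epsilon> * X1\<bar> powr p) has_real_derivative p * spow (p - 1) (X0 + \<epsilon> * X1) * X1) (at \<epsilon>)"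
    by (rule DERIV_chain2[where f = "\<lambda>x. \<bar>x\<bar> powr p", OF has_real_derivative_abs_powr[OF p] dX])
  have S: "((\<lambda>\<epsilon>. sqrt (Q \<epsilon>)) has_real_derivative Q' \<epsilon> / (2 * sqrt (Q \<epsilon>))) (at \<epsilon>)"
    by (rule DERIV_cong[OF DERIV_chain2[where f = sqrt, OF DERIV_real_sqrt[OF Q] dQ]]) (simp add: field_simps)
  show ?thesis
    using DERIV_add[OF DERIV_mult[OF A DERIV_powr_const[OF dQ Q, of s]] DERIV_cmult[OF S, of lam]]
    unfolding mult.commute[of "s * Q \<epsilon> powr (s - 1) * Q' \<epsilon>" "\<bar>X0 + \<epsilon> * X1\<bar> powr p"] .
qed

text \<open>The majorant for dominated convergence. The squared speed Q stays above m, so its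
  nonpositive powers are bounded; y will be a multiple of 1 plus the size of the second derivative,
  whose p-th power is integrable.\<close>

lemma variation_integrand_bound:
  fixes p lam x x1 Q Q' m M y :: real
  assumes p: "1 < p" and m: "0 < m" "m \<le> Q" and Q': "\<bar>Q'\<bar> \<le> M" and x: "\<bar>x\<bar> \<le> y" "\<bar>x1\<bar> \<le> y"
    and s: "s \<le> 0" and y: "0 < y"
  shows "\<bar>p * spow (p - 1) x * x1 * Q powr s + \<bar>x\<bar> powr p * (s * Q powr (s - 1) * Q') + lam * (Q' / (2 * sqrt Q))\<bar>
    \<le> (p * m powr s + \<bar>s\<bar> * m powr (s - 1) * M) * y powr p + \<bar>lam\<bar> * (M / (2 * sqrt m))"
proof -
  have M: "0 \<le> M" using Q' by linarith
  have q1: "Q powr s \<le> m powr s" "Q powr (s - 1) \<le> m powr (s - 1)"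
    using m s by (auto intro!: powr_mono2')
  have x1: "\<bar>x\<bar> powr (p - 1) \<le> y powr (p - 1)" "\<bar>x\<bar> powr p \<le> y powr p"
    using x p by (auto intro!: powr_mono2)
  have "\<bar>p * spow (p - 1) x * x1 * Q powr s\<bar> = p * (\<bar>x\<bar> powr (p - 1) * \<bar>x1\<bar>) * Q powr s"
    using p by (simp add: abs_mult abs_spow)
  also have "\<dots> \<le> p * (y powr (p - 1) * y) * m powr s"
    using p q1 x x1 y by (intro mult_mono) auto
  also have "y powr (p - 1) * y = y powr p" using y by (simp add: powr_diff)
  finally have 1: "\<bar>p * spow (p - 1) x * x1 * Q powr s\<bar> \<le> p * y powr p * m powr s" .
  have "\<bar>\<bar>x\<bar> powr p * (s * Q powr (s - 1) * Q')\<bar> = \<bar>x\<bar> powr p * (\<bar>s\<bar> * Q powr (s - 1) * \<bar>Q'\<bar>)"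
    by (simp add: abs_mult)
  also have "\<dots> \<le> y powr p * (\<bar>s\<bar> * m powr (s - 1) * M)"
    using q1 x1 Q' by (intro mult_mono) auto
  finally have 2: "\<bar>\<bar>x\<bar> powr p * (s * Q powr (s - 1) * Q')\<bar> \<le> y powr p * (\<bar>s\<bar> * m powr (s - 1) * M)" .
  have "\<bar>Q'\<bar> / (2 * sqrt Q) \<le> M / (2 * sqrt m)"
    using m Q' M by (intro frac_le) auto
  then have "\<bar>lam\<bar> * (\<bar>Q'\<bar> / (2 * sqrt Q)) \<le> \<bar>lam\<bar> * (M / (2 * sqrt m))"
    by (rule mult_left_mono) simp
  then have 3: "\<bar>lam * (Q' / (2 * sqrt Q))\<bar> \<le> \<bar>lam\<bar> * (M / (2 * sqrt m))"
    using m by (simp add: abs_mult)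
  have "\<bar>a + b + c\<bar> \<le> a' + b' + c'" if "\<bar>a\<bar> \<le> a'" "\<bar>b\<bar> \<le> b'" "\<bar>c\<bar> \<le> c'" for a b c a' b' c' :: real
    using that by linarith
  from this[OF 1 2 3] show ?thesis by (simp add: algebra_simps)
qed

lemma abs_mult_mono: "\<bar>a\<bar> \<le> x \<Longrightarrow> \<bar>b\<bar> \<le> y \<Longrightarrow> \<bar>a * b\<bar> \<le> x * y" for a b x y :: real
  unfolding abs_mult by (rule mult_mono) auto

text \<open>Since the derivative of the energy is assumed to exist, dominated convergence along a single
  sequence of parameters identifies it.\<close>

lemma first_variation:
  fixes v1 v2 w1 w2 \<alpha> \<beta> :: "real \<Rightarrow> real" and e1 e2 p lam :: real
  defines "X0 \<equiv> \<lambda>t. v1 t * w2 t - v2 t * w1 t"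
    and "X1 \<equiv> \<lambda>t. \<alpha> t * (e1 * w2 t - e2 * w1 t) + \<beta> t * (v1 t * e2 - v2 t * e1)"
    and "Q \<equiv> \<lambda>\<epsilon> t. (v1 t + \<epsilon> * (\<alpha> t * e1))\<^sup>2 + (v2 t + \<epsilon> * (\<alpha> t * e2))\<^sup>2"
    and "q \<equiv> \<lambda>t. (v1 t)\<^sup>2 + (v2 t)\<^sup>2"
    and "s \<equiv> (1 - 3 * p) / 2"
  defines "G \<equiv> \<lambda>\<epsilon> t. \<bar>X0 t + \<epsilon> * X1 t\<bar> powr p * Q \<epsilon> t powr s + lam * sqrt (Q \<epsilon> t)"
  assumes p: "1 < p"
    and cont: "continuous_on {0..1} v1" "continuous_on {0..1} v2" "continuous_on {0..1} \<alpha>" "continuous_on {0..1} \<beta>"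
    and w: "w1 \<in> borel_measurable (lebesgue_on {0..1})" "w2 \<in> borel_measurable (lebesgue_on {0..1})"
    and wp: "(\<lambda>t. (1 + \<bar>w1 t\<bar> + \<bar>w2 t\<bar>) powr p) integrable_on {0..1}"
    and v: "\<And>t. t \<in> {0..1} \<Longrightarrow> 0 < (v1 t)\<^sup>2 + (v2 t)\<^sup>2"
    and E: "(E has_real_derivative 0) (at 0)"
      "\<And>\<epsilon>. (\<And>t. t \<in> {0..1} \<Longrightarrow> 0 < Q \<epsilon> t) \<Longrightarrow>
        (\<And>c. (\<lambda>t. \<bar>X0 t + \<epsilon> * X1 t\<bar> powr p * Q \<epsilon> t powr s + c * sqrt (Q \<epsilon> t)) absolutely_integrable_on {0..1}) \<Longrightarrow>
        E \<epsilon> = integral {0..1} (G \<epsilon>)"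
  shows "integral {0..1} (\<lambda>t.
      \<alpha> t * (p * spow (p - 1) (X0 t) * q t powr s * (e1 * w2 t - e2 * w1 t)
        + (\<bar>X0 t\<bar> powr p * (2 * s * q t powr (s - 1)) + lam / sqrt (q t)) * (v1 t * e1 + v2 t * e2))
      + \<beta> t * (p * spow (p - 1) (X0 t) * q t powr s * (v1 t * e2 - v2 t * e1))) = 0"
proof -
  have bd: "\<exists>B. \<forall>t\<in>{0..1}. \<bar>f t\<bar> \<le> B" if "continuous_on {0..1} f" for f :: "real \<Rightarrow> real"
    using compact_imp_bounded[OF compact_continuous_image[OF that]] by (auto simp: bounded_real)
  obtain B1 where B1: "\<forall>t\<in>{0..1}. \<bar>v1 t\<bar> \<le> B1" using bd[OF cont(1)] by blast
  obtain B2 where B2: "\<forall>t\<in>{0..1}. \<bar>v2 t\<bar> \<le> B2" using bd[OF cont(2)] by blast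
  obtain B3 where B3: "\<forall>t\<in>{0..1}. \<bar>\<alpha> t\<bar> \<le> B3" using bd[OF cont(3)] by blast
  obtain B4 where B4: "\<forall>t\<in>{0..1}. \<bar>\<beta> t\<bar> \<le> B4" using bd[OF cont(4)] by blast
  \<comment> \<open>One bound for all the continuous data, at least 1 so that higher powers of it
    absorb lower ones.\<close>
  define B where "B = 1 + \<bar>B1\<bar> + \<bar>B2\<bar> + \<bar>B3\<bar> + \<bar>B4\<bar> + \<bar>e1\<bar> + \<bar>e2\<bar>"
  have B: "\<bar>v1 t\<bar> \<le> B" "\<bar>v2 t\<bar> \<le> B" "\<bar>\<alpha> t\<bar> \<le> B" "\<bar>\<beta> t\<bar> \<le> B" if "t \<in> {0..1}" for t
    using bspec[OF B1 that] bspec[OF B2 that] bspec[OF B3 that] bspec[OF B4 that] unfolding B_def by linarith+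
  have Be: "\<bar>e1\<bar> \<le> B" "\<bar>e2\<bar> \<le> B" "1 \<le> B" by (auto simp: B_def)
  have "continuous_on {0..1} (\<lambda>t. (v1 t)\<^sup>2 + (v2 t)\<^sup>2)" by (intro continuous_intros cont)
  then obtain tm where tm: "tm \<in> {0..1}" "\<And>t. t \<in> {0..1} \<Longrightarrow> (v1 tm)\<^sup>2 + (v2 tm)\<^sup>2 \<le> (v1 t)\<^sup>2 + (v2 t)\<^sup>2"
    using continuous_attains_inf[of "{0..1::real}" "\<lambda>t. (v1 t)\<^sup>2 + (v2 t)\<^sup>2"] by auto
  define m where "m = ((v1 tm)\<^sup>2 + (v2 tm)\<^sup>2) / 2"
  have m: "0 < m" "2 * m \<le> (v1 t)\<^sup>2 + (v2 t)\<^sup>2" if "t \<in> {0..1}" for t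
    using v[OF tm(1)] tm(2)[OF that] by (auto simp: m_def)
  have m0: "0 < m" using m(1)[of 0] by simp
  \<comment> \<open>The squared speed starts at no less than 2 m. Its part linear in \<epsilon> is
    at most 4 B^3 |\<epsilon>| in size and the quadratic part is nonnegative, so for |\<epsilon>|
    \<le> \<delta> at least m is left.\<close>
  define \<delta> where "\<delta> = min 1 (m / (4 * B ^ 3))"
  have \<delta>: "0 < \<delta>" "\<delta> \<le> 1" "\<delta> * (4 * B ^ 3) \<le> m"
    using m0 Be(3) by (auto simp: \<delta>_def min_def field_simps)
  have bb: "\<bar>\<alpha> t * e1\<bar> \<le> B * B" "\<bar>\<alpha> t * e2\<bar> \<le> B * B" if "t \<in> {0..1}" for t
    using abs_mult_mono[OF B(3)[OF that] Be(1)] abs_mult_mono[OF B(3)[OF that] Be(2)] by simp_all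
  have Qlow: "m \<le> Q \<epsilon> t" if "\<bar>\<epsilon>\<bar> \<le> \<delta>" "t \<in> {0..1}" for \<epsilon> t
  proof -
    let ?c = "2 * (v1 t * (\<alpha> t * e1) + v2 t * (\<alpha> t * e2))"
    have "Q \<epsilon> t = (v1 t)\<^sup>2 + (v2 t)\<^sup>2 + \<epsilon> * ?c + (\<epsilon> * (\<alpha> t * e1))\<^sup>2 + (\<epsilon> * (\<alpha> t * e2))\<^sup>2"
      by (simp add: Q_def power2_eq_square algebra_simps)
    then have 1: "(v1 t)\<^sup>2 + (v2 t)\<^sup>2 - \<bar>\<epsilon> * ?c\<bar> \<le> Q \<epsilon> t"
      using abs_ge_minus_self[of "\<epsilon> * ?c"] zero_le_power2[of "\<epsilon> * (\<alpha> t * e1)"] zero_le_power2[of "\<epsilon> * (\<alpha> t * e2)"]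
      by linarith
    have "\<bar>v1 t * (\<alpha> t * e1)\<bar> \<le> B * (B * B)" "\<bar>v2 t * (\<alpha> t * e2)\<bar> \<le> B * (B * B)"
      using abs_mult_mono[OF B(1)[OF that(2)] bb(1)[OF that(2)]] abs_mult_mono[OF B(2)[OF that(2)] bb(2)[OF that(2)]] by simp_all
    moreover have "\<bar>2 * (x + y)\<bar> \<le> 4 * z" if "\<bar>x\<bar> \<le> z" "\<bar>y\<bar> \<le> z" for x y z :: real
      using that unfolding abs_le_iff by auto
    ultimately have "\<bar>?c\<bar> \<le> 4 * B ^ 3" unfolding power3_eq_cube mult.assoc by blast
    from abs_mult_mono[OF that(1) this] have "\<bar>\<epsilon> * ?c\<bar> \<le> \<delta> * (4 * B ^ 3)" .
    then show ?thesis using 1 \<delta>(3) m(2)[OF that(2)] by linarith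
  qed
  have bnd: "\<bar>v1 t + \<epsilon> * (\<alpha> t * e1)\<bar> \<le> 2 * B\<^sup>2" "\<bar>v2 t + \<epsilon> * (\<alpha> t * e2)\<bar> \<le> 2 * B\<^sup>2"
    if "\<bar>\<epsilon>\<bar> \<le> \<delta>" "t \<in> {0..1}" for \<epsilon> t
  proof -
    have BB: "B \<le> B * B" using Be(3) by simp
    have "\<bar>\<epsilon> * x\<bar> \<le> \<bar>x\<bar>" for x using that(1) \<delta>(2) mult_right_mono[of "\<bar>\<epsilon>\<bar>" 1 "\<bar>x\<bar>"] by (simp add: abs_mult)
    from this[of "\<alpha> t * e1"] this[of "\<alpha> t * e2"]
    show "\<bar>v1 t + \<epsilon> * (\<alpha> t * e1)\<bar> \<le> 2 * B\<^sup>2" "\<bar>v2 t + \<epsilon> * (\<alpha> t * e2)\<bar> \<le> 2 * B\<^sup>2"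
      using B[OF that(2)] bb[OF that(2)] BB unfolding power2_eq_square by linarith+
  qed
  define Q' where "Q' = (\<lambda>\<epsilon> t. 2 * (v1 t + \<epsilon> * (\<alpha> t * e1)) * (\<alpha> t * e1) + 2 * (v2 t + \<epsilon> * (\<alpha> t * e2)) * (\<alpha> t * e2))"
  \<comment> \<open>Each velocity component is at most 2 B^2 in size; the same constant then serves
    for \<open>Q\<close> and for its derivative \<open>Q'\<close>.\<close>
  define M where "M = 8 * B ^ 4"
  have Q'b: "\<bar>Q' \<epsilon> t\<bar> \<le> M" if "\<bar>\<epsilon>\<bar> \<le> \<delta>" "t \<in> {0..1}" for \<epsilon> t
  proof -
    have "\<bar>(v1 t + \<epsilon> * (\<alpha> t * e1)) * (\<alpha> t * e1)\<bar> \<le> 2 * B\<^sup>2 * (B * B)" "\<bar>(v2 t + \<epsilon> * (\<alpha> t * e2)) * (\<alpha> t * e2)\<bar> \<le> 2 * B\<^sup>2 * (B * B)"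
      by (rule abs_mult_mono[OF bnd(1)[OF that] bb(1)[OF that(2)]], rule abs_mult_mono[OF bnd(2)[OF that] bb(2)[OF that(2)]])
    moreover have "2 * B\<^sup>2 * (B * B) = 2 * B ^ 4" by (simp add: power2_eq_square power4_eq_xxxx)
    ultimately show ?thesis unfolding Q'_def M_def by linarith
  qed
  have Qhigh: "Q \<epsilon> t \<le> M" if "\<bar>\<epsilon>\<bar> \<le> \<delta>" "t \<in> {0..1}" for \<epsilon> t
  proof -
    have sq: "x\<^sup>2 \<le> y\<^sup>2" if "\<bar>x\<bar> \<le> y" for x y :: real
      using that abs_le_square_iff[of x y] by linarith
    have "(v1 t + \<epsilon> * (\<alpha> t * e1))\<^sup>2 \<le> (2 * B\<^sup>2)\<^sup>2" "(v2 t + \<epsilon> * (\<alpha> t * e2))\<^sup>2 \<le> (2 * B\<^sup>2)\<^sup>2"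
      by (rule sq[OF bnd(1)[OF that]], rule sq[OF bnd(2)[OF that]])
    moreover have "(2 * B\<^sup>2)\<^sup>2 = 4 * B ^ 4" by (simp add: power_mult_distrib flip: power_mult)
    ultimately show ?thesis unfolding Q_def M_def by linarith
  qed
  \<comment> \<open>From |X0| \<le> B W and |X1| \<le> B^3 W + 2 B^3 with W = |w1| + |w2|; the
    factor 3 B^3 covers their sum.\<close>
  define Y where "Y = (\<lambda>t. 3 * B ^ 3 * (1 + \<bar>w1 t\<bar> + \<bar>w2 t\<bar>))"
  have Y0: "0 < Y t" for t using Be(3) by (simp add: Y_def add_pos_nonneg)
  have Xb: "\<bar>X0 t + \<epsilon> * X1 t\<bar> \<le> Y t" "\<bar>X1 t\<bar> \<le> Y t" if "\<bar>\<epsilon>\<bar> \<le> \<delta>" "t \<in> {0..1}" for \<epsilon> t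
  proof -
    let ?w = "\<bar>w1 t\<bar> + \<bar>w2 t\<bar>"
    have "\<bar>v1 t * w2 t\<bar> \<le> B * \<bar>w2 t\<bar>" "\<bar>v2 t * w1 t\<bar> \<le> B * \<bar>w1 t\<bar>"
      unfolding abs_mult using B[OF that(2)] by (auto intro!: mult_right_mono)
    then have x0: "\<bar>X0 t\<bar> \<le> B * ?w" unfolding X0_def distrib_left by linarith
    have "\<bar>e1 * w2 t\<bar> \<le> B * \<bar>w2 t\<bar>" "\<bar>e2 * w1 t\<bar> \<le> B * \<bar>w1 t\<bar>"
      unfolding abs_mult using Be by (auto intro!: mult_right_mono)
    then have "\<bar>e1 * w2 t - e2 * w1 t\<bar> \<le> B * ?w" unfolding distrib_left by linarith
    then have a: "\<bar>\<alpha> t * (e1 * w2 t - e2 * w1 t)\<bar> \<le> B * (B * ?w)"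
      using abs_mult_mono[OF B(3)[OF that(2)]] by blast
    have "\<bar>v1 t * e2\<bar> \<le> B * B" "\<bar>v2 t * e1\<bar> \<le> B * B"
      by (rule abs_mult_mono[OF B(1)[OF that(2)] Be(2)], rule abs_mult_mono[OF B(2)[OF that(2)] Be(1)])
    then have "\<bar>v1 t * e2 - v2 t * e1\<bar> \<le> 2 * (B * B)" by linarith
    then have b: "\<bar>\<beta> t * (v1 t * e2 - v2 t * e1)\<bar> \<le> B * (2 * (B * B))"
      using abs_mult_mono[OF B(4)[OF that(2)]] by blast
    have B13: "B \<le> B ^ 3" "B * B \<le> B ^ 3"
      using power_increasing[of 1 3 B] power_increasing[of 2 3 B] Be(3) by (auto simp: power2_eq_square)
    have w0: "0 \<le> ?w" by simp
    have 1: "B * ?w \<le> B ^ 3 * ?w" "B * B * ?w \<le> B ^ 3 * ?w"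
      using B13 w0 by (auto intro!: mult_right_mono)
    have B3: "0 \<le> B ^ 3" using Be(3) by simp
    have x1: "\<bar>X1 t\<bar> \<le> B ^ 3 * ?w + 2 * B ^ 3"
      using a b 1 unfolding X1_def by (simp add: power3_eq_cube mult.assoc) linarith
    have Yt: "Y t = 3 * B ^ 3 + 3 * (B ^ 3 * ?w)" by (simp add: Y_def algebra_simps)
    have B3w: "0 \<le> B ^ 3 * ?w" using B3 w0 by (rule mult_nonneg_nonneg)
    show "\<bar>X1 t\<bar> \<le> Y t" using x1 Yt B3 B3w by linarith
    have "\<bar>\<epsilon> * X1 t\<bar> \<le> \<bar>X1 t\<bar>"
      using that(1) \<delta>(2) mult_right_mono[of "\<bar>\<epsilon>\<bar>" 1 "\<bar>X1 t\<bar>"] by (simp add: abs_mult)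
    then show "\<bar>X0 t + \<epsilon> * X1 t\<bar> \<le> Y t" using x0 x1 1(1) Yt B3 B3w by linarith
  qed
  have s0: "s \<le> 0" using p by (simp add: s_def)
  have Yp: "(\<lambda>t. C * Y t powr p + D) integrable_on {0..1}" for C D
  proof -
    have "(\<lambda>t. C * (3 * B ^ 3) powr p * (1 + \<bar>w1 t\<bar> + \<bar>w2 t\<bar>) powr p + D) integrable_on {0..1}"
      using wp by (intro integrable_add integrable_on_mult_right) auto
    then show ?thesis using Be(3) by (simp add: Y_def powr_mult mult.assoc add_nonneg_nonneg)
  qed
  have [measurable]: "v1 \<in> borel_measurable (lebesgue_on {0..1})" "v2 \<in> borel_measurable (lebesgue_on {0..1})"
    "\<alpha> \<in> borel_measurable (lebesgue_on {0..1})" "\<beta> \<in> borel_measurable (lebesgue_on {0..1})"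
    by (auto intro!: continuous_imp_measurable_on_sets_lebesgue cont)
  note w[measurable]
  have Gint: "(\<lambda>t. \<bar>X0 t + \<epsilon> * X1 t\<bar> powr p * Q \<epsilon> t powr s + c * sqrt (Q \<epsilon> t)) absolutely_integrable_on {0..1}"
    if \<epsilon>: "\<bar>\<epsilon>\<bar> \<le> \<delta>" for \<epsilon> c
  proof (rule measurable_bounded_by_integrable_imp_absolutely_integrable)
    show "(\<lambda>t. \<bar>X0 t + \<epsilon> * X1 t\<bar> powr p * Q \<epsilon> t powr s + c * sqrt (Q \<epsilon> t)) \<in> borel_measurable (lebesgue_on {0..1})"
      unfolding X0_def X1_def Q_def by measurable
    show "(\<lambda>t. m powr s * Y t powr p + \<bar>c\<bar> * sqrt M) integrable_on {0..1}" by (rule Yp)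
    fix t :: real assume t: "t \<in> {0..1}"
    have "\<bar>X0 t + \<epsilon> * X1 t\<bar> powr p * Q \<epsilon> t powr s \<le> Y t powr p * m powr s"
      using Xb[OF \<epsilon> t] Qlow[OF \<epsilon> t] m0 s0 p by (intro mult_mono powr_mono2 powr_mono2') auto
    moreover have "\<bar>c * sqrt (Q \<epsilon> t)\<bar> \<le> \<bar>c\<bar> * sqrt M"
      using Qhigh[OF \<epsilon> t] Qlow[OF \<epsilon> t] m0 by (auto simp: abs_mult intro!: mult_left_mono)
    moreover have "0 \<le> \<bar>X0 t + \<epsilon> * X1 t\<bar> powr p * Q \<epsilon> t powr s" by simp
    ultimately show "norm (\<bar>X0 t + \<epsilon> * X1 t\<bar> powr p * Q \<epsilon> t powr s + c * sqrt (Q \<epsilon> t)) \<le> m powr s * Y t powr p + \<bar>c\<bar> * sqrt M"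
      unfolding real_norm_def mult.commute[of "m powr s"] by linarith
  qed simp
  define G' where "G' = (\<lambda>\<epsilon> t. p * spow (p - 1) (X0 t + \<epsilon> * X1 t) * X1 t * Q \<epsilon> t powr s
      + \<bar>X0 t + \<epsilon> * X1 t\<bar> powr p * (s * Q \<epsilon> t powr (s - 1) * Q' \<epsilon> t)
      + lam * (Q' \<epsilon> t / (2 * sqrt (Q \<epsilon> t))))"
  have dG: "((\<lambda>\<epsilon>. G \<epsilon> t) has_real_derivative G' \<epsilon> t) (at \<epsilon>)" if "\<bar>\<epsilon>\<bar> \<le> \<delta>" "t \<in> {0..1}" for \<epsilon> t
    unfolding G_def G'_def Q_def Q'_def
    by (rule variation_integrand_deriv[OF p]) (use Qlow[OF that] m0 in \<open>simp add: Q_def\<close>)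
  define H where "H = (\<lambda>t. (p * m powr s + \<bar>s\<bar> * m powr (s - 1) * M) * Y t powr p + \<bar>lam\<bar> * (M / (2 * sqrt m)))"
  have G'b: "\<bar>G' \<epsilon> t\<bar> \<le> H t" if "\<bar>\<epsilon>\<bar> \<le> \<delta>" "t \<in> {0..1}" for \<epsilon> t
    unfolding G'_def H_def
    by (rule variation_integrand_bound[OF p m0 Qlow[OF that] Q'b[OF that] Xb[OF that] s0 Y0])
  have E2: "E \<epsilon> = integral {0..1} (G \<epsilon>)" if "\<bar>\<epsilon>\<bar> \<le> \<delta>" for \<epsilon>
  proof (rule E(2))
    show "0 < Q \<epsilon> t" if "t \<in> {0..1}" for t using Qlow[OF \<open>\<bar>\<epsilon>\<bar> \<le> \<delta>\<close> that] m0 by linarith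
  qed (rule Gint[OF that])
  have main: "integral {0..1} (G' 0) = 0"
  proof -
    define \<epsilon> where "\<epsilon> = (\<lambda>n::nat. \<delta> * inverse (real (Suc n)))"
    have \<epsilon>: "0 < \<epsilon> n" "\<bar>\<epsilon> n\<bar> \<le> \<delta>" for n
      using \<delta>(1) by (auto simp: \<epsilon>_def field_simps)
    have "\<epsilon> \<longlonglongrightarrow> \<delta> * 0" unfolding \<epsilon>_def by (intro tendsto_intros LIMSEQ_inverse_real_of_nat)
    then have lim0: "filterlim \<epsilon> (at 0) sequentially"
      using \<epsilon>(1) by (auto simp: filterlim_at less_imp_neq[THEN not_sym])
    define f where "f = (\<lambda>n t. (G (0 + \<epsilon> n) t - G 0 t) / \<epsilon> n)"
    have Gi: "G \<epsilon> integrable_on {0..1}" if "\<bar>\<epsilon>\<bar> \<le> \<delta>" for \<epsilon>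
      unfolding G_def by (rule absint_integrable[OF Gint[OF that]])
    have G0: "G 0 integrable_on {0..1}" using Gi[of 0] \<delta>(1) by simp
    have "(\<lambda>n. integral {0..1} (f n)) \<longlonglongrightarrow> integral {0..1} (G' 0)"
    proof (rule dominated_convergence(2))
      show "f n integrable_on {0..1}" for n
        unfolding f_def using Gi[OF \<epsilon>(2)] G0 by (simp add: integrable_diff integrable_on_divide)
      show "H integrable_on {0..1}" unfolding H_def by (rule Yp)
      fix t :: real assume t: "t \<in> {0..1}"
      show "norm (f n t) \<le> H t" for n
      proof -
        have "((\<lambda>\<epsilon>. G \<epsilon> t) has_real_derivative G' x t) (at x)" if "0 \<le> x" "x \<le> \<epsilon> n" for x
          using that \<epsilon>(2)[of n] by (intro dG t) auto
        \<comment> \<open>The difference quotient is a derivative at an intermediate parameter, to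
          which the uniform bound \<open>G'b\<close> applies.\<close>
        from MVT2[OF \<epsilon>(1) this] obtain z where z: "0 < z" "z < \<epsilon> n" "G (\<epsilon> n) t - G 0 t = (\<epsilon> n - 0) * G' z t" by blast
        then have "f n t = G' z t" using \<epsilon>(1)[of n] by (simp add: f_def)
        then show ?thesis using G'b[of z t] z \<epsilon>(2)[of n] t by auto
      qed
      have "((\<lambda>h. (G (0 + h) t - G 0 t) / h) \<longlongrightarrow> G' 0 t) (at 0)"
        using dG[of 0 t] \<delta>(1) t by (simp add: DERIV_def)
      from filterlim_compose[OF this lim0] show "(\<lambda>n. f n t) \<longlonglongrightarrow> G' 0 t" by (simp add: f_def)
    qed
    moreover have "integral {0..1} (f n) = (E (0 + \<epsilon> n) - E 0) / \<epsilon> n" for n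
      unfolding f_def using Gi[OF \<epsilon>(2)] G0 E2[OF \<epsilon>(2)] E2[of 0] \<delta>(1)
      by (simp add: Henstock_Kurzweil_Integration.integral_diff)
    moreover have "(\<lambda>n. (E (0 + \<epsilon> n) - E 0) / \<epsilon> n) \<longlonglongrightarrow> 0"
      using filterlim_compose[OF _ lim0, of "\<lambda>h. (E (0 + h) - E 0) / h" "nhds 0"] E(1) by (simp add: DERIV_def)
    ultimately show ?thesis using LIMSEQ_unique by auto
  qed
  have eq: "G' 0 t = \<alpha> t * (p * spow (p - 1) (X0 t) * q t powr s * (e1 * w2 t - e2 * w1 t)
        + (\<bar>X0 t\<bar> powr p * (2 * s * q t powr (s - 1)) + lam / sqrt (q t)) * (v1 t * e1 + v2 t * e2))
      + \<beta> t * (p * spow (p - 1) (X0 t) * q t powr s * (v1 t * e2 - v2 t * e1))" for t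
  proof -
    have Q0: "Q 0 t = q t" by (simp add: Q_def q_def)
    have Q'0: "Q' 0 t = 2 * (\<alpha> t * (v1 t * e1 + v2 t * e2))" by (simp add: Q'_def algebra_simps)
    have "lam * (Q' 0 t / (2 * sqrt (Q 0 t))) = lam / sqrt (q t) * (\<alpha> t * (v1 t * e1 + v2 t * e2))"
      unfolding Q0 Q'0 by simp
    then have "G' 0 t = p * spow (p - 1) (X0 t) * X1 t * q t powr s
        + \<bar>X0 t\<bar> powr p * (s * q t powr (s - 1) * (2 * (\<alpha> t * (v1 t * e1 + v2 t * e2))))
        + lam / sqrt (q t) * (\<alpha> t * (v1 t * e1 + v2 t * e2))"
      unfolding G'_def Q0 Q'0 by simp
    then show ?thesis unfolding X1_def by (simp only: algebra_simps)
  qed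
  from main show ?thesis unfolding ext[of "G' 0", OF eq] .
qed

section \<open>The elastica equation\<close>

definition rot90 :: "real^2 \<Rightarrow> real^2" where
  "rot90 x = vector [- x $ 2, x $ 1]"

text \<open>The Frenet equations with speed \<open>r\<close> and unit tangent \<open>T\<close>, for
  a curvature prescribed as a function of the position. The free speed admits the given
  parametrization and its images under similarities.\<close>

definition curvature_field :: "(real^2 \<Rightarrow> real) \<Rightarrow> (real \<Rightarrow> real^2) \<Rightarrow> (real \<Rightarrow> real) \<Rightarrow> (real \<Rightarrow> real^2) \<Rightarrow> bool" where
  "curvature_field \<kappa> \<gamma> r T \<longleftrightarrow> continuous_on {0..1} r \<and>
     (\<forall>t\<in>{0..1}. 0 < r t \<and> norm (T t) = 1 \<and>
        (\<gamma> has_vector_derivative r t *\<^sub>R T t) (at t within {0..1}) \<and>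
        (T has_vector_derivative (r t * \<kappa> (\<gamma> t)) *\<^sub>R rot90 (T t)) (at t within {0..1}))"

lemma norm_vec_2: "norm (x :: real^2) = sqrt ((x $ 1)\<^sup>2 + (x $ 2)\<^sup>2)"
  by (simp add: norm_eq_sqrt_inner inner_vec_def sum_2 power2_eq_square)

lemma vec_2_eta: "vector [x $ 1, x $ 2] = (x :: real^2)"
  by (simp add: vec_eq_iff forall_2)

lemma has_vector_derivative_component:
  fixes \<gamma> :: "real \<Rightarrow> real^2"
  assumes "(\<gamma> has_vector_derivative V) F"
  shows "((\<lambda>t. \<gamma> t $ i) has_real_derivative V $ i) F"
  using bounded_linear.has_vector_derivative[OF bounded_linear_vec_nth assms]
  by (simp add: has_real_derivative_iff_has_vector_derivative)

lemma has_vector_derivative_from_components: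
  fixes \<gamma> :: "real \<Rightarrow> real^2"
  assumes "((\<lambda>t. \<gamma> t $ 1) has_real_derivative a) F" "((\<lambda>t. \<gamma> t $ 2) has_real_derivative b) F"
  shows "(\<gamma> has_vector_derivative vector [a, b]) F"
  using has_vector_derivative_vector_2[OF assms] by (simp add: vec_2_eta)

section \<open>Weak derivatives of plane curves and the explicit energy\<close>

lemma absint_component:
  fixes f :: "real \<Rightarrow> real^2"
  assumes "f absolutely_integrable_on S"
  shows "(\<lambda>t. f t $ i) absolutely_integrable_on S"
  using integrable_bounded_linear[OF bounded_linear_vec_nth assms[unfolded set_integrable_def]]
  by (simp add: set_integrable_def)

text \<open>On an interval of finite length the bound x \<le> 1 + x^p turns integrability of the
  p-th power into integrability.\<close>

lemma in_Lp_absint: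
  fixes w :: "real \<Rightarrow> 'a::euclidean_space"
  assumes "1 \<le> p" "in_Lp p w"
  shows "w absolutely_integrable_on {0..1}" "(\<lambda>t. norm (w t) powr p) absolutely_integrable_on {0..1}"
proof -
  show p: "(\<lambda>t. norm (w t) powr p) absolutely_integrable_on {0..1}"
    using assms(2) by (simp add: in_Lp_def absint_Ioo_iff)
  have "(\<lambda>t. 1 + norm (w t) powr p) absolutely_integrable_on {0..1}"
    by (intro set_integral_add p absolutely_integrable_continuous_real continuous_intros)
  then have i: "set_integrable lebesgue {0<..<1} (\<lambda>t. 1 + norm (w t) powr p)"
    by (simp add: absint_Ioo_iff)
  have "set_integrable lebesgue {0<..<1} w"
  proof (rule set_integrable_bound[OF i])
    show "set_borel_measurable lebesgue {0<..<1} w" using assms(2) by (simp add: in_Lp_def)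
    have "x \<le> 1 + x powr p" if "0 \<le> x" for x :: real
    proof (cases "x \<le> 1")
      case False
      then have "x powr 1 \<le> x powr p" using assms(1) by (intro powr_mono) auto
      then show ?thesis using False by simp
    qed (simp add: add_increasing2)
    then show "AE x in lebesgue. x \<in> {0<..<1} \<longrightarrow> norm (w x) \<le> norm (1 + norm (w x) powr p)"
      by (simp add: abs_of_nonneg add_nonneg_nonneg)
  qed
  then show "w absolutely_integrable_on {0..1}" by (simp add: absint_Ioo_iff)
qed

lemma absint_scaleR:
  fixes \<phi> :: "real \<Rightarrow> real" and f :: "real \<Rightarrow> 'a::euclidean_space"
  assumes "continuous_on {a..b} \<phi>" "f absolutely_integrable_on {a..b}"
  shows "(\<lambda>t. \<phi> t *\<^sub>R f t) absolutely_integrable_on {a..b}"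
proof -
  have b: "bilinear (scaleR :: real \<Rightarrow> 'a \<Rightarrow> 'a)"
    by (simp add: bilinear_conv_bounded_bilinear bounded_bilinear_scaleR)
  have m: "\<phi> \<in> borel_measurable (lebesgue_on {a..b})"
    using assms(1) by (rule continuous_imp_measurable_on_sets_lebesgue) simp
  have bd: "bounded (\<phi> ` {a..b})"
    using compact_continuous_image[OF assms(1)] by (simp add: compact_imp_bounded)
  show ?thesis
    by (rule absolutely_integrable_bounded_measurable_product[OF b m _ bd assms(2)]) simp
qed

lemma test_scaleR_integrable:
  fixes \<phi> :: "real \<Rightarrow> real" and f :: "real \<Rightarrow> 'a::euclidean_space"
  assumes \<phi>: "test_function \<phi>" and f: "locally_integrable f"
  shows "integrable lebesgue (\<lambda>t. indicator {0<..<1} t *\<^sub>R (\<phi> t *\<^sub>R f t))"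
proof -
  obtain a b where ab: "0 < a" "a < b" "b < 1" "\<And>t. t \<notin> {a..b} \<Longrightarrow> \<phi> t = 0"
    by (rule test_functionE[OF \<phi>]) blast
  have "(\<lambda>t. \<phi> t *\<^sub>R f t) absolutely_integrable_on {a..b}"
    using f ab by (intro absint_scaleR test_function_AC(4)[OF \<phi>]) (auto simp: locally_integrable_def)
  moreover have "(\<lambda>t. indicator {a..b} t *\<^sub>R (\<phi> t *\<^sub>R f t)) = (\<lambda>t. indicator {0<..<1} t *\<^sub>R (\<phi> t *\<^sub>R f t))"
    using ab by (auto simp: indicator_def fun_eq_iff)
  ultimately show ?thesis by (simp add: set_integrable_def)
qed

text \<open>The fundamental lemma in each component. It permits replacing the chosen representative
  \<open>weak_deriv\<close> by an explicit one under integrals.\<close>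

lemma weak_deriv_unique:
  fixes f :: "real \<Rightarrow> real^2"
  assumes g: "has_weak_deriv k f g" and g': "has_weak_deriv k f g'"
  shows "ae_unit (\<lambda>t. g t = g' t)"
proof -
  have li: "locally_integrable g" "locally_integrable g'" using g g' by (auto simp: has_weak_deriv_def)
  have comp: "ae_unit (\<lambda>t. g t $ i - g' t $ i = 0)" for i
  proof (rule fundamental_lemma)
    show "locally_integrable (\<lambda>t. g t $ i - g' t $ i)"
      unfolding locally_integrable_def
    proof (intro allI impI)
      fix a b :: real assume ab: "0 < a \<and> a < b \<and> b < 1"
      show "set_integrable lebesgue {a..b} (\<lambda>t. g t $ i - g' t $ i)"
        using li ab by (intro set_integral_diff(1) absint_component) (auto simp: locally_integrable_def)
    qed
    fix \<phi> :: "real \<Rightarrow> real" assume \<phi>: "test_function \<phi>"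
    have comp: "(LINT t:{0<..<1}|lebesgue. \<phi> t *\<^sub>R f t) $ i = (LINT t|lebesgue. indicator {0<..<1} t * (\<phi> t * f t $ i))"
      and int: "integrable lebesgue (\<lambda>t. indicator {0<..<1} t * (\<phi> t * f t $ i))"
      if "locally_integrable f" for f :: "real \<Rightarrow> real^2"
    proof -
      note I = test_scaleR_integrable[OF \<phi> that]
      show "(LINT t:{0<..<1}|lebesgue. \<phi> t *\<^sub>R f t) $ i = (LINT t|lebesgue. indicator {0<..<1} t * (\<phi> t * f t $ i))"
        unfolding set_lebesgue_integral_def
        using integral_bounded_linear[OF bounded_linear_vec_nth[of i] I] by (simp add: mult.assoc)
      show "integrable lebesgue (\<lambda>t. indicator {0<..<1} t * (\<phi> t * f t $ i))"
        using integrable_bounded_linear[OF bounded_linear_vec_nth[of i] I] by (simp add: mult.assoc)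
    qed
    have "(LINT t:{0<..<1}|lebesgue. \<phi> t *\<^sub>R g t) = (LINT t:{0<..<1}|lebesgue. \<phi> t *\<^sub>R g' t)"
      using g g' \<phi> unfolding has_weak_deriv_def by simp
    then have "(LINT t|lebesgue. indicator {0<..<1} t * (\<phi> t * g t $ i)) - (LINT t|lebesgue. indicator {0<..<1} t * (\<phi> t * g' t $ i)) = 0"
      using comp[OF li(1)] comp[OF li(2)] by simp
    then have "(LINT t|lebesgue. indicator {0<..<1} t * (\<phi> t * g t $ i) - indicator {0<..<1} t * (\<phi> t * g' t $ i)) = 0"
      by (simp only: Bochner_Integration.integral_diff[OF int[OF li(1)] int[OF li(2)]])
    moreover have "indicator {0<..<1} t *\<^sub>R (\<phi> t *\<^sub>R (g t $ i - g' t $ i))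
      = indicator {0<..<1} t * (\<phi> t * g t $ i) - indicator {0<..<1} t * (\<phi> t * g' t $ i)" for t :: real
      by (simp add: right_diff_distrib)
    ultimately show "(LINT t:{0<..<1}|lebesgue. \<phi> t *\<^sub>R (g t $ i - g' t $ i)) = 0"
      unfolding set_lebesgue_integral_def by simp
  qed
  show ?thesis using comp[of 1] comp[of 2] by eventually_elim (simp add: vec_eq_iff forall_2)
qed

lemma funpow_2_vderiv: "(vderiv ^^ 2) f = vderiv (vderiv f)"
  by (simp add: numeral_2_eq_2)

lemma has_weak_deriv_2_iff:
  fixes f w :: "real \<Rightarrow> real^2"
  assumes f: "f absolutely_integrable_on {0..1}" and w: "w absolutely_integrable_on {0..1}"
  shows "has_weak_deriv 2 f w \<longleftrightarrow> (\<forall>\<phi>. test_function \<phi> \<longrightarrow>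
    (\<forall>i. integral {0..1} (\<lambda>t. vderiv (vderiv \<phi>) t * f t $ i) = integral {0..1} (\<lambda>t. \<phi> t * w t $ i)))"
proof -
  have li: "locally_integrable f" if "f absolutely_integrable_on {0..1}" for f :: "real \<Rightarrow> real^2"
    unfolding locally_integrable_def using that by (auto intro: absolutely_integrable_on_subinterval)
  have "((LINT t:{0<..<1}|lebesgue. (vderiv ^^ 2) \<phi> t *\<^sub>R f t) = (- 1) ^ 2 *\<^sub>R (LINT t:{0<..<1}|lebesgue. \<phi> t *\<^sub>R w t))
    \<longleftrightarrow> (\<forall>i. integral {0..1} (\<lambda>t. vderiv (vderiv \<phi>) t * f t $ i) = integral {0..1} (\<lambda>t. \<phi> t * w t $ i))"
    if \<phi>: "test_function \<phi>" for \<phi> :: "real \<Rightarrow> real"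
  proof -
    note \<phi>2 = test_function_vderiv[OF test_function_vderiv[OF \<phi>]]
    have 1: "(\<lambda>t. vderiv (vderiv \<phi>) t *\<^sub>R f t) absolutely_integrable_on {0..1}"
      by (rule absint_scaleR[OF test_function_AC(4)[OF \<phi>2] f])
    have 2: "(\<lambda>t. \<phi> t *\<^sub>R w t) absolutely_integrable_on {0..1}"
      by (rule absint_scaleR[OF test_function_AC(4)[OF \<phi>] w])
    have 3: "integral {0..1} g $ i = integral {0..1} (\<lambda>t. g t $ i)" if "g absolutely_integrable_on {0..1}" for g :: "real \<Rightarrow> real^2" and i
      using that by (intro integral_component_eq_cart[symmetric]) (simp add: absolutely_integrable_on_def)
    show ?thesis
      by (simp add: funpow_2_vderiv LINT_unit[OF 1] LINT_unit[OF 2] vec_eq_iff 3[OF 1] 3[OF 2])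
  qed
  then show ?thesis using li[OF f] li[OF w] by (auto simp: has_weak_deriv_def)
qed

lemma has_weak_deriv_2_perturb:
  fixes f w :: "real \<Rightarrow> real^2" and \<phi> :: "real \<Rightarrow> real"
  assumes f: "f absolutely_integrable_on {0..1}" and w: "w absolutely_integrable_on {0..1}"
    and fw: "has_weak_deriv 2 f w" and \<phi>: "test_function \<phi>"
  shows "has_weak_deriv 2 (\<lambda>t. f t + \<epsilon> *\<^sub>R (\<phi> t *\<^sub>R e)) (\<lambda>t. w t + \<epsilon> *\<^sub>R (vderiv (vderiv \<phi>) t *\<^sub>R e))"
proof -
  note \<phi>1 = test_function_vderiv[OF \<phi>] and \<phi>2 = test_function_vderiv[OF test_function_vderiv[OF \<phi>]]
  have add: "(\<lambda>t. f t + \<epsilon> *\<^sub>R (\<psi> t *\<^sub>R e)) absolutely_integrable_on {0..1}"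
    if "f absolutely_integrable_on {0..1}" "test_function \<psi>" for f :: "real \<Rightarrow> real^2" and \<psi> :: "real \<Rightarrow> real"
    by (intro set_integral_add(1)[OF that(1)] absolutely_integrable_continuous_real continuous_intros test_function_AC(4)[OF that(2)])
  show ?thesis
    unfolding has_weak_deriv_2_iff[OF add[OF f \<phi>] add[OF w \<phi>2]]
  proof (intro allI impI)
    fix \<psi> :: "real \<Rightarrow> real" and i assume \<psi>: "test_function \<psi>"
    note \<psi>1 = test_function_vderiv[OF \<psi>] and \<psi>2 = test_function_vderiv[OF test_function_vderiv[OF \<psi>]]
    have 0: "integral {0..1} (\<lambda>t. vderiv (vderiv \<psi>) t * f t $ i) = integral {0..1} (\<lambda>t. \<psi> t * w t $ i)"
      using fw \<psi> unfolding has_weak_deriv_2_iff[OF f w] by blast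
    have 1: "integral {0..1} (\<lambda>t. vderiv (vderiv \<psi>) t * \<phi> t) = integral {0..1} (\<lambda>t. \<psi> t * vderiv (vderiv \<phi>) t)"
      using test_parts[OF \<psi>1 test_function_AC(1)[OF \<phi>]] test_parts[OF \<psi> test_function_AC(1)[OF \<phi>1]] by simp
    have split: "integral {0..1} (\<lambda>t. \<psi> t * (f t + \<epsilon> *\<^sub>R (\<phi> t *\<^sub>R e)) $ i)
      = integral {0..1} (\<lambda>t. \<psi> t * f t $ i) + (\<epsilon> * e $ i) * integral {0..1} (\<lambda>t. \<psi> t * \<phi> t)"
      if "f absolutely_integrable_on {0..1}" "test_function \<psi>" "test_function \<phi>"
      for f :: "real \<Rightarrow> real^2" and \<psi> \<phi> :: "real \<Rightarrow> real"
    proof -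
      have "(\<lambda>t. \<psi> t * (f t + \<epsilon> *\<^sub>R (\<phi> t *\<^sub>R e)) $ i) = (\<lambda>t. \<psi> t * f t $ i + (\<epsilon> * e $ i) * (\<psi> t * \<phi> t))"
        by (simp add: algebra_simps)
      then show ?thesis
        using test_mult_absint(2)[OF that(2) absint_component[OF that(1)]] test_mult_absint(2)[OF that(2) test_function_AC(5)[OF that(3)]]
        by (simp add: Henstock_Kurzweil_Integration.integral_add integrable_on_mult_right)
    qed
    show "integral {0..1} (\<lambda>t. vderiv (vderiv \<psi>) t * (f t + \<epsilon> *\<^sub>R (\<phi> t *\<^sub>R e)) $ i)
      = integral {0..1} (\<lambda>t. \<psi> t * (w t + \<epsilon> *\<^sub>R (vderiv (vderiv \<phi>) t *\<^sub>R e)) $ i)"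
      unfolding split[OF f \<psi>2 \<phi>] split[OF w \<psi> \<phi>2] using 0 1 by simp
  qed
qed

lemma LINT_unit_cong:
  fixes f g :: "real \<Rightarrow> real"
  assumes g: "g absolutely_integrable_on {0..1}" and eq: "ae_unit (\<lambda>t. f t = g t)"
  shows "(LINT t:{0<..<1}|lebesgue. f t) = integral {0..1} g"
proof -
  obtain N where N: "negligible N" "\<And>t. t \<in> {0..1} \<Longrightarrow> t \<notin> N \<Longrightarrow> f t = g t"
    using ae_unitE[OF eq] by blast
  have "f absolutely_integrable_on {0..1}"
    by (rule absolutely_integrable_spike[OF g N(1)]) (use N in auto)
  moreover have "integral {0..1} f = integral {0..1} g"
    by (rule integral_spike[OF N(1)]) (use N in auto)
  ultimately show ?thesis by (simp add: LINT_unit)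
qed

text \<open>The origin of the exponent (1 - 3p) / 2: the curvature is X / Q^(3/2), and the length
  element contributes Q^(1/2).\<close>

lemma curvature_energy_density:
  fixes X Q p :: real
  assumes "0 < Q"
  shows "\<bar>X / sqrt Q ^ 3\<bar> powr p * sqrt Q = \<bar>X\<bar> powr p * Q powr ((1 - 3 * p) / 2)"
proof -
  have "sqrt Q ^ 3 = Q powr (3 / 2)"
    using assms by (simp add: powr_half_sqrt[symmetric] powr_realpow[symmetric] powr_powr)
  then have "\<bar>X / sqrt Q ^ 3\<bar> powr p = (\<bar>X\<bar> / Q powr (3 / 2)) powr p"
    by (simp only: abs_divide abs_of_nonneg[OF powr_ge_zero])
  also have "\<dots> = \<bar>X\<bar> powr p / Q powr (3 / 2 * p)"
    by (simp only: powr_divide powr_powr)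
  also have "\<dots> = \<bar>X\<bar> powr p * Q powr (- (3 / 2 * p))"
    by (simp only: powr_minus_divide mult_1_right times_divide_eq_right)
  finally have "\<bar>X / sqrt Q ^ 3\<bar> powr p = \<bar>X\<bar> powr p * Q powr (- (3 / 2 * p))" .
  then have "\<bar>X / sqrt Q ^ 3\<bar> powr p * sqrt Q = \<bar>X\<bar> powr p * (Q powr (- (3 / 2 * p)) * Q powr (1 / 2))"
    using assms by (simp add: powr_half_sqrt)
  also have "Q powr (- (3 / 2 * p)) * Q powr (1 / 2) = Q powr ((1 - 3 * p) / 2)"
    unfolding powr_add[symmetric] by (simp add: field_simps)
  finally show ?thesis .
qed

text \<open>The link between the energies as defined and the integrand of
  \<open>first_variation\<close>: \<open>vderiv\<close> is computed at interior points from the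
  one-sided data, and the chosen weak derivative agrees with the explicit one almost
  everywhere.\<close>

lemma perturbed_energy:
  fixes \<gamma> w :: "real \<Rightarrow> real^2" and \<phi> v1 v2 :: "real \<Rightarrow> real" and e1 e2 \<epsilon> :: real
  defines "g \<equiv> \<lambda>t. \<gamma> t + \<epsilon> *\<^sub>R (\<phi> t *\<^sub>R vector [e1, e2])"
  defines "X \<equiv> \<lambda>t. (v1 t * w t $ 2 - v2 t * w t $ 1) + \<epsilon> * (vderiv \<phi> t * (e1 * w t $ 2 - e2 * w t $ 1) + vderiv (vderiv \<phi>) t * (v1 t * e2 - v2 t * e1))"
    and "Q \<equiv> \<lambda>t. (v1 t + \<epsilon> * (vderiv \<phi> t * e1))\<^sup>2 + (v2 t + \<epsilon> * (vderiv \<phi> t * e2))\<^sup>2"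
  assumes \<gamma>: "\<gamma> absolutely_integrable_on {0..1}" and w: "w absolutely_integrable_on {0..1}"
    and weak: "has_weak_deriv 2 \<gamma> w" and \<phi>: "test_function \<phi>"
    and der: "\<And>t. t \<in> {0..1} \<Longrightarrow> (\<gamma> has_vector_derivative vector [v1 t, v2 t]) (at t within {0..1})"
    and Q: "\<And>t. t \<in> {0..1} \<Longrightarrow> 0 < Q t"
    and int: "\<And>c. (\<lambda>t. \<bar>X t\<bar> powr p * Q t powr ((1 - 3 * p) / 2) + c * sqrt (Q t)) absolutely_integrable_on {0..1}"
  shows "bending_energy p g + lam * curve_length g = integral {0..1} (\<lambda>t. \<bar>X t\<bar> powr p * Q t powr ((1 - 3 * p) / 2) + lam * sqrt (Q t))"
proof -
  let ?V = "\<lambda>t. vector [v1 t + \<epsilon> * (vderiv \<phi> t * e1), v2 t + \<epsilon> * (vderiv \<phi> t * e2)] :: real^2"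
  note sm = test_function_smooth[OF \<phi>]
  have V: "vderiv g t = ?V t" if t: "t \<in> {0<..<1}" for t
  proof -
    have "(\<gamma> has_vector_derivative vector [v1 t, v2 t]) (at t)"
      using der[of t] t at_within_Icc_at[of 0 t 1] by simp
    moreover have "((\<lambda>t. \<phi> t *\<^sub>R vector [e1, e2]) has_vector_derivative vderiv \<phi> t *\<^sub>R vector [e1, e2]) (at t)"
      using smoothD(2)[OF sm] by (rule bounded_linear.has_vector_derivative[OF bounded_linear_scaleR_left])
    ultimately have "(g has_vector_derivative vector [v1 t, v2 t] + \<epsilon> *\<^sub>R (vderiv \<phi> t *\<^sub>R vector [e1, e2])) (at t)"
      unfolding g_def by (intro has_vector_derivative_add bounded_linear.has_vector_derivative[OF bounded_linear_scaleR_right]) assumption+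
    moreover have "vector [v1 t, v2 t] + \<epsilon> *\<^sub>R (vderiv \<phi> t *\<^sub>R vector [e1, e2]) = ?V t"
      by (simp add: vec_eq_iff forall_2)
    ultimately show ?thesis by (simp add: vderiv_def vector_derivative_at)
  qed
  have nV: "norm (vderiv g t) = sqrt (Q t)" if "t \<in> {0<..<1}" for t
    unfolding V[OF that] by (simp add: norm_vec_2 Q_def)
  have wd: "has_weak_deriv 2 g (\<lambda>t. w t + \<epsilon> *\<^sub>R (vderiv (vderiv \<phi>) t *\<^sub>R vector [e1, e2]))"
    unfolding g_def by (rule has_weak_deriv_2_perturb[OF \<gamma> w weak \<phi>])
  then have "has_weak_deriv 2 g (weak_deriv 2 g)" unfolding weak_deriv_def by (rule someI[of "has_weak_deriv 2 g"])
  from weak_deriv_unique[OF this wd]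
  have ae: "ae_unit (\<lambda>t. weak_deriv 2 g t = w t + \<epsilon> *\<^sub>R (vderiv (vderiv \<phi>) t *\<^sub>R vector [e1, e2]))" .
  have B: "bending_energy p g = integral {0..1} (\<lambda>t. \<bar>X t\<bar> powr p * Q t powr ((1 - 3 * p) / 2))"
    unfolding bending_energy_def
  proof (rule LINT_unit_cong)
    show "(\<lambda>t. \<bar>X t\<bar> powr p * Q t powr ((1 - 3 * p) / 2)) absolutely_integrable_on {0..1}"
      using int[of 0] by simp
    show "ae_unit (\<lambda>t. \<bar>signed_curvature g t\<bar> powr p * norm (vderiv g t) = \<bar>X t\<bar> powr p * Q t powr ((1 - 3 * p) / 2))"
      using ae
    proof eventually_elim
      case (elim t)
      show ?case
      proof
        assume t: "t \<in> {0<..<1}"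
        have "signed_curvature g t = X t / sqrt (Q t) ^ 3"
          unfolding signed_curvature_def nV[OF t] unfolding V[OF t] elim[rule_format, OF t]
          by (simp add: X_def algebra_simps)
        then show "\<bar>signed_curvature g t\<bar> powr p * norm (vderiv g t) = \<bar>X t\<bar> powr p * Q t powr ((1 - 3 * p) / 2)"
          using curvature_energy_density[OF Q[of t]] t by (simp add: nV)
      qed
    qed
  qed
  \<comment> \<open>The difference of the cases c = 1 and c = 0; it is the reason for assuming
    \<open>int\<close> for every c.\<close>
  have sq: "(\<lambda>t. sqrt (Q t)) absolutely_integrable_on {0..1}"
    using set_integral_diff(1)[OF int[of 1] int[of 0]] by simp
  have L: "curve_length g = integral {0..1} (\<lambda>t. sqrt (Q t))"
    unfolding curve_length_def using sq by (rule LINT_unit_cong) (simp add: nV)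
  have 1: "(\<lambda>t. \<bar>X t\<bar> powr p * Q t powr ((1 - 3 * p) / 2)) integrable_on {0..1}"
    using absint_integrable[OF int[of 0]] by simp
  have 2: "(\<lambda>t. lam * sqrt (Q t)) integrable_on {0..1}"
    using absint_integrable[OF sq] by (rule integrable_on_mult_right)
  show ?thesis
    unfolding B L Henstock_Kurzweil_Integration.integral_add[OF 1 2] integral_mult_right ..
qed

text \<open>All four functions grow at most like the p-th power of \<open>Y\<close>, which is at
  least 1 and dominates the second derivatives.\<close>

lemma euler_lagrange_coefficients_absint:
  fixes v1 v2 w1 w2 :: "real \<Rightarrow> real" and p :: real
  defines "X0 \<equiv> \<lambda>t. v1 t * w2 t - v2 t * w1 t"
  assumes p: "1 < p" and cont: "continuous_on {0..1} v1" "continuous_on {0..1} v2"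
    and w: "w1 \<in> borel_measurable (lebesgue_on {0..1})" "w2 \<in> borel_measurable (lebesgue_on {0..1})"
    and wp: "(\<lambda>t. (1 + \<bar>w1 t\<bar> + \<bar>w2 t\<bar>) powr p) integrable_on {0..1}"
  shows "(\<lambda>t. spow (p - 1) (X0 t)) absolutely_integrable_on {0..1}"
    "(\<lambda>t. spow (p - 1) (X0 t) * w1 t) absolutely_integrable_on {0..1}"
    "(\<lambda>t. spow (p - 1) (X0 t) * w2 t) absolutely_integrable_on {0..1}"
    "(\<lambda>t. \<bar>X0 t\<bar> powr p) absolutely_integrable_on {0..1}"
proof -
  have bd: "\<exists>B. \<forall>t\<in>{0..1}. \<bar>f t\<bar> \<le> B" if "continuous_on {0..1} f" for f :: "real \<Rightarrow> real"
    using compact_imp_bounded[OF compact_continuous_image[OF that]] by (auto simp: bounded_real)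
  obtain B1 where B1: "\<forall>t\<in>{0..1}. \<bar>v1 t\<bar> \<le> B1" using bd[OF cont(1)] by blast
  obtain B2 where B2: "\<forall>t\<in>{0..1}. \<bar>v2 t\<bar> \<le> B2" using bd[OF cont(2)] by blast
  define B where "B = 1 + \<bar>B1\<bar> + \<bar>B2\<bar>"
  define Y where "Y = (\<lambda>t. 1 + \<bar>w1 t\<bar> + \<bar>w2 t\<bar>)"
  have B: "1 \<le> B" by (simp add: B_def)
  have Y: "1 \<le> Y t" "\<bar>w1 t\<bar> \<le> Y t" "\<bar>w2 t\<bar> \<le> Y t" for t by (auto simp: Y_def)
  have X: "\<bar>X0 t\<bar> \<le> B * Y t" if t: "t \<in> {0..1}" for t
  proof -
    have "\<bar>v1 t\<bar> \<le> B" "\<bar>v2 t\<bar> \<le> B" using bspec[OF B1 t] bspec[OF B2 t] by (auto simp: B_def)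
    then have "\<bar>v1 t * w2 t\<bar> \<le> B * \<bar>w2 t\<bar>" "\<bar>v2 t * w1 t\<bar> \<le> B * \<bar>w1 t\<bar>"
      unfolding abs_mult by (auto intro!: mult_right_mono)
    moreover have "B * Y t = B + B * \<bar>w1 t\<bar> + B * \<bar>w2 t\<bar>" by (simp add: Y_def algebra_simps)
    ultimately show ?thesis using B unfolding X0_def by linarith
  qed
  have [measurable]: "v1 \<in> borel_measurable (lebesgue_on {0..1})" "v2 \<in> borel_measurable (lebesgue_on {0..1})"
    by (auto intro!: continuous_imp_measurable_on_sets_lebesgue cont)
  note w[measurable]
  have [measurable]: "spow a \<in> borel_measurable borel" for a unfolding spow_def[abs_def] by measurable
  have bound: "f absolutely_integrable_on {0..1}"
    if "f \<in> borel_measurable (lebesgue_on {0..1})" "\<And>t. t \<in> {0..1} \<Longrightarrow> \<bar>f t\<bar> \<le> B powr p * Y t powr p" for f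
  proof (rule measurable_bounded_by_integrable_imp_absolutely_integrable[OF that(1)])
    show "(\<lambda>t. B powr p * Y t powr p) integrable_on {0..1}"
      using wp unfolding Y_def by (rule integrable_on_mult_right)
  qed (use that(2) in auto)
  have Yp: "(B * Y t) powr (p - 1) * Y t \<le> B powr p * Y t powr p" for t
  proof -
    have "B powr (p - 1) \<le> B powr p" using B by (intro powr_mono) auto
    moreover have "Y t powr (p - 1) * Y t = Y t powr p" using Y(1)[of t] by (simp add: powr_diff)
    ultimately show ?thesis
      using mult_right_mono[of "B powr (p - 1)" "B powr p" "Y t powr p"] B Y(1)[of t]
      by (simp add: powr_mult mult.assoc)
  qed
  have u: "\<bar>spow (p - 1) (X0 t)\<bar> \<le> (B * Y t) powr (p - 1)" if "t \<in> {0..1}" for t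
    unfolding abs_spow using X[OF that] p by (intro powr_mono2) auto
  have uw: "\<bar>spow (p - 1) (X0 t) * c\<bar> \<le> B powr p * Y t powr p" if "t \<in> {0..1}" "\<bar>c\<bar> \<le> Y t" for t c
    using abs_mult_mono[OF u[OF that(1)] that(2)] Yp[of t] by linarith
  show "(\<lambda>t. spow (p - 1) (X0 t)) absolutely_integrable_on {0..1}"
  proof (rule bound)
    show "(\<lambda>t. spow (p - 1) (X0 t)) \<in> borel_measurable (lebesgue_on {0..1})" unfolding X0_def by measurable
    show "\<bar>spow (p - 1) (X0 t)\<bar> \<le> B powr p * Y t powr p" if "t \<in> {0..1}" for t
      using uw[OF that, of 1] Y(1)[of t] by simp
  qed
  show "(\<lambda>t. spow (p - 1) (X0 t) * w1 t) absolutely_integrable_on {0..1}"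
  proof (rule bound)
    show "(\<lambda>t. spow (p - 1) (X0 t) * w1 t) \<in> borel_measurable (lebesgue_on {0..1})" unfolding X0_def by measurable
  qed (rule uw, assumption, rule Y)
  show "(\<lambda>t. spow (p - 1) (X0 t) * w2 t) absolutely_integrable_on {0..1}"
  proof (rule bound)
    show "(\<lambda>t. spow (p - 1) (X0 t) * w2 t) \<in> borel_measurable (lebesgue_on {0..1})" unfolding X0_def by measurable
  qed (rule uw, assumption, rule Y)
  show "(\<lambda>t. \<bar>X0 t\<bar> powr p) absolutely_integrable_on {0..1}"
  proof (rule bound)
    show "(\<lambda>t. \<bar>X0 t\<bar> powr p) \<in> borel_measurable (lebesgue_on {0..1})" unfolding X0_def by measurable
    show "\<bar>\<bar>X0 t\<bar> powr p\<bar> \<le> B powr p * Y t powr p" if "t \<in> {0..1}" for t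
      using powr_mono2[of p "\<bar>X0 t\<bar>" "B * Y t"] X[OF that] p B Y(1)[of t] by (simp add: powr_mult)
  qed
qed

lemma absint_mult_left:
  fixes f :: "real \<Rightarrow> real"
  shows "f absolutely_integrable_on {0..1} \<Longrightarrow> (\<lambda>t. c * f t) absolutely_integrable_on {0..1}"
  by (rule absint_mult_continuous[where g = "\<lambda>_. c"]) auto

text \<open>The normal component of the integrated Euler--Lagrange equation determines \<open>|k|\<^sup>p\<^sup>-\<^sup>2k\<close>
  as an affine function of the position, and its tangential component is not needed.\<close>

lemma p_elastica_curvature_field:
  fixes p :: real and \<gamma> :: "real \<Rightarrow> real^2"
  assumes p: "1 < p" and "p_elastica p \<gamma>"
  obtains b1 b2 \<beta> r T where
    "curvature_field (\<lambda>x. spow (1 / (p - 1)) (b1 * x $ 1 + b2 * x $ 2 + \<beta>)) \<gamma> r T"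
proof -
  obtain lam where imm: "immersed_W2p p \<gamma>" and crit: "\<And>\<eta> :: real \<Rightarrow> real^2. test_function \<eta> \<Longrightarrow>
        ((\<lambda>\<epsilon>. bending_energy p (\<lambda>t. \<gamma> t + \<epsilon> *\<^sub>R \<eta> t)
              + lam * curve_length (\<lambda>t. \<gamma> t + \<epsilon> *\<^sub>R \<eta> t)) has_real_derivative 0) (at 0)"
    using assms(2) unfolding p_elastica_def by blast
  obtain w where weak: "has_weak_deriv 2 \<gamma> w" and wLp: "in_Lp p w"
    using imm unfolding immersed_W2p_def in_W2p_def by blast
  have diff: "\<exists>v. (\<gamma> has_vector_derivative v) (at t within {0..1}) \<and> v \<noteq> 0" if "t \<in> {0..1}" for t
    using imm that unfolding immersed_W2p_def by blast
  have cg: "continuous_on {0..1} \<gamma>"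
    unfolding continuous_on_eq_continuous_within
    using diff has_vector_derivative_continuous by blast
  have gi: "\<gamma> absolutely_integrable_on {0..1}" using cg by (rule absolutely_integrable_continuous_real)
  have wi: "w absolutely_integrable_on {0..1}" and wpi: "(\<lambda>t. norm (w t) powr p) absolutely_integrable_on {0..1}"
    using in_Lp_absint[of p w] p wLp by auto
  \<comment> \<open>The velocity is thereby absolutely continuous, with the weak second derivative
    as its derivative.\<close>
  have C1: "\<exists>v. AC v (\<lambda>t. w t $ i) \<and> (\<forall>t\<in>{0..1}. ((\<lambda>t. \<gamma> t $ i) has_real_derivative v t) (at t within {0..1}))" for i
  proof -
    have "continuous_on {0..1} (\<lambda>t. \<gamma> t $ i)" by (intro continuous_intros cg)
    moreover have "(\<lambda>t. w t $ i) absolutely_integrable_on {0..1}" using wi by (rule absint_component)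
    moreover have "integral {0..1} (\<lambda>t. vderiv (vderiv \<phi>) t * \<gamma> t $ i) = integral {0..1} (\<lambda>t. \<phi> t * w t $ i)"
      if "test_function \<phi>" for \<phi>
      using weak that unfolding has_weak_deriv_2_iff[OF gi wi] by blast
    ultimately show ?thesis by (rule weak_second_derivative_C1) blast+
  qed
  obtain v1 where v1: "AC v1 (\<lambda>t. w t $ 1)" "\<And>t. t \<in> {0..1} \<Longrightarrow> ((\<lambda>t. \<gamma> t $ 1) has_real_derivative v1 t) (at t within {0..1})"
    using C1[of 1] by blast
  obtain v2 where v2: "AC v2 (\<lambda>t. w t $ 2)" "\<And>t. t \<in> {0..1} \<Longrightarrow> ((\<lambda>t. \<gamma> t $ 2) has_real_derivative v2 t) (at t within {0..1})"
    using C1[of 2] by blast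
  define w1 where "w1 = (\<lambda>t. w t $ 1)"
  define w2 where "w2 = (\<lambda>t. w t $ 2)"
  note v1 = v1[folded w1_def] and v2 = v2[folded w2_def]
  note cv = AC_continuous[OF v1(1)] AC_continuous[OF v2(1)]
  have der: "(\<gamma> has_vector_derivative vector [v1 t, v2 t]) (at t within {0..1})" if "t \<in> {0..1}" for t
    using v1(2)[OF that] v2(2)[OF that] by (rule has_vector_derivative_from_components)
  define q where "q = (\<lambda>t. (v1 t)\<^sup>2 + (v2 t)\<^sup>2)"
  have q: "0 < q t" if t: "t \<in> {0..1}" for t
  proof -
    obtain V where V: "(\<gamma> has_vector_derivative V) (at t within {0..1})" "V \<noteq> 0" using diff[OF t] by blast
    have "V = vector [v1 t, v2 t]"
      using vector_derivative_unique_within_closed_interval[of 0 1 t \<gamma>] V(1) der[OF t] t by auto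
    then have "v1 t \<noteq> 0 \<or> v2 t \<noteq> 0" using V(2) by (auto simp: vec_eq_iff forall_2)
    then show ?thesis by (auto simp: q_def sum_power2_gt_zero_iff)
  qed
  have wm: "w1 \<in> borel_measurable (lebesgue_on {0..1})" "w2 \<in> borel_measurable (lebesgue_on {0..1})"
    using absolutely_integrable_measurable[of "{0..1}" w1] absolutely_integrable_measurable[of "{0..1}" w2]
      absint_component[OF wi] by (auto simp: w1_def w2_def)
  have wp: "(\<lambda>t. (1 + \<bar>w1 t\<bar> + \<bar>w2 t\<bar>) powr p) integrable_on {0..1}"
  proof (rule absint_integrable, rule measurable_bounded_by_integrable_imp_absolutely_integrable)
    show "(\<lambda>t. (1 + \<bar>w1 t\<bar> + \<bar>w2 t\<bar>) powr p) \<in> borel_measurable (lebesgue_on {0..1})"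
      using wm by measurable
    show "(\<lambda>t. 3 powr p * (1 + norm (w t) powr p)) integrable_on {0..1}"
      using absint_integrable[OF wpi] by (intro integrable_on_mult_right integrable_add) auto
    fix t :: real
    have c: "\<bar>w1 t\<bar> \<le> norm (w t)" "\<bar>w2 t\<bar> \<le> norm (w t)" unfolding w1_def w2_def by (rule component_le_norm_cart)+
    have "(1 + \<bar>w1 t\<bar> + \<bar>w2 t\<bar>) powr p \<le> (3 * max 1 (norm (w t))) powr p"
      using c p by (intro powr_mono2) auto
    also have "\<dots> = 3 powr p * max 1 (norm (w t)) powr p" by (simp add: powr_mult)
    also have "\<dots> \<le> 3 powr p * (1 + norm (w t) powr p)"
      by (intro mult_left_mono) (auto simp: max_def)
    finally show "norm ((1 + \<bar>w1 t\<bar> + \<bar>w2 t\<bar>) powr p) \<le> 3 powr p * (1 + norm (w t) powr p)" by simp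
  qed simp
  define X0 where "X0 = (\<lambda>t. v1 t * w2 t - v2 t * w1 t)"
  define s where "s = (1 - 3 * p) / 2"
  define cu where "cu = (\<lambda>t. p * spow (p - 1) (X0 t) * q t powr s)"
  define sg where "sg = (\<lambda>t. \<bar>X0 t\<bar> powr p * (2 * s * q t powr (s - 1)) + lam / sqrt (q t))"
  have EL: "integral {0..1} (\<lambda>t. vderiv \<phi> t * (cu t * (e1 * w2 t - e2 * w1 t) + sg t * (v1 t * e1 + v2 t * e2))
      + vderiv (vderiv \<phi>) t * (cu t * (v1 t * e2 - v2 t * e1))) = 0"
    if \<phi>: "test_function \<phi>" for \<phi> :: "real \<Rightarrow> real" and e1 e2 :: real
  proof -
    note \<phi>1 = test_function_vderiv[OF \<phi>] and \<phi>2 = test_function_vderiv[OF test_function_vderiv[OF \<phi>]]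
    have \<eta>: "test_function (\<lambda>t. \<phi> t *\<^sub>R (vector [e1, e2] :: real^2))"
    proof -
      obtain a b where ab: "0 < a" "a < b" "b < 1" "\<And>t. t \<notin> {a..b} \<Longrightarrow> \<phi> t = 0"
        by (rule test_functionE[OF \<phi>]) blast
      show ?thesis
        using smooth_scaleR_const(1)[OF test_function_smooth[OF \<phi>]] ab by (intro test_functionI[of _ a b]) auto
    qed
    show ?thesis
      unfolding cu_def sg_def X0_def q_def s_def w1_def w2_def
    proof (rule first_variation[OF p cv test_function_AC(4)[OF \<phi>1] test_function_AC(4)[OF \<phi>2] wm[unfolded w1_def w2_def] wp[unfolded w1_def w2_def] _ crit[OF \<eta>]])
      show "0 < (v1 t)\<^sup>2 + (v2 t)\<^sup>2" if "t \<in> {0..1}" for t using q[OF that] by (simp add: q_def)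
    qed (rule perturbed_energy[OF gi wi weak \<phi> der]; assumption)
  qed
  have cq: "continuous_on {0..1} q" unfolding q_def by (intro continuous_intros cv)
  have cqp: "continuous_on {0..1} (\<lambda>t. q t powr a)" for a
    using q by (intro continuous_intros cq) force
  have coef: "(\<lambda>t. spow (p - 1) (X0 t)) absolutely_integrable_on {0..1}"
    "(\<lambda>t. spow (p - 1) (X0 t) * w1 t) absolutely_integrable_on {0..1}"
    "(\<lambda>t. spow (p - 1) (X0 t) * w2 t) absolutely_integrable_on {0..1}"
    "(\<lambda>t. \<bar>X0 t\<bar> powr p) absolutely_integrable_on {0..1}"
    unfolding X0_def by (rule euler_lagrange_coefficients_absint[OF p cv wm wp])+
  have cu_int: "(\<lambda>t. cu t) absolutely_integrable_on {0..1}" "(\<lambda>t. cu t * w1 t) absolutely_integrable_on {0..1}"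
    "(\<lambda>t. cu t * w2 t) absolutely_integrable_on {0..1}"
    using absint_mult_continuous[OF absint_mult_left[OF coef(1), of p] cqp[of s]]
      absint_mult_continuous[OF absint_mult_left[OF coef(2), of p] cqp[of s]]
      absint_mult_continuous[OF absint_mult_left[OF coef(3), of p] cqp[of s]]
    by (simp_all add: cu_def mult_ac)
  have sg_int: "sg absolutely_integrable_on {0..1}"
  proof -
    have "(\<lambda>t. (2 * s * q t powr (s - 1)) * \<bar>X0 t\<bar> powr p) absolutely_integrable_on {0..1}"
      by (rule absint_mult_continuous[OF coef(4)]) (rule continuous_on_mult_left[OF cqp])
    moreover have "(\<lambda>t. lam / sqrt (q t)) absolutely_integrable_on {0..1}"
      using q by (intro absolutely_integrable_continuous_real continuous_intros cq) force
    ultimately show ?thesis unfolding sg_def using set_integral_add(1) by (simp add: mult.commute)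
  qed
  have cuv: "(\<lambda>t. cu t * f t) absolutely_integrable_on {0..1}" if "continuous_on {0..1} f" for f
    using absint_mult_continuous[OF cu_int(1) that] by (simp add: mult.commute)
  have sgv: "(\<lambda>t. sg t * f t) absolutely_integrable_on {0..1}" if "continuous_on {0..1} f" for f
    using absint_mult_continuous[OF sg_int that] by (simp add: mult.commute)
  \<comment> \<open>With J the rotation by a right angle, v the velocity and w the second
    derivative, the variation has the coefficient A = sg v - cu J w at \<eta>' and cu J v at
    \<eta>''. The directions (1, 0) and (0, 1) test the two components.\<close>
  define A1 where "A1 = (\<lambda>t. cu t * w2 t + sg t * v1 t)"
  define A2 where "A2 = (\<lambda>t. (- 1) * (cu t * w1 t) + sg t * v2 t)"
  obtain P1 m1 where P1: "AC P1 (\<lambda>t. A1 t + m1)" "ae_unit (\<lambda>t. (- 1) * (cu t * v2 t) = P1 t)"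
  proof (rule weak_euler_lagrange)
    show "A1 absolutely_integrable_on {0..1}" unfolding A1_def by (intro set_integral_add(1) cu_int sgv cv)
    show "(\<lambda>t. (- 1) * (cu t * v2 t)) absolutely_integrable_on {0..1}" by (intro absint_mult_left cuv cv)
    show "integral {0..1} (\<lambda>t. vderiv \<phi> t * A1 t + vderiv (vderiv \<phi>) t * ((- 1) * (cu t * v2 t))) = 0"
      if "test_function \<phi>" for \<phi> using EL[OF that, of 1 0] by (simp add: A1_def)
  qed
  obtain P2 m2 where P2: "AC P2 (\<lambda>t. A2 t + m2)" "ae_unit (\<lambda>t. cu t * v1 t = P2 t)"
  proof (rule weak_euler_lagrange)
    show "A2 absolutely_integrable_on {0..1}" unfolding A2_def by (intro set_integral_add(1) absint_mult_left cu_int sgv cv)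
    show "(\<lambda>t. cu t * v1 t) absolutely_integrable_on {0..1}" by (intro cuv cv)
    show "integral {0..1} (\<lambda>t. vderiv \<phi> t * A2 t + vderiv (vderiv \<phi>) t * (cu t * v1 t)) = 0"
      if "test_function \<phi>" for \<phi> using EL[OF that, of 0 1] by (simp add: A2_def)
  qed
  \<comment> \<open>This is the inner product of P and J v, divided by p, where P = cu J v almost
    everywhere. In its derivative sg v is orthogonal to J v and the two terms cu (J v, J w) cancel;
    what remains, (m, J v) / p, is the derivative of a linear function of the position.\<close>
  define U where "U = (\<lambda>t. (1 / p) * (P2 t * v1 t + (- 1) * (P1 t * v2 t)))"
  define \<beta> where "\<beta> = U 0 - (m2 / p * \<gamma> 0 $ 1 - m1 / p * \<gamma> 0 $ 2)"
  have U': "AC U (\<lambda>t. m2 / p * v1 t - m1 / p * v2 t)"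
  proof (rule AC_cong_ae)
    show "AC U (\<lambda>t. (1 / p) * (((A2 t + m2) * v1 t + P2 t * w1 t) + (- 1) * ((A1 t + m1) * v2 t + P1 t * w2 t)))"
      unfolding U_def by (intro AC_cmult AC_add AC_mult P1 P2 v1 v2)
    show "ae_unit (\<lambda>t. (1 / p) * (((A2 t + m2) * v1 t + P2 t * w1 t) + (- 1) * ((A1 t + m1) * v2 t + P1 t * w2 t)) = m2 / p * v1 t - m1 / p * v2 t)"
      using P1(2) P2(2)
    proof eventually_elim
      case (elim t)
      show ?case
      proof
        assume t: "t \<in> {0<..<1}"
        have "P1 t = - (cu t * v2 t)" "P2 t = cu t * v1 t" using elim t by auto
        then have "((A2 t + m2) * v1 t + P2 t * w1 t) + (- 1) * ((A1 t + m1) * v2 t + P1 t * w2 t) = m2 * v1 t - m1 * v2 t"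
          by (simp add: A1_def A2_def algebra_simps)
        then show "(1 / p) * (((A2 t + m2) * v1 t + P2 t * w1 t) + (- 1) * ((A1 t + m1) * v2 t + P1 t * w2 t)) = m2 / p * v1 t - m1 / p * v2 t"
          by (simp add: diff_divide_distrib)
      qed
    qed
  qed
  have U_eq: "U t = m2 / p * \<gamma> t $ 1 - m1 / p * \<gamma> t $ 2 + \<beta>" if t: "t \<in> {0..1}" for t
  proof -
    have "AC (\<lambda>t. m2 / p * \<gamma> t $ 1 - m1 / p * \<gamma> t $ 2) (\<lambda>t. m2 / p * v1 t - m1 / p * v2 t)"
    proof (rule AC_C1)
      show "((\<lambda>t. m2 / p * \<gamma> t $ 1 - m1 / p * \<gamma> t $ 2) has_real_derivative m2 / p * v1 t - m1 / p * v2 t) (at t within {0..1})"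
        if "t \<in> {0..1}" for t
        by (intro DERIV_diff DERIV_cmult v1(2) v2(2) that)
    qed (intro continuous_intros cv)
    from AC_at[OF this t] AC_at[OF U' t] show ?thesis by (simp add: \<beta>_def)
  qed
  \<comment> \<open>Almost everywhere \<open>U\<close> is cu q / p, the signed power p - 1 of the
    curvature, since s + 1 = -(3/2)(p - 1). So this is a continuous representative of the
    curvature.\<close>
  define k where "k = (\<lambda>t. spow (1 / (p - 1)) (U t))"
  have k_ae: "ae_unit (\<lambda>t. X0 t * q t powr (- 3 / 2) = k t)"
    using P1(2) P2(2)
  proof eventually_elim
    case (elim t)
    show ?case
    proof
      assume t: "t \<in> {0<..<1}"
      then have qt: "0 < q t" using q by simp
      have "P1 t = - (cu t * v2 t)" "P2 t = cu t * v1 t" using elim t by auto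
      then have "U t = (1 / p) * cu t * q t" by (simp add: U_def q_def power2_eq_square algebra_simps)
      also have "\<dots> = spow (p - 1) (X0 t) * (q t powr s * q t)" using p by (simp add: cu_def)
      also have "q t powr s * q t = (q t powr (- 3 / 2)) powr (p - 1)"
      proof -
        have "s + 1 = - 3 / 2 * (p - 1)" by (simp add: s_def field_simps)
        moreover have "q t powr s * q t = q t powr (s + 1)" using qt by (simp add: powr_add)
        ultimately show ?thesis by (simp only: powr_powr)
      qed
      also have "spow (p - 1) (X0 t) * (q t powr (- 3 / 2)) powr (p - 1) = spow (p - 1) (X0 t * q t powr (- 3 / 2))"
        by (simp add: spow_mult spow_nonneg)
      finally show "X0 t * q t powr (- 3 / 2) = k t"
        using p by (simp add: k_def spow_spow spow_one)
    qed
  qed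
  \<comment> \<open>The reciprocal speed: multiplying the velocity by it gives the unit tangent,
    whose almost everywhere derivative contains w only through the curvature and is therefore
    continuous.\<close>
  define \<rho> where "\<rho> = (\<lambda>t. q t powr (- 1 / 2))"
  have AC_q: "AC q (\<lambda>t. (w1 t * v1 t + v1 t * w1 t) + (w2 t * v2 t + v2 t * w2 t))"
    unfolding q_def power2_eq_square by (intro AC_add AC_mult v1 v2)
  have AC_\<rho>: "AC \<rho> (\<lambda>t. (- 1 / 2 * q t powr (- 3 / 2)) * ((w1 t * v1 t + v1 t * w1 t) + (w2 t * v2 t + v2 t * w2 t)))"
    unfolding \<rho>_def
  proof (rule AC_chain[OF AC_q, of "{0<..}" "\<lambda>y. y powr (- 1 / 2)" "\<lambda>y. - 1 / 2 * y powr (- 3 / 2)"])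
    show "((\<lambda>y. y powr (- 1 / 2)) has_real_derivative - 1 / 2 * y powr (- 3 / 2)) (at y)" if "y \<in> {0<..}" for y :: real
      using DERIV_powr_const[OF DERIV_ident, of y "- 1 / 2"] that by simp
    show "continuous_on {0<..} (\<lambda>y::real. - 1 / 2 * y powr (- 3 / 2))"
      by (intro continuous_intros) auto
  qed (use q in \<open>auto simp: is_interval_1\<close>)
  have ck: "continuous_on {0..1} k"
    unfolding k_def using p by (intro continuous_on_compose2[OF continuous_on_spow[of "1 / (p - 1)" UNIV] AC_continuous[OF U']]) auto
  have q\<rho>: "\<rho> t * q t = sqrt (q t)" "q t powr (- 3 / 2) * q t = \<rho> t" "(\<rho> t)\<^sup>2 * q t = 1" if t: "t \<in> {0..1}" for t
  proof -
    have pm: "q t powr a * q t = q t powr (a + 1)" for a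
      using q[OF t] by (simp add: powr_add)
    show "\<rho> t * q t = sqrt (q t)" using q[OF t] by (simp add: \<rho>_def pm powr_half_sqrt)
    show "q t powr (- 3 / 2) * q t = \<rho> t" by (simp add: \<rho>_def pm)
    show "(\<rho> t)\<^sup>2 * q t = 1" using q[OF t] by (simp add: \<rho>_def pm powr_power powr_add[symmetric] power2_eq_square)
  qed
  have dT: "((\<lambda>t. v1 t * \<rho> t) has_real_derivative - v2 t * k t) (at t within {0..1})"
    "((\<lambda>t. v2 t * \<rho> t) has_real_derivative v1 t * k t) (at t within {0..1})" if t: "t \<in> {0..1}" for t
  proof -
    let ?q' = "\<lambda>t. (w1 t * v1 t + v1 t * w1 t) + (w2 t * v2 t + v2 t * w2 t)"
    have alg: "w1 t * \<rho> t + v1 t * ((- 1 / 2 * q t powr (- 3 / 2)) * ?q' t) = - v2 t * (X0 t * q t powr (- 3 / 2))"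
      "w2 t * \<rho> t + v2 t * ((- 1 / 2 * q t powr (- 3 / 2)) * ?q' t) = v1 t * (X0 t * q t powr (- 3 / 2))"
      if "t \<in> {0..1}" for t
      unfolding q\<rho>(2)[OF that, symmetric] by (simp_all add: X0_def q_def power2_eq_square algebra_simps)
    have "AC (\<lambda>t. v1 t * \<rho> t) (\<lambda>t. - v2 t * k t)"
    proof (rule AC_cong_ae[OF AC_mult[OF v1(1) AC_\<rho>]])
      show "ae_unit (\<lambda>t. w1 t * \<rho> t + v1 t * ((- 1 / 2 * q t powr (- 3 / 2)) * ?q' t) = - v2 t * k t)"
        using k_ae by eventually_elim (use alg in auto)
    qed
    then show "((\<lambda>t. v1 t * \<rho> t) has_real_derivative - v2 t * k t) (at t within {0..1})"
      by (rule AC_has_derivative) (intro continuous_intros cv ck t)+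
    have "AC (\<lambda>t. v2 t * \<rho> t) (\<lambda>t. v1 t * k t)"
    proof (rule AC_cong_ae[OF AC_mult[OF v2(1) AC_\<rho>]])
      show "ae_unit (\<lambda>t. w2 t * \<rho> t + v2 t * ((- 1 / 2 * q t powr (- 3 / 2)) * ?q' t) = v1 t * k t)"
        using k_ae by eventually_elim (use alg in auto)
    qed
    then show "((\<lambda>t. v2 t * \<rho> t) has_real_derivative v1 t * k t) (at t within {0..1})"
      by (rule AC_has_derivative) (intro continuous_intros cv ck t)+
  qed
  let ?T = "\<lambda>t. vector [v1 t * \<rho> t, v2 t * \<rho> t] :: real^2"
  let ?\<kappa> = "\<lambda>x::real^2. spow (1 / (p - 1)) (m2 / p * x $ 1 + (- m1 / p) * x $ 2 + \<beta>)"
  have "curvature_field ?\<kappa> \<gamma> (\<lambda>t. sqrt (q t)) ?T"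
    unfolding curvature_field_def
  proof (intro conjI ballI)
    show "continuous_on {0..1} (\<lambda>t. sqrt (q t))" by (intro continuous_intros cq)
    fix t :: real assume t: "t \<in> {0..1}"
    show "0 < sqrt (q t)" using q[OF t] by simp
    have "(v1 t * \<rho> t)\<^sup>2 + (v2 t * \<rho> t)\<^sup>2 = (\<rho> t)\<^sup>2 * q t"
      by (simp add: q_def power_mult_distrib algebra_simps)
    then show "norm (?T t) = 1" using q\<rho>(3)[OF t] by (simp add: norm_vec_2)
    have one: "sqrt (q t) * \<rho> t = 1"
      using q\<rho>(1,3)[OF t] by (metis mult.assoc mult.commute power2_eq_square)
    then have "sqrt (q t) *\<^sub>R ?T t = vector [v1 t, v2 t]"
      by (simp add: vec_eq_iff forall_2 mult.left_commute[of "sqrt (q t)"])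
    then show "(\<gamma> has_vector_derivative sqrt (q t) *\<^sub>R ?T t) (at t within {0..1})" using der[OF t] by simp
    have "?\<kappa> (\<gamma> t) = k t" unfolding k_def U_eq[OF t] by (simp add: algebra_simps)
    moreover have "(sqrt (q t) * k t) *\<^sub>R rot90 (?T t) = vector [- v2 t * k t, v1 t * k t]"
    proof -
      have "sqrt (q t) * k t * (c * \<rho> t) = c * k t * (sqrt (q t) * \<rho> t)" for c by (simp only: mult_ac)
      then have "sqrt (q t) * k t * (c * \<rho> t) = c * k t" for c unfolding one by simp
      then show ?thesis
        by (simp only: rot90_def vec_eq_iff forall_2 vector_2 vector_scaleR_component real_scaleR_def
            mult_minus_left mult_minus_right simp_thms)
    qed
    ultimately show "(?T has_vector_derivative (sqrt (q t) * ?\<kappa> (\<gamma> t)) *\<^sub>R rot90 (?T t)) (at t within {0..1})"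
      using has_vector_derivative_vector_2[OF dT[OF t]] by simp
  qed
  then show ?thesis by (rule that)
qed

section \<open>Uniqueness\<close>

lemma rot90_simps:
  "rot90 (x - y) = rot90 x - rot90 y" "x \<bullet> rot90 x = 0" "norm (rot90 x) = norm x" "rot90 (c *\<^sub>R x) = c *\<^sub>R rot90 x"
  by (simp_all add: rot90_def vec_eq_iff forall_2 norm_vec_2 inner_vec_def sum_2 add.commute)

text \<open>The inverse function rule relative to sets, which covers the one-sided derivatives at
  the ends of the parameter interval.\<close>

lemma DERIV_inverse_within:
  fixes f g :: "real \<Rightarrow> real"
  assumes f: "(f has_real_derivative d) (at (g y) within S)" and d: "d \<noteq> 0"
    and g: "continuous (at y within T) g" and y: "y \<in> T"
    and inv: "\<And>z. z \<in> T \<Longrightarrow> g z \<in> S" "\<And>z. z \<in> T \<Longrightarrow> f (g z) = z"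
  shows "(g has_real_derivative 1 / d) (at y within T)"
proof -
  have "filterlim g (at (g y) within S) (at y within T)"
    unfolding filterlim_at
  proof
    show "\<forall>\<^sub>F z in at y within T. g z \<in> S \<and> g z \<noteq> g y"
      unfolding eventually_at_filter using inv y by (intro always_eventually) metis
    show "(g \<longlongrightarrow> g y) (at y within T)" using g by (simp add: continuous_within)
  qed
  moreover have "((\<lambda>x. (f x - f (g y)) / (x - g y)) \<longlongrightarrow> d) (at (g y) within S)"
    using f by (simp add: has_field_derivative_iff)
  ultimately have "((\<lambda>z. (f (g z) - f (g y)) / (g z - g y)) \<longlongrightarrow> d) (at y within T)"
    by (rule filterlim_compose[rotated])
  then have "((\<lambda>z. 1 / ((f (g z) - f (g y)) / (g z - g y))) \<longlongrightarrow> 1 / d) (at y within T)"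
    using d by (intro tendsto_divide[OF tendsto_const]) auto
  moreover have "\<forall>\<^sub>F z in at y within T. 1 / ((f (g z) - f (g y)) / (g z - g y)) = (g z - g y) / (z - y)"
    unfolding eventually_at_filter using inv(2) y by (intro always_eventually) simp
  ultimately show ?thesis
    unfolding has_field_derivative_iff by (rule Lim_transform_eventually)
qed

text \<open>The product of e with exp(-C t) does not increase, starts at 0 and is
  nonnegative.\<close>

lemma gronwall_zero:
  fixes e :: "real \<Rightarrow> real"
  assumes der: "\<And>t. t \<in> {0..1} \<Longrightarrow> (e has_real_derivative e' t) (at t within {0..1})"
    and le: "\<And>t. t \<in> {0..1} \<Longrightarrow> e' t \<le> C * e t" and e0: "e 0 = 0" and nonneg: "\<And>t. 0 \<le> e t"
    and t: "t \<in> {0..1}"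
  shows "e t = 0"
proof -
  let ?g = "\<lambda>t. e t * exp (- C * t)"
  have dg: "(?g has_real_derivative e' x * exp (- C * x) + exp (- C * x) * (- C) * e x) (at x within {0..1})"
    if "x \<in> {0..1}" for x
  proof -
    have "((\<lambda>t. exp (- C * t)) has_real_derivative exp (- C * x) * (- C)) (at x within {0..1})"
      by (auto intro!: derivative_eq_intros)
    from DERIV_mult[OF der[OF that] this] show ?thesis .
  qed
  have "?g t \<le> ?g 0"
  proof (rule DERIV_nonpos_imp_decreasing_open[where f = ?g and a = 0 and b = t])
    show "continuous_on {0..t} ?g"
      using dg t by (intro continuous_on_subset[OF DERIV_continuous_on[of "{0..1}" ?g]]) auto
    fix x assume x: "0 < x" "x < t"
    then have x1: "x \<in> {0..1}" using t by auto
    have "(?g has_real_derivative e' x * exp (- C * x) + exp (- C * x) * (- C) * e x) (at x)"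
      using dg[OF x1] x t at_within_Icc_at[of 0 x 1] by simp
    moreover have "e' x * exp (- C * x) + exp (- C * x) * (- C) * e x = (e' x - C * e x) * exp (- C * x)"
      by (simp add: algebra_simps)
    moreover have "\<dots> \<le> 0" using le[OF x1] by (simp add: mult_nonpos_nonneg)
    ultimately show "\<exists>y. (?g has_real_derivative y) (at x) \<and> y \<le> 0" by metis
  qed (use t in auto)
  then have "e t \<le> 0" using e0 by (simp add: mult_le_0_iff)
  then show ?thesis using nonneg[of t] by simp
qed

definition locally_lipschitz :: "(real^2 \<Rightarrow> real) \<Rightarrow> bool" where
  "locally_lipschitz \<kappa> \<longleftrightarrow> (\<forall>B. \<exists>L. \<forall>x y. norm x \<le> B \<longrightarrow> norm y \<le> B \<longrightarrow> \<bar>\<kappa> x - \<kappa> y\<bar> \<le> L * norm (x - y))"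

lemma locally_lipschitz_spow_affine:
  assumes m: "1 \<le> m"
  shows "locally_lipschitz (\<lambda>x. spow m (b1 * x $ 1 + b2 * x $ 2 + \<beta>))"
  unfolding locally_lipschitz_def
proof
  fix B
  define D where "D = \<bar>b1\<bar> * \<bar>B\<bar> + \<bar>b2\<bar> * \<bar>B\<bar> + \<bar>\<beta>\<bar>"
  let ?L = "m * D powr (m - 1) * (\<bar>b1\<bar> + \<bar>b2\<bar>)"
  have lin: "\<bar>b1 * x $ 1 + b2 * x $ 2\<bar> \<le> (\<bar>b1\<bar> + \<bar>b2\<bar>) * norm x" for x :: "real^2"
  proof -
    have "\<bar>b1 * x $ 1\<bar> \<le> \<bar>b1\<bar> * norm x" "\<bar>b2 * x $ 2\<bar> \<le> \<bar>b2\<bar> * norm x"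
      unfolding abs_mult by (auto intro!: mult_left_mono component_le_norm_cart)
    then show ?thesis unfolding distrib_right by linarith
  qed
  have bd: "\<bar>b1 * x $ 1 + b2 * x $ 2 + \<beta>\<bar> \<le> D" if "norm x \<le> B" for x :: "real^2"
  proof -
    have "(\<bar>b1\<bar> + \<bar>b2\<bar>) * norm x \<le> (\<bar>b1\<bar> + \<bar>b2\<bar>) * \<bar>B\<bar>" using that by (intro mult_left_mono) auto
    then show ?thesis using lin[of x] unfolding D_def distrib_right by linarith
  qed
  have "\<bar>spow m (b1 * x $ 1 + b2 * x $ 2 + \<beta>) - spow m (b1 * y $ 1 + b2 * y $ 2 + \<beta>)\<bar> \<le> ?L * norm (x - y)"
    if "norm x \<le> B" "norm y \<le> B" for x y :: "real^2"
  proof -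
    have "\<bar>spow m (b1 * x $ 1 + b2 * x $ 2 + \<beta>) - spow m (b1 * y $ 1 + b2 * y $ 2 + \<beta>)\<bar>
      \<le> m * D powr (m - 1) * \<bar>(b1 * x $ 1 + b2 * x $ 2 + \<beta>) - (b1 * y $ 1 + b2 * y $ 2 + \<beta>)\<bar>"
      using m bd that by (intro spow_lipschitz) auto
    also have "(b1 * x $ 1 + b2 * x $ 2 + \<beta>) - (b1 * y $ 1 + b2 * y $ 2 + \<beta>) = b1 * (x - y) $ 1 + b2 * (x - y) $ 2"
      by (simp add: algebra_simps)
    also have "m * D powr (m - 1) * \<bar>b1 * (x - y) $ 1 + b2 * (x - y) $ 2\<bar> \<le> m * D powr (m - 1) * ((\<bar>b1\<bar> + \<bar>b2\<bar>) * norm (x - y))"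
      using m by (intro mult_left_mono lin) auto
    finally show ?thesis by (simp add: mult.assoc)
  qed
  then show "\<exists>L. \<forall>x y :: real^2. norm x \<le> B \<longrightarrow> norm y \<le> B \<longrightarrow>
      \<bar>spow m (b1 * x $ 1 + b2 * x $ 2 + \<beta>) - spow m (b1 * y $ 1 + b2 * y $ 2 + \<beta>)\<bar> \<le> L * norm (x - y)" by blast
qed

text \<open>Gronwall for the squared distance in position and direction, inside a ball that contains
  both curves and so provides one Lipschitz constant.\<close>

lemma curvature_field_unique:
  assumes 1: "curvature_field \<kappa> \<gamma> r T" and 2: "curvature_field \<kappa> y r S"
    and lip: "locally_lipschitz \<kappa>" and init: "\<gamma> 0 = y 0" "T 0 = S 0" and t: "t \<in> {0..1}"
  shows "\<gamma> t = y t"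
proof -
  have c: "continuous_on {0..1} r" using 1 by (simp add: curvature_field_def)
  have r: "0 < r t" if "t \<in> {0..1}" for t using 1 that by (simp add: curvature_field_def)
  have N: "norm (S t) = 1" if "t \<in> {0..1}" for t using 2 that by (simp add: curvature_field_def)
  have d\<gamma>: "(\<gamma> has_vector_derivative r t *\<^sub>R T t) (at t within {0..1})"
    and dT: "(T has_vector_derivative (r t * \<kappa> (\<gamma> t)) *\<^sub>R rot90 (T t)) (at t within {0..1})" if "t \<in> {0..1}" for t
    using 1 that unfolding curvature_field_def by blast+
  have dy: "(y has_vector_derivative r t *\<^sub>R S t) (at t within {0..1})"
    and dS: "(S has_vector_derivative (r t * \<kappa> (y t)) *\<^sub>R rot90 (S t)) (at t within {0..1})" if "t \<in> {0..1}" for t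
    using 2 that unfolding curvature_field_def by blast+
  have "continuous_on {0..1} \<gamma>" "continuous_on {0..1} y"
    unfolding continuous_on_eq_continuous_within using d\<gamma> dy has_vector_derivative_continuous by blast+
  then have "bounded (\<gamma> ` {0..1})" "bounded (y ` {0..1})"
    by (auto intro!: compact_imp_bounded compact_continuous_image)
  then obtain B1 B2 where B12: "\<forall>x\<in>\<gamma> ` {0..1}. norm x \<le> B1" "\<forall>x\<in>y ` {0..1}. norm x \<le> B2"
    unfolding bounded_iff by blast
  define B where "B = max B1 B2"
  have B: "norm (\<gamma> t) \<le> B" "norm (y t) \<le> B" if "t \<in> {0..1}" for t
    using B12 that by (auto simp: B_def le_max_iff_disj)
  obtain L where L: "\<And>x y. norm x \<le> B \<Longrightarrow> norm y \<le> B \<Longrightarrow> \<bar>\<kappa> x - \<kappa> y\<bar> \<le> L * norm (x - y)"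
    using lip unfolding locally_lipschitz_def by blast
  have "bounded (r ` {0..1})" using c by (intro compact_imp_bounded compact_continuous_image) auto
  then obtain R where R: "\<And>t. t \<in> {0..1} \<Longrightarrow> \<bar>r t\<bar> \<le> R" unfolding bounded_real by blast
  let ?e = "\<lambda>t. (\<gamma> t - y t) \<bullet> (\<gamma> t - y t) + (T t - S t) \<bullet> (T t - S t)"
  let ?a = "\<lambda>t. r t *\<^sub>R T t - r t *\<^sub>R S t"
  let ?b = "\<lambda>t. (r t * \<kappa> (\<gamma> t)) *\<^sub>R rot90 (T t) - (r t * \<kappa> (y t)) *\<^sub>R rot90 (S t)"
  let ?e' = "\<lambda>t. ((\<gamma> t - y t) \<bullet> ?a t + ?a t \<bullet> (\<gamma> t - y t)) + ((T t - S t) \<bullet> ?b t + ?b t \<bullet> (T t - S t))"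
  have "?e t = 0"
  proof (rule gronwall_zero[OF _ _ _ _ t])
    fix t :: real assume t: "t \<in> {0..1}"
    have "((\<lambda>t. \<gamma> t - y t) has_vector_derivative ?a t) (at t within {0..1})" (is ?d1)
      and "((\<lambda>t. T t - S t) has_vector_derivative ?b t) (at t within {0..1})" (is ?d2)
      by (intro has_vector_derivative_diff d\<gamma> dy dT dS t)+
    then show "(?e has_real_derivative ?e' t) (at t within {0..1})"
      unfolding has_real_derivative_iff_has_vector_derivative
      by (intro has_vector_derivative_add bounded_bilinear.has_vector_derivative[OF bounded_bilinear_inner] \<open>?d1\<close> \<open>?d2\<close>)
    let ?x = "\<gamma> t - y t" and ?z = "T t - S t"
    have 1: "?x \<bullet> ?a t \<le> r t * (norm ?x * norm ?z)"
    proof -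
      have "?x \<bullet> ?a t = r t * (?x \<bullet> ?z)" by (simp add: inner_diff_right algebra_simps)
      then show ?thesis using r[OF t] norm_cauchy_schwarz[of ?x ?z] by simp
    qed
    \<comment> \<open>Arranged so that the first summand is perpendicular to T - S and drops out;
      only the difference of the curvatures remains to be estimated.\<close>
    have "?b t = (r t * \<kappa> (\<gamma> t)) *\<^sub>R rot90 ?z + (r t * (\<kappa> (\<gamma> t) - \<kappa> (y t))) *\<^sub>R rot90 (S t)"
      by (simp add: rot90_simps scaleR_diff_right scaleR_diff_left right_diff_distrib)
    then have "?z \<bullet> ?b t = r t * ((\<kappa> (\<gamma> t) - \<kappa> (y t)) * (?z \<bullet> rot90 (S t)))"
      by (simp only: inner_add_right inner_scaleR_right rot90_simps(2) mult_zero_right add_0 mult.assoc)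
    moreover have "(\<kappa> (\<gamma> t) - \<kappa> (y t)) * (?z \<bullet> rot90 (S t)) \<le> (L * norm ?x) * norm ?z"
    proof -
      have "\<bar>?z \<bullet> rot90 (S t)\<bar> \<le> norm ?z"
        using Cauchy_Schwarz_ineq2[of ?z "rot90 (S t)"] N[OF t] by (simp add: rot90_simps)
      from abs_mult_mono[OF L[OF B[OF t]] this] show ?thesis by linarith
    qed
    ultimately have 2: "?z \<bullet> ?b t \<le> r t * (L * norm ?x * norm ?z)"
      using r[OF t] by simp
    have "?e' t \<le> 2 * r t * ((1 + L) * (norm ?x * norm ?z))"
      using 1 2 by (simp add: inner_commute algebra_simps)
    also have "\<dots> \<le> 2 * R * ((1 + \<bar>L\<bar>) * (norm ?x * norm ?z))"
    proof -
      have "(1 + L) * (norm ?x * norm ?z) \<le> (1 + \<bar>L\<bar>) * (norm ?x * norm ?z)" by (intro mult_right_mono) auto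
      then have "2 * r t * ((1 + L) * (norm ?x * norm ?z)) \<le> 2 * r t * ((1 + \<bar>L\<bar>) * (norm ?x * norm ?z))"
        using r[OF t] by (intro mult_left_mono) auto
      also have "\<dots> \<le> 2 * R * ((1 + \<bar>L\<bar>) * (norm ?x * norm ?z))"
        using R[OF t] by (intro mult_right_mono) auto
      finally show ?thesis .
    qed
    also have "\<dots> \<le> R * (1 + \<bar>L\<bar>) * ?e t"
    proof -
      have "2 * (norm ?x * norm ?z) \<le> (norm ?x)\<^sup>2 + (norm ?z)\<^sup>2" using sum_squares_bound[of "norm ?x" "norm ?z"] by simp
      then have "2 * (norm ?x * norm ?z) \<le> ?e t" by (simp add: dot_square_norm)
      moreover have "0 \<le> R * (1 + \<bar>L\<bar>)" using R[OF t] by simp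
      ultimately have "R * (1 + \<bar>L\<bar>) * (2 * (norm ?x * norm ?z)) \<le> R * (1 + \<bar>L\<bar>) * ?e t" by (rule mult_left_mono)
      then show ?thesis by (simp only: mult_ac)
    qed
    finally show "?e' t \<le> R * (1 + \<bar>L\<bar>) * ?e t" .
  qed (use init in auto)
  moreover have "0 \<le> (T t - S t) \<bullet> (T t - S t)" "0 \<le> (\<gamma> t - y t) \<bullet> (\<gamma> t - y t)" by simp_all
  ultimately have "(\<gamma> t - y t) \<bullet> (\<gamma> t - y t) = 0" by linarith
  then show ?thesis by simp
qed

text \<open>Run at the speed of the given curve, that is along its arclength
  \<open>\<sigma>\<close>, the model solves the same system with the same initial data, so both
  agree. The inverse of \<open>\<sigma>\<close> is the reparametrization and the similarity is the
  identity, as a translation by 0.\<close>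

lemma represented_by_model:
  assumes cf: "curvature_field \<kappa> \<gamma> r T" and lip: "locally_lipschitz \<kappa>"
    and M: "has_angle_curvature M \<theta> k" and k: "\<And>s. k s = \<kappa> (M s)"
    and init: "\<gamma> 0 = M s0" "T 0 = vector [cos (\<theta> s0), sin (\<theta> s0)]"
  shows "represented_by \<gamma> M"
proof -
  have c: "continuous_on {0..1} r" using cf by (simp add: curvature_field_def)
  have r: "0 < r t" if "t \<in> {0..1}" for t using cf that by (simp add: curvature_field_def)
  define \<sigma> where "\<sigma> = (\<lambda>t. integral {0..t} r)"
  have d\<sigma>: "(\<sigma> has_real_derivative r t) (at t within {0..1})" if "t \<in> {0..1}" for t
    unfolding \<sigma>_def using c that by (rule integral_has_real_derivative)
  have c\<sigma>: "continuous_on {0..1} \<sigma>" by (rule DERIV_continuous_on) (rule d\<sigma>)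
  have \<sigma>0: "\<sigma> 0 = 0" by (simp add: \<sigma>_def)
  have mono: "\<sigma> s < \<sigma> t" if "s < t" "s \<in> {0..1}" "t \<in> {0..1}" for s t
  proof (rule DERIV_pos_imp_increasing_open[OF that(1)])
    show "continuous_on {s..t} \<sigma>" using c\<sigma> that by (auto intro: continuous_on_subset)
    fix x assume "s < x" "x < t"
    then have "x \<in> {0..1}" "0 < x" "x < 1" using that by auto
    then show "\<exists>y. (\<sigma> has_real_derivative y) (at x) \<and> 0 < y"
      using d\<sigma>[of x] r[of x] at_within_Icc_at[of 0 x 1] by auto
  qed
  let ?\<theta> = "\<lambda>t. \<theta> (\<sigma> t + s0)"
  let ?y = "\<lambda>t. M (\<sigma> t + s0)" and ?S = "\<lambda>t. vector [cos (?\<theta> t), sin (?\<theta> t)] :: real^2"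
  have "curvature_field \<kappa> ?y r ?S"
    unfolding curvature_field_def
  proof (intro conjI ballI c)
    fix t :: real assume t: "t \<in> {0..1}"
    show "0 < r t" using r[OF t] .
    show "norm (?S t) = 1" by (simp add: norm_vec_2)
    have ds: "((\<lambda>t. \<sigma> t + s0) has_real_derivative r t) (at t within {0..1})"
      using d\<sigma>[OF t] by (auto intro!: derivative_eq_intros)
    have dM: "(M has_vector_derivative ?S t) (at (\<sigma> t + s0))" and d\<theta>: "(\<theta> has_real_derivative k (\<sigma> t + s0)) (at (\<sigma> t + s0))"
      using M unfolding has_angle_curvature_def by blast+
    show "(?y has_vector_derivative r t *\<^sub>R ?S t) (at t within {0..1})"
      using vector_derivative_diff_chain_within[OF ds[unfolded has_real_derivative_iff_has_vector_derivative] has_derivative_at_withinI[OF dM[unfolded has_vector_derivative_def]]]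
      by (simp add: o_def)
    have dt: "(?\<theta> has_real_derivative k (\<sigma> t + s0) * r t) (at t within {0..1})"
      by (rule DERIV_chain2[OF d\<theta> ds])
    have "((\<lambda>t. cos (?\<theta> t)) has_real_derivative - sin (?\<theta> t) * (k (\<sigma> t + s0) * r t)) (at t within {0..1})"
      "((\<lambda>t. sin (?\<theta> t)) has_real_derivative cos (?\<theta> t) * (k (\<sigma> t + s0) * r t)) (at t within {0..1})"
      by (rule DERIV_chain2[OF DERIV_cos dt], rule DERIV_chain2[OF DERIV_sin dt])
    from has_vector_derivative_vector_2[OF this]
    have "(?S has_vector_derivative vector [- sin (?\<theta> t) * (k (\<sigma> t + s0) * r t), cos (?\<theta> t) * (k (\<sigma> t + s0) * r t)]) (at t within {0..1})" .
    moreover have "vector [- sin (?\<theta> t) * (k (\<sigma> t + s0) * r t), cos (?\<theta> t) * (k (\<sigma> t + s0) * r t)] = (r t * \<kappa> (?y t)) *\<^sub>R rot90 (?S t)"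
      by (simp add: k rot90_def vec_eq_iff forall_2 mult_ac)
    ultimately show "(?S has_vector_derivative (r t * \<kappa> (?y t)) *\<^sub>R rot90 (?S t)) (at t within {0..1})" by simp
  qed
  from curvature_field_unique[OF cf this lip] init \<sigma>0
  have eq: "\<gamma> t = M (\<sigma> t + s0)" if "t \<in> {0..1}" for t using that by simp
  define l where "l = \<sigma> 1"
  have l: "0 < l" using mono[of 0 1] \<sigma>0 by (simp add: l_def)
  have "\<sigma> ` {0..1} = {0..l}"
  proof
    have "\<sigma> s \<le> \<sigma> t" if "s \<le> t" "s \<in> {0..1}" "t \<in> {0..1}" for s t
      using mono[of s t] that by (cases "s = t") auto
    from this[of 0] this[of _ 1] show "\<sigma> ` {0..1} \<subseteq> {0..l}" using \<sigma>0 by (auto simp: l_def)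
    show "{0..l} \<subseteq> \<sigma> ` {0..1}"
    proof
      fix s assume "s \<in> {0..l}"
      then show "s \<in> \<sigma> ` {0..1}" using IVT'[of \<sigma> 0 s 1] c\<sigma> \<sigma>0 by (auto simp: l_def)
    qed
  qed
  moreover have "inj_on \<sigma> {0..1}"
    by (rule linorder_inj_onI) (use mono in force)+
  ultimately obtain \<phi> where hom: "homeomorphism {0..1} {0..l} \<sigma> \<phi>"
    using homeomorphism_compact[OF compact_Icc c\<sigma>] by blast
  have \<phi>: "\<phi> s \<in> {0..1}" "\<sigma> (\<phi> s) = s" if "s \<in> {0..l}" for s
    using hom that unfolding homeomorphism_def by blast+
  have c\<phi>: "continuous_on {0..l} \<phi>" using hom unfolding homeomorphism_def by blast
  have "C1_diffeo {0..l} {0..1} \<phi>"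
    unfolding C1_diffeo_def
  proof (intro exI conjI)
    show "homeomorphism {0..l} {0..1} \<phi> \<sigma>" using hom by (simp add: homeomorphism_symD)
    show "C1_within {0..1} \<sigma>" unfolding C1_within_def using c d\<sigma> by blast
    show "C1_within {0..l} \<phi>"
      unfolding C1_within_def
    proof (intro exI conjI ballI)
      show "continuous_on {0..l} (\<lambda>s. 1 / r (\<phi> s))"
        using \<phi>(1) r by (intro continuous_intros continuous_on_compose2[OF c c\<phi>]) (auto simp: less_imp_neq[THEN not_sym])
      fix s assume s: "s \<in> {0..l}"
      show "(\<phi> has_real_derivative 1 / r (\<phi> s)) (at s within {0..l})"
      proof (rule DERIV_inverse_within[where f = \<sigma> and g = \<phi> and y = s, OF d\<sigma>[OF \<phi>(1)[OF s]] _ _ s])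
        show "r (\<phi> s) \<noteq> 0" using r[OF \<phi>(1)[OF s]] by simp
        show "continuous (at s within {0..l}) \<phi>" using c\<phi> s by (simp add: continuous_on_eq_continuous_within)
      qed (use \<phi> in auto)
    qed
  qed
  moreover have "similarity (\<lambda>x. x + 0)" by (rule similarity.translation)
  moreover have "\<forall>s\<in>{0..l}. \<gamma> (\<phi> s) + 0 = M (s + s0)"
  proof
    fix s assume "s \<in> {0..l}"
    then show "\<gamma> (\<phi> s) + 0 = M (s + s0)" using eq[OF \<phi>(1)] \<phi>(2) by simp
  qed
  ultimately show ?thesis unfolding represented_by_def using l by blast
qed

section \<open>Classification\<close>

lemma curvature_field_components:
  "curvature_field \<kappa> \<gamma> r T \<longleftrightarrow> continuous_on {0..1} r \<and>
     (\<forall>t\<in>{0..1}. 0 < r t \<and> (T t $ 1)\<^sup>2 + (T t $ 2)\<^sup>2 = 1 \<and>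
        ((\<lambda>t. \<gamma> t $ 1) has_real_derivative r t * T t $ 1) (at t within {0..1}) \<and>
        ((\<lambda>t. \<gamma> t $ 2) has_real_derivative r t * T t $ 2) (at t within {0..1}) \<and>
        ((\<lambda>t. T t $ 1) has_real_derivative - (r t * \<kappa> (\<gamma> t) * T t $ 2)) (at t within {0..1}) \<and>
        ((\<lambda>t. T t $ 2) has_real_derivative r t * \<kappa> (\<gamma> t) * T t $ 1) (at t within {0..1}))"
proof -
  have comp: "(f has_vector_derivative V) F \<longleftrightarrow>
      ((\<lambda>t. f t $ 1) has_real_derivative V $ 1) F \<and> ((\<lambda>t. f t $ 2) has_real_derivative V $ 2) F"
    for f :: "real \<Rightarrow> real^2" and V F
    using has_vector_derivative_component[of f V F] has_vector_derivative_from_components[of f "V $ 1" F "V $ 2"]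
    by (auto simp: vec_2_eta)
  show ?thesis unfolding curvature_field_def comp by (simp add: norm_vec_2 rot90_def)
qed

lemma similarity_rotation_2:
  fixes a b :: real
  assumes "a\<^sup>2 + b\<^sup>2 = 1"
  shows "similarity (\<lambda>x. vector [a * x $ 1 - b * x $ 2, b * x $ 1 + a * x $ 2])"
proof -
  let ?Q = "vector [vector [a, - b], vector [b, a]] :: real^2^2"
  have "transpose ?Q ** ?Q = mat 1"
    using assms by (simp add: vec_eq_iff forall_2 matrix_matrix_mult_def transpose_def mat_def sum_2 power2_eq_square algebra_simps)
  then have "rotation_matrix ?Q"
    using assms by (simp add: rotation_matrix_def orthogonal_matrix det_2 power2_eq_square)
  moreover have "(\<lambda>x. ?Q *v x) = (\<lambda>x. vector [a * x $ 1 - b * x $ 2, b * x $ 1 + a * x $ 2])"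
    by (simp add: fun_eq_iff vec_eq_iff forall_2 matrix_vector_mult_def sum_2)
  ultimately show ?thesis using similarity.rotation[of ?Q] by simp
qed

lemma similarity_affine_2:
  fixes a b c d1 d2 :: real
  assumes "a\<^sup>2 + b\<^sup>2 = 1" "0 < c"
  shows "similarity (\<lambda>x. vector [c * (a * x $ 1 - b * x $ 2) + d1, c * (b * x $ 1 + a * x $ 2) + d2])"
proof -
  have "similarity ((\<lambda>x. x + vector [d1, d2]) \<circ> ((\<lambda>x. c *\<^sub>R x) \<circ> (\<lambda>x. vector [a * x $ 1 - b * x $ 2, b * x $ 1 + a * x $ 2])))"
    using assms by (intro similarity.composition similarity.translation similarity.dilation similarity_rotation_2)
  moreover have "(\<lambda>x. x + vector [d1, d2]) \<circ> ((\<lambda>x. c *\<^sub>R x) \<circ> (\<lambda>x. vector [a * x $ 1 - b * x $ 2, b * x $ 1 + a * x $ 2]))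
     = (\<lambda>x::real^2. vector [c * (a * x $ 1 - b * x $ 2) + d1, c * (b * x $ 1 + a * x $ 2) + d2] :: real^2)"
    by (simp add: fun_eq_iff vec_eq_iff forall_2)
  ultimately show ?thesis by simp
qed

lemma similarity_reflection_2: "similarity (\<lambda>x. vector [x $ 1, - x $ 2])"
proof -
  let ?Q = "vector [vector [1, 0], vector [0, - 1]] :: real^2^2"
  have "transpose ?Q ** ?Q = mat 1"
    by (simp add: vec_eq_iff forall_2 matrix_matrix_mult_def transpose_def mat_def sum_2)
  then have "rotoinversion_matrix ?Q"
    by (simp add: rotoinversion_matrix_def orthogonal_matrix det_2)
  moreover have "(\<lambda>x. ?Q *v x) = (\<lambda>x. vector [x $ 1, - x $ 2])"
    by (simp add: fun_eq_iff vec_eq_iff forall_2 matrix_vector_mult_def sum_2)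
  ultimately show ?thesis using similarity.reflection[of ?Q] by simp
qed

lemma represented_by_similar_curve:
  assumes "similarity S" "represented_by (\<lambda>t. S (\<gamma> t)) M"
  shows "represented_by \<gamma> M"
proof -
  obtain s0 l \<phi> S' where "l > 0" "C1_diffeo {0..l} {0..1} \<phi>" "similarity S'"
    "\<forall>s\<in>{0..l}. S' (S (\<gamma> (\<phi> s))) = M (s + s0)"
    using assms(2) unfolding represented_by_def by blast
  moreover from this have "similarity (S' \<circ> S)" using assms(1) by (intro similarity.composition)
  ultimately show ?thesis unfolding represented_by_def by (metis comp_apply)
qed

lemma represented_by_similar_model:
  assumes "similarity S" "represented_by \<gamma> M" "\<And>s. S (M s) = N s"
  shows "represented_by \<gamma> N"
proof -
  obtain s0 l \<phi> S' where "l > 0" "C1_diffeo {0..l} {0..1} \<phi>" "similarity S'"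
    "\<forall>s\<in>{0..l}. S' (\<gamma> (\<phi> s)) = M (s + s0)"
    using assms(2) unfolding represented_by_def by blast
  moreover from this have "similarity (S \<circ> S')" using assms(1) by (intro similarity.composition)
  ultimately show ?thesis unfolding represented_by_def using assms(3) by (metis comp_apply)
qed

text \<open>The dilation scales the speed by c and the curvature by 1 / c, so their product, the
  turning rate of the tangent, is invariant; this is \<open>ck\<close>.\<close>

lemma curvature_field_affine:
  fixes a b c d1 d2 :: real
  defines "S \<equiv> \<lambda>x::real^2. vector [c * (a * x $ 1 - b * x $ 2) + d1, c * (b * x $ 1 + a * x $ 2) + d2] :: real^2"
  assumes ab: "a\<^sup>2 + b\<^sup>2 = 1" and c: "0 < c" and cf: "curvature_field \<kappa> \<gamma> r T"
    and \<kappa>': "\<And>x. \<kappa>' (S x) = \<kappa> x / c"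
  shows "curvature_field \<kappa>' (\<lambda>t. S (\<gamma> t)) (\<lambda>t. c * r t) (\<lambda>t. vector [a * T t $ 1 - b * T t $ 2, b * T t $ 1 + a * T t $ 2])"
    (is "curvature_field _ _ _ ?V")
  unfolding curvature_field_components
proof (intro conjI ballI)
  note cf' = cf[unfolded curvature_field_components]
  show "continuous_on {0..1} (\<lambda>t. c * r t)" using cf' by (intro continuous_on_mult_left) blast
  fix t :: real assume t: "t \<in> {0..1}"
  have r: "0 < r t" "(T t $ 1)\<^sup>2 + (T t $ 2)\<^sup>2 = 1" using cf' t by blast+
  show "0 < c * r t" using c r by simp
  have "(a * T t $ 1 - b * T t $ 2)\<^sup>2 + (b * T t $ 1 + a * T t $ 2)\<^sup>2 = (a\<^sup>2 + b\<^sup>2) * ((T t $ 1)\<^sup>2 + (T t $ 2)\<^sup>2)"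
    by (simp add: power2_eq_square algebra_simps)
  then show "(?V t $ 1)\<^sup>2
      + (?V t $ 2)\<^sup>2 = 1" using ab r by simp
  have d: "((\<lambda>t. \<gamma> t $ 1) has_real_derivative r t * T t $ 1) (at t within {0..1})"
        "((\<lambda>t. \<gamma> t $ 2) has_real_derivative r t * T t $ 2) (at t within {0..1})"
        "((\<lambda>t. T t $ 1) has_real_derivative - (r t * \<kappa> (\<gamma> t) * T t $ 2)) (at t within {0..1})"
        "((\<lambda>t. T t $ 2) has_real_derivative r t * \<kappa> (\<gamma> t) * T t $ 1) (at t within {0..1})"
    using cf' t by blast+
  show "((\<lambda>t. S (\<gamma> t) $ 1) has_real_derivative c * r t * ?V t $ 1) (at t within {0..1})"
    "((\<lambda>t. S (\<gamma> t) $ 2) has_real_derivative c * r t * ?V t $ 2) (at t within {0..1})"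
    unfolding S_def vector_2 by (auto intro!: derivative_eq_intros d simp: algebra_simps)
  have ck: "c * r t * \<kappa>' (S (\<gamma> t)) = r t * \<kappa> (\<gamma> t)" using c by (simp add: \<kappa>')
  show "((\<lambda>t. ?V t $ 1) has_real_derivative
      - (c * r t * \<kappa>' (S (\<gamma> t)) * ?V t $ 2)) (at t within {0..1})"
    "((\<lambda>t. ?V t $ 2) has_real_derivative
      c * r t * \<kappa>' (S (\<gamma> t)) * ?V t $ 1) (at t within {0..1})"
    unfolding vector_2 ck by (auto intro!: derivative_eq_intros d simp: algebra_simps)
qed

lemma curvature_field_reflect:
  defines "S \<equiv> \<lambda>x::real^2. vector [x $ 1, - x $ 2] :: real^2"
  assumes cf: "curvature_field \<kappa> \<gamma> r T" and \<kappa>': "\<And>x. \<kappa>' (S x) = - \<kappa> x"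
  shows "curvature_field \<kappa>' (\<lambda>t. S (\<gamma> t)) r (\<lambda>t. S (T t))"
  unfolding curvature_field_components
proof (intro conjI ballI)
  note cf' = cf[unfolded curvature_field_components]
  show "continuous_on {0..1} r" using cf' by blast
  fix t :: real assume t: "t \<in> {0..1}"
  show "0 < r t" "(S (T t) $ 1)\<^sup>2 + (S (T t) $ 2)\<^sup>2 = 1" using cf' t by (auto simp: S_def)
  have d: "((\<lambda>t. \<gamma> t $ 1) has_real_derivative r t * T t $ 1) (at t within {0..1})"
        "((\<lambda>t. \<gamma> t $ 2) has_real_derivative r t * T t $ 2) (at t within {0..1})"
        "((\<lambda>t. T t $ 1) has_real_derivative - (r t * \<kappa> (\<gamma> t) * T t $ 2)) (at t within {0..1})"
        "((\<lambda>t. T t $ 2) has_real_derivative r t * \<kappa> (\<gamma> t) * T t $ 1) (at t within {0..1})"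
    using cf' t by blast+
  show "((\<lambda>t. S (\<gamma> t) $ 1) has_real_derivative r t * S (T t) $ 1) (at t within {0..1})"
    "((\<lambda>t. S (\<gamma> t) $ 2) has_real_derivative r t * S (T t) $ 2) (at t within {0..1})"
    "((\<lambda>t. S (T t) $ 1) has_real_derivative - (r t * \<kappa>' (S (\<gamma> t)) * S (T t) $ 2)) (at t within {0..1})"
    "((\<lambda>t. S (T t) $ 2) has_real_derivative r t * \<kappa>' (S (\<gamma> t)) * S (T t) $ 1) (at t within {0..1})"
    unfolding \<kappa>' unfolding S_def vector_2 by (auto intro!: derivative_eq_intros d)
qed

lemma unit_vector_angle:
  fixes x y :: real
  assumes "x\<^sup>2 + y\<^sup>2 = 1"
  obtains \<Theta> where "- pi \<le> \<Theta>" "\<Theta> \<le> pi" "x = cos \<Theta>" "y = sin \<Theta>"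
proof (cases "0 \<le> y")
  case True
  then show ?thesis using sincos_total_pi[OF True assms] that by (metis order_trans neg_le_0_iff_le pi_ge_zero)
next
  case False
  then obtain t where "0 \<le> t" "t \<le> pi" "x = cos t" "- y = sin t"
    using sincos_total_pi[of "- y" x] assms by auto
  then show ?thesis using that[of "- t"] by auto
qed

lemma curvature_field_initial_angle:
  assumes "curvature_field \<kappa> \<gamma> r T"
  obtains \<Theta> where "- pi \<le> \<Theta>" "\<Theta> \<le> pi" "T 0 = vector [cos \<Theta>, sin \<Theta>]"
proof -
  have "(T 0 $ 1)\<^sup>2 + (T 0 $ 2)\<^sup>2 = 1" using assms unfolding curvature_field_components by simp
  then obtain \<Theta> where "- pi \<le> \<Theta>" "\<Theta> \<le> pi" "T 0 $ 1 = cos \<Theta>" "T 0 $ 2 = sin \<Theta>"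
    by (rule unit_vector_angle) blast
  then show ?thesis using that[of \<Theta>] by (simp add: vec_eq_iff forall_2)
qed

section \<open>Matching a curve with a line, a circle or a model\<close>

text \<open>The initial tangent line itself solves the system if the prescribed curvature vanishes
  along it. This covers curvature zero everywhere and also the starts at which \<open>u\<close>
  vanishes and the tangent is parallel to its zero line.\<close>

lemma represented_by_linear:
  assumes cf: "curvature_field \<kappa> \<gamma> r T" and lip: "locally_lipschitz \<kappa>"
    and zero: "\<And>u. \<kappa> (\<gamma> 0 + u *\<^sub>R T 0) = 0"
  shows "represented_by \<gamma> linear_curve"
proof -
  obtain \<Theta> where \<Theta>: "T 0 = vector [cos \<Theta>, sin \<Theta>]" by (rule curvature_field_initial_angle[OF cf]) blast
  let ?M = "\<lambda>s. \<gamma> 0 + s *\<^sub>R T 0"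
  have "represented_by \<gamma> ?M"
  proof (rule represented_by_model[OF cf lip, where ?s0.0 = 0])
    show "has_angle_curvature ?M (\<lambda>_. \<Theta>) (\<lambda>_. 0)"
      unfolding has_angle_curvature_def \<Theta> by (auto intro!: derivative_eq_intros)
  qed (use zero \<Theta> in auto)
  \<comment> \<open>The rotation by -\<Theta>, which turns the tangent to the first axis, with the
    translation that brings the initial point to the origin.\<close>
  moreover let ?S = "\<lambda>x::real^2. vector [1 * (cos \<Theta> * x $ 1 - (- sin \<Theta>) * x $ 2) + - (cos \<Theta> * \<gamma> 0 $ 1 + sin \<Theta> * \<gamma> 0 $ 2),
      1 * ((- sin \<Theta>) * x $ 1 + cos \<Theta> * x $ 2) + - (- sin \<Theta> * \<gamma> 0 $ 1 + cos \<Theta> * \<gamma> 0 $ 2)] :: real^2"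
  have "similarity ?S" by (rule similarity_affine_2) auto
  moreover have "?S (?M s) = linear_curve s" for s
  proof -
    have "cos \<Theta> * (s * cos \<Theta>) + sin \<Theta> * (s * sin \<Theta>) = s * ((sin \<Theta>)\<^sup>2 + (cos \<Theta>)\<^sup>2)"
      by (simp only: power2_eq_square algebra_simps)
    then show ?thesis by (simp add: \<Theta> linear_curve_def vec_eq_iff forall_2 algebra_simps)
  qed
  ultimately show ?thesis using represented_by_similar_model by blast
qed

lemma represented_by_circular:
  assumes cf: "curvature_field (\<lambda>_. 1) \<gamma> r T"
  shows "represented_by \<gamma> circular_curve"
proof -
  obtain \<Theta> where \<Theta>: "T 0 = vector [cos \<Theta>, sin \<Theta>]" by (rule curvature_field_initial_angle[OF cf]) blast
  \<comment> \<open>The tangential angle of the unit circle is s + pi / 2.\<close>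
  let ?s = "\<Theta> - pi / 2"
  let ?v = "\<gamma> 0 - circular_curve ?s"
  have "represented_by \<gamma> (\<lambda>s. circular_curve s + ?v)"
  proof (rule represented_by_model[OF cf, where ?s0.0 = ?s])
    show "locally_lipschitz (\<lambda>_. 1)" unfolding locally_lipschitz_def by (auto intro: exI[of _ 0])
    show "has_angle_curvature (\<lambda>s. circular_curve s + ?v) (\<lambda>s. s + pi / 2) (\<lambda>s. 1)"
      using has_angle_curvature_circular unfolding has_angle_curvature_def
      by (auto intro!: derivative_eq_intros)
  qed (use \<Theta> in auto)
  then show ?thesis
    by (rule represented_by_similar_model[OF similarity.translation[of "- ?v"]]) simp
qed

text \<open>Here \<open>u = |k|\<^sup>p\<^sup>-\<^sup>2k\<close> equals \<open>- a y\<close>, and \<open>|k|\<^sup>p = a p' (h + cos \<theta>)\<close> is the energy identity.\<close>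

lemma represented_by_matching:
  fixes p :: real
  assumes p: "1 < p" "p \<le> 2" and cf: "curvature_field (\<lambda>x. spow (1 / (p - 1)) (- x $ 2)) \<gamma> r T"
    and T0: "T 0 = vector [cos \<Theta>, sin \<Theta>]" and y0: "\<gamma> 0 $ 2 \<le> 0"
    and h: "(- \<gamma> 0 $ 2) powr (p / (p - 1)) = p / (p - 1) * (h + cos \<Theta>)"
    and M: "has_angle_curvature M \<theta> k" and a: "0 < a" and Mk: "\<And>s. - a * M s $ 2 = spow (p - 1) (k s)"
    and s0: "\<theta> s0 = \<Theta>" "0 \<le> k s0" "k s0 powr p = a * (p / (p - 1)) * (h + cos \<Theta>)"
  shows "represented_by \<gamma> M"
proof -
  let ?m = "1 / (p - 1)"
  \<comment> \<open>Dilation by c must turn the field for -y into the one for -a y: (a c)^(1/(p-1))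
    = 1 / c, that is c^p = 1 / a.\<close>
  define c where "c = a powr (- 1 / p)"
  have c: "0 < c" using a by (simp add: c_def)
  \<comment> \<open>The field depends on the height alone, so a horizontal translation is free and
    makes the first coordinates agree; the second ones must agree by the energy identity.\<close>
  define d1 where "d1 = M s0 $ 1 - c * \<gamma> 0 $ 1"
  let ?S = "\<lambda>x::real^2. vector [c * (1 * x $ 1 - 0 * x $ 2) + d1, c * (0 * x $ 1 + 1 * x $ 2) + 0] :: real^2"
  let ?\<kappa> = "\<lambda>x::real^2. spow ?m (0 * x $ 1 + (- a) * x $ 2 + 0)"
  have cf': "curvature_field ?\<kappa> (\<lambda>t. ?S (\<gamma> t)) (\<lambda>t. c * r t) (\<lambda>t. vector [1 * T t $ 1 - 0 * T t $ 2, 0 * T t $ 1 + 1 * T t $ 2])"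
  proof (rule curvature_field_affine[OF _ c cf])
    fix x :: "real^2"
    have "spow ?m (a * c) = 1 / c"
    proof -
      have "a * c = a powr (1 - 1 / p)" using a by (simp add: c_def powr_diff powr_minus divide_inverse)
      then have "spow ?m (a * c) = a powr ((1 - 1 / p) * ?m)" using a c by (simp add: spow_nonneg powr_powr)
      also have "(1 - 1 / p) * ?m = 1 / p" using p by (simp add: field_simps)
      also have "a powr (1 / p) = 1 / c" using powr_minus_divide[of a "1 / p"] a by (simp add: c_def)
      finally show ?thesis .
    qed
    then have "spow ?m ((a * c) * (- x $ 2)) = spow ?m (- x $ 2) / c" unfolding spow_mult by simp
    then show "?\<kappa> (?S x) = spow ?m (- x $ 2) / c" by (simp add: mult.assoc)
  qed simp
  have \<kappa>: "k s = ?\<kappa> (M s)" for s using Mk[of s] p by (simp add: spow_spow spow_one)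
  have "represented_by (\<lambda>t. ?S (\<gamma> t)) M"
  proof (rule represented_by_model[OF cf' _ M \<kappa>, where ?s0.0 = s0])
    show "locally_lipschitz ?\<kappa>" using p by (intro locally_lipschitz_spow_affine) (simp add: field_simps)
    show "vector [1 * T 0 $ 1 - 0 * T 0 $ 2, 0 * T 0 $ 1 + 1 * T 0 $ 2] = (vector [cos (\<theta> s0), sin (\<theta> s0)] :: real^2)"
      by (simp add: T0 s0)
    let ?p = "p / (p - 1)"
    have pp: "0 < ?p" using p by simp
    \<comment> \<open>The heights are compared after raising them to the power p / (p - 1), where
      \<open>h\<close> and \<open>s0(3)\<close> give equal values; on nonnegative numbers this power
      is injective.\<close>
    have "(a * (c * - \<gamma> 0 $ 2)) powr ?p = (a * c) powr ?p * (- \<gamma> 0 $ 2) powr ?p"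
      unfolding mult.assoc[symmetric] by (rule powr_mult)
    also have "(a * c) powr ?p = a"
    proof -
      have "a * c = a powr (1 - 1 / p)" using a by (simp add: c_def powr_diff powr_minus divide_inverse)
      then have "(a * c) powr ?p = a powr ((1 - 1 / p) * ?p)" by (simp add: powr_powr)
      also have "(1 - 1 / p) * ?p = 1" using p by (simp add: field_simps)
      finally show ?thesis using a by simp
    qed
    also have "a * (- \<gamma> 0 $ 2) powr ?p = k s0 powr p" unfolding h s0(3) by simp
    also have "k s0 powr p = (- a * M s0 $ 2) powr ?p"
      unfolding Mk spow_nonneg[OF s0(2)] using p by (simp add: powr_powr)
    finally have eq: "(a * (c * - \<gamma> 0 $ 2)) powr ?p = (- a * M s0 $ 2) powr ?p" .
    have nn: "0 \<le> a * (c * - \<gamma> 0 $ 2)" using a c y0 by (intro mult_nonneg_nonneg) auto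
    have nn': "0 \<le> - a * M s0 $ 2" unfolding Mk spow_nonneg[OF s0(2)] by simp
    have "a * (c * - \<gamma> 0 $ 2) = - a * M s0 $ 2"
      using powr_less_mono2[OF pp nn, of "- a * M s0 $ 2"] powr_less_mono2[OF pp nn', of "a * (c * - \<gamma> 0 $ 2)"] eq
      by linarith
    then have "c * \<gamma> 0 $ 2 = M s0 $ 2" using a by simp
    then show "?S (\<gamma> 0) = M s0" by (simp add: d1_def vec_eq_iff forall_2)
  qed
  moreover have "similarity ?S" using c by (intro similarity_affine_2) auto
  ultimately show ?thesis using represented_by_similar_curve[of ?S] by blast
qed

lemma represented_by_normal_form:
  fixes p :: real
  assumes p: "1 < p" "p \<le> 2" and cf: "curvature_field (\<lambda>x. spow (1 / (p - 1)) (- x $ 2)) \<gamma> r T"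
    and y0: "\<gamma> 0 $ 2 \<le> 0"
  shows "represented_by \<gamma> linear_curve \<or> (\<exists>q\<in>{0<..<1}. represented_by \<gamma> (wavelike_curve p q))
    \<or> represented_by \<gamma> (borderline_curve p) \<or> (\<exists>q\<in>{0<..<1}. represented_by \<gamma> (orbitlike_curve p q))"
proof -
  let ?p = "p / (p - 1)"
  have pp: "0 < ?p" using p by simp
  obtain \<Theta> where \<Theta>: "- pi \<le> \<Theta>" "\<Theta> \<le> pi" and T0: "T 0 = vector [cos \<Theta>, sin \<Theta>]"
    by (rule curvature_field_initial_angle[OF cf]) blast
  \<comment> \<open>These are the rest points of the pendulum, h = -1 for cos \<Theta> = 1 and h = 1
    for cos \<Theta> = -1; the curve stays on the axis.\<close>
  have equilibrium: "represented_by \<gamma> linear_curve" if "\<gamma> 0 $ 2 = 0" "sin \<Theta> = 0"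
  proof (rule represented_by_linear[OF cf])
    show "locally_lipschitz (\<lambda>x. spow (1 / (p - 1)) (- x $ 2))"
      using locally_lipschitz_spow_affine[of "1 / (p - 1)" 0 "- 1" 0] p by (simp add: field_simps)
    show "spow (1 / (p - 1)) (- (\<gamma> 0 + u *\<^sub>R T 0) $ 2) = 0" for u using that by (simp add: T0)
  qed
  define h where "h = (- \<gamma> 0 $ 2) powr ?p / ?p - cos \<Theta>"
  have h: "(- \<gamma> 0 $ 2) powr ?p = ?p * (h + cos \<Theta>)"
  proof -
    have "x = K * (x / K - y + y)" if "0 < K" for x y K :: real using that by simp
    from this[OF pp] show ?thesis unfolding h_def .
  qed
  have hc: "0 \<le> h + cos \<Theta>"
  proof -
    have "h + cos \<Theta> = (- \<gamma> 0 $ 2) powr ?p / ?p" by (simp add: h_def)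
    then show ?thesis using divide_nonneg_pos[OF powr_ge_zero pp] by simp
  qed
  have y0_iff: "\<gamma> 0 $ 2 = 0 \<longleftrightarrow> h + cos \<Theta> = 0"
    using h pp by (metis mult_eq_0_iff neg_equal_0_iff_equal powr_eq_0_iff order_less_irrefl)
  note matching = represented_by_matching[OF p cf T0 y0 h]
  have half: "(sin (\<Theta> / 2))\<^sup>2 = (1 - cos \<Theta>) / 2" "(cos (\<Theta> / 2))\<^sup>2 = (1 + cos \<Theta>) / 2"
    using cos_double_sin[of "\<Theta> / 2"] cos_double_cos[of "\<Theta> / 2"] by simp_all
  have sc: "(sin \<Theta>)\<^sup>2 = 1 - (cos \<Theta>)\<^sup>2" by (simp add: sin_squared_eq)
  consider "h = - 1" | "- 1 < h" "h < 1" | "h = 1" | "1 < h"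
    using hc cos_le_one[of \<Theta>] by linarith
  then show ?thesis
  proof cases
    case 1
    then have "cos \<Theta> = 1" using hc cos_le_one[of \<Theta>] by linarith
    then have "\<gamma> 0 $ 2 = 0" "sin \<Theta> = 0" using y0_iff 1 sc by auto
    then show ?thesis using equilibrium by blast
  next
    case 2
    \<comment> \<open>h + cos(angle) vanishes where sin(angle / 2)^2 = (1 + h) / 2, and q is the
      largest value of sin(angle / 2) on the wavelike model.\<close>
    define q where "q = sqrt ((1 + h) / 2)"
    have q2: "q\<^sup>2 = (1 + h) / 2" and q: "0 < q" "q < 1" using 2 by (auto simp: q_def real_sqrt_lt_1_iff)
    \<comment> \<open>The value that \<open>sn\<close> must take at the matching parameter; |z|
      \<le> 1 expresses h + cos \<Theta> \<ge> 0. Its arcsine selects the branch with nonnegative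
      cosine, hence with nonnegative curvature.\<close>
    define z where "z = sin (\<Theta> / 2) / q"
    have z2: "z\<^sup>2 = (sin (\<Theta> / 2))\<^sup>2 / q\<^sup>2" by (simp add: z_def power_divide)
    have zle: "z\<^sup>2 \<le> 1" unfolding z2 half q2 using 2 hc by (simp add: field_simps)
    then have z: "- 1 \<le> z" "z \<le> 1" by (auto simp: abs_square_le_1 abs_le_iff)
    define s0 where "s0 = F1 p (arcsin z) q"
    have am: "am1 p s0 q = arcsin z" unfolding s0_def using am1_props(2)[OF p q] .
    have cs: "cos (arcsin z) = sqrt (1 - z\<^sup>2)" using z by (simp add: cos_arcsin)
    have cn: "cn p s0 q = sqrt (1 - z\<^sup>2) powr (2 / p)"
      unfolding cn_eq[OF p q] am cs using zle by (simp add: spow_nonneg)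
    \<comment> \<open>Solves a q p / (p - 1) = (2 q)^(p-1), so that -a times the height of the model
      is the signed power p - 1 of its curvature.\<close>
    define a where "a = 2 powr (p - 1) * q powr (p - 2) / ?p"
    have a: "0 < a" unfolding a_def by (intro divide_pos_pos mult_pos_pos pp) (use q in auto)
    have "represented_by \<gamma> (wavelike_curve p q)"
    proof (rule matching[OF has_angle_curvature_wavelike[OF p q] a, where ?s0.0 = s0])
      fix s
      have "- a * wavelike_curve p q s $ 2 = (a * ?p) * q * (\<bar>cn p s q\<bar> powr (p - 2) * cn p s q)"
        by (simp add: wavelike_curve_def)
      also have "(a * ?p) * q = (2 * q) powr (p - 1)"
        using p q by (simp add: a_def powr_mult powr_diff field_simps power2_eq_square)
      also have "\<bar>cn p s q\<bar> powr (p - 2) * cn p s q = spow (p - 1) (cn p s q)" by (simp add: abs_powr_times)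
      also have "(2 * q) powr (p - 1) * \<dots> = spow (p - 1) (2 * q * cn p s q)"
        unfolding spow_mult using q by (simp add: spow_nonneg powr_mult)
      finally show "- a * wavelike_curve p q s $ 2 = spow (p - 1) (2 * q * cn p s q)" .
    next
      have "q * sn p s0 q = sin (\<Theta> / 2)" using q z by (simp add: sn_def am z_def)
      then show "2 * arcsin (q * sn p s0 q) = \<Theta>" using \<Theta> by (simp add: arcsin_sin)
      show "0 \<le> 2 * q * cn p s0 q" using q by (simp add: cn)
      have "(2 * q * cn p s0 q) powr p = (2 * q) powr p * (1 - z\<^sup>2)"
        unfolding cn using q p zle by (simp add: powr_mult powr_powr powr_half_sqrt[symmetric])
      also have "1 - z\<^sup>2 = (h + cos \<Theta>) / (2 * q\<^sup>2)"
        unfolding z2 half q2 using 2 by (simp add: field_simps)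
      also have "(2 * q) powr p * ((h + cos \<Theta>) / (2 * q\<^sup>2)) = a * ?p * (h + cos \<Theta>)"
        using p q by (simp add: a_def powr_mult powr_diff field_simps power2_eq_square)
      finally show "(2 * q * cn p s0 q) powr p = a * ?p * (h + cos \<Theta>)" .
    qed
    then show ?thesis using q by auto
  next
    case 3
    show ?thesis
    proof (cases "\<gamma> 0 $ 2 = 0")
      \<comment> \<open>At the unstable rest point the angle is pi or -pi; the borderline curve
        never attains these values, and the curve is a line.\<close>
      case True
      then have "cos \<Theta> = - 1" using y0_iff 3 by simp
      then show ?thesis using equilibrium[OF True] sc by simp
    next
      case False
      have "\<Theta> \<noteq> pi" "\<Theta> \<noteq> - pi" using False y0_iff 3 by auto
      then have d: "\<Theta> / 2 \<in> {- (pi / 2)<..<pi / 2}" using \<Theta> by auto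
      define s0 where "s0 = F1 p (\<Theta> / 2) 1"
      have am: "am1 p s0 1 = \<Theta> / 2" unfolding s0_def using am1_1_props(3)[OF p d] .
      define a where "a = 2 powr (p - 1) / ?p"
      have a: "0 < a" unfolding a_def by (intro divide_pos_pos pp) auto
      have "represented_by \<gamma> (borderline_curve p)"
      proof (rule matching[OF has_angle_curvature_borderline[OF p] a, where ?s0.0 = s0])
        fix s
        have "- a * borderline_curve p s $ 2 = (a * ?p) * sech_p p s powr (p - 1)"
          by (simp add: borderline_curve_def)
        also have "a * ?p = 2 powr (p - 1)" using p by (simp add: a_def)
        also have "2 powr (p - 1) * sech_p p s powr (p - 1) = spow (p - 1) (2 * sech_p p s)"
          by (simp add: spow_nonneg sech_p_eq[OF p] powr_mult)
        finally show "- a * borderline_curve p s $ 2 = spow (p - 1) (2 * sech_p p s)" .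
      next
        show "2 * am1 p s0 1 = \<Theta>" by (simp add: am)
        show "0 \<le> 2 * sech_p p s0" by (simp add: sech_p_eq[OF p])
        have "(2 * sech_p p s0) powr p = 2 powr p * (cos (\<Theta> / 2))\<^sup>2"
          using p cos_pos[OF p d] by (simp add: sech_p_eq[OF p] am powr_mult powr_powr)
        also have "\<dots> = a * ?p * (h + cos \<Theta>)"
          unfolding half using p 3 by (simp add: a_def powr_diff field_simps)
        finally show "(2 * sech_p p s0) powr p = a * ?p * (h + cos \<Theta>)" .
      qed
      then show ?thesis by blast
    qed
  next
    case 4
    \<comment> \<open>The modulus for which 1 - q^2 sin(angle / 2)^2 equals q^2 / 2 times h +
      cos(angle).\<close>
    define q where "q = sqrt (2 / (1 + h))"
    have q2: "q\<^sup>2 = 2 / (1 + h)" and q: "0 < q" "q < 1" using 4 by (auto simp: q_def)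
    define s0 where "s0 = F2 p (\<Theta> / 2) q"
    have am: "am2 p s0 q = \<Theta> / 2" unfolding s0_def using am2_props(2)[OF p q] .
    \<comment> \<open>The factor q^2 compensates the 1 / q^2 in front of the orbitlike
      curve.\<close>
    define a where "a = 2 powr (p - 1) * q\<^sup>2 / ?p"
    have a: "0 < a" unfolding a_def by (intro divide_pos_pos mult_pos_pos pp) (use q in auto)
    have "represented_by \<gamma> (orbitlike_curve p q)"
    proof (rule matching[OF has_angle_curvature_orbitlike[OF p q] a, where ?s0.0 = s0])
      fix s
      have "- a * orbitlike_curve p q s $ 2 = (a * ?p / q\<^sup>2) * dn p s q powr (p - 1)"
        by (simp add: orbitlike_curve_def mult_ac)
      also have "a * ?p / q\<^sup>2 = 2 powr (p - 1)" using p q by (simp add: a_def)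
      also have "2 powr (p - 1) * dn p s q powr (p - 1) = spow (p - 1) (2 * dn p s q)"
        by (simp add: spow_nonneg dn_def powr_mult)
      finally show "- a * orbitlike_curve p q s $ 2 = spow (p - 1) (2 * dn p s q)" .
    next
      show "2 * am2 p s0 q = \<Theta>" by (simp add: am)
      show "0 \<le> 2 * dn p s0 q" by (simp add: dn_def)
      have D: "0 < 1 - q\<^sup>2 * (sin (\<Theta> / 2))\<^sup>2" by (rule modulus(1)[OF p q])
      have "(2 * dn p s0 q) powr p = 2 powr p * (1 - q\<^sup>2 * (sin (\<Theta> / 2))\<^sup>2)"
        using p D by (simp add: dn_def am powr_mult powr_powr)
      also have "1 - q\<^sup>2 * (sin (\<Theta> / 2))\<^sup>2 = q\<^sup>2 / 2 * (h + cos \<Theta>)"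
        unfolding half q2 using 4 by (simp add: field_simps)
      also have "2 powr p * (q\<^sup>2 / 2 * (h + cos \<Theta>)) = a * ?p * (h + cos \<Theta>)"
        using p by (simp add: a_def powr_diff field_simps)
      finally show "(2 * dn p s0 q) powr p = a * ?p * (h + cos \<Theta>)" .
    qed
    then show ?thesis using q by auto
  qed
qed

lemma represented_by_classification:
  fixes p :: real
  assumes p: "1 < p" "p \<le> 2"
    and cf: "curvature_field (\<lambda>x. spow (1 / (p - 1)) (b1 * x $ 1 + b2 * x $ 2 + \<beta>)) \<gamma> r T"
  shows "represented_by \<gamma> linear_curve \<or> (\<exists>q\<in>{0<..<1}. represented_by \<gamma> (wavelike_curve p q))
    \<or> represented_by \<gamma> (borderline_curve p) \<or> (\<exists>q\<in>{0<..<1}. represented_by \<gamma> (orbitlike_curve p q))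
    \<or> represented_by \<gamma> circular_curve"
proof (cases "b1 = 0 \<and> b2 = 0")
  case True
  define k where "k = spow (1 / (p - 1)) \<beta>"
  have cfk: "curvature_field (\<lambda>_. k) \<gamma> r T" using cf True by (simp add: k_def)
  have circ: "represented_by \<gamma> circular_curve" if "curvature_field (\<lambda>_. k) \<gamma> r T" "0 < k" for \<gamma> r T k
  proof -
    let ?S = "\<lambda>x::real^2. vector [k * (1 * x $ 1 - 0 * x $ 2) + 0, k * (0 * x $ 1 + 1 * x $ 2) + 0] :: real^2"
    have "curvature_field (\<lambda>_. 1) (\<lambda>t. ?S (\<gamma> t)) (\<lambda>t. k * r t) (\<lambda>t. vector [1 * T t $ 1 - 0 * T t $ 2, 0 * T t $ 1 + 1 * T t $ 2])"
      by (rule curvature_field_affine[OF _ that(2,1)]) (use that(2) in auto)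
    from represented_by_circular[OF this] show ?thesis
      by (rule represented_by_similar_curve[rotated]) (rule similarity_affine_2, use that(2) in auto)
  qed
  consider "k = 0" | "0 < k" | "k < 0" by linarith
  then show ?thesis
  proof cases
    case 1
    have "represented_by \<gamma> linear_curve"
      by (rule represented_by_linear[OF cfk]) (use 1 in \<open>auto simp: locally_lipschitz_def intro: exI[of _ 0]\<close>)
    then show ?thesis by blast
  next
    case 2
    then show ?thesis using circ[OF cfk] by blast
  next
    case 3
    have "curvature_field (\<lambda>_. - k) (\<lambda>t. vector [\<gamma> t $ 1, - \<gamma> t $ 2]) r (\<lambda>t. vector [T t $ 1, - T t $ 2])"
      by (rule curvature_field_reflect[OF cfk]) simp
    from circ[OF this] 3 have "represented_by (\<lambda>t. vector [\<gamma> t $ 1, - \<gamma> t $ 2]) circular_curve" by simp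
    then show ?thesis using represented_by_similar_curve[OF similarity_reflection_2] by blast
  qed
next
  case False
  let ?m = "1 / (p - 1)"
  define n where "n = sqrt (b1\<^sup>2 + b2\<^sup>2)"
  have n2: "n\<^sup>2 = b1\<^sup>2 + b2\<^sup>2" by (simp add: n_def)
  have n: "0 < n" using False by (simp add: n_def sum_power2_gt_zero_iff)
  \<comment> \<open>The second row (b, a) of the rotation is the unit vector -(b1, b2) / n, so the
    linear part of the field becomes a positive multiple of minus the height.\<close>
  define a where "a = - b2 / n"
  define b where "b = - b1 / n"
  have "a\<^sup>2 + b\<^sup>2 = (b1\<^sup>2 + b2\<^sup>2) / n\<^sup>2" by (simp add: a_def b_def power_divide add_divide_distrib)
  then have ab: "a\<^sup>2 + b\<^sup>2 = 1" using n by (simp add: n2[symmetric])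
  \<comment> \<open>The argument of \<open>spow\<close> is multiplied by c / n while the curvature
    must be divided by c: (c / n)^(1/(p-1)) = 1 / c, that is c^p = n.\<close>
  define c where "c = n powr (1 / p)"
  have c: "0 < c" using n by (simp add: c_def)
  define d where "d = - c * \<beta> / n"
  let ?S = "\<lambda>x::real^2. vector [c * (a * x $ 1 - b * x $ 2) + 0, c * (b * x $ 1 + a * x $ 2) + d] :: real^2"
  let ?\<delta> = "\<lambda>t. ?S (\<gamma> t)"
  let ?T = "\<lambda>t. vector [a * T t $ 1 - b * T t $ 2, b * T t $ 1 + a * T t $ 2] :: real^2"
  have sim: "similarity ?S" using ab c by (rule similarity_affine_2)
  have cf': "curvature_field (\<lambda>x. spow ?m (- x $ 2)) ?\<delta> (\<lambda>t. c * r t) ?T"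
  proof (rule curvature_field_affine[OF ab c cf])
    fix x :: "real^2"
    have "- ?S x $ 2 = (c / n) * (b1 * x $ 1 + b2 * x $ 2 + \<beta>)"
      using n by (simp add: a_def b_def d_def field_simps)
    then have "spow ?m (- ?S x $ 2) = spow ?m (c / n) * spow ?m (b1 * x $ 1 + b2 * x $ 2 + \<beta>)"
      by (simp only: spow_mult)
    moreover have "spow ?m (c / n) = 1 / c"
    proof -
      have "c / n = n powr (1 / p - 1)" using n by (simp add: c_def powr_diff)
      then have "spow ?m (c / n) = n powr ((1 / p - 1) * ?m)" by (simp add: spow_nonneg powr_powr)
      also have "(1 / p - 1) * ?m = - (1 / p)" using p by (simp add: field_simps)
      also have "n powr - (1 / p) = 1 / c" by (simp add: c_def powr_minus divide_inverse)
      finally show ?thesis .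
    qed
    ultimately show "spow ?m (- ?S x $ 2) = spow ?m (b1 * x $ 1 + b2 * x $ 2 + \<beta>) / c" by simp
  qed
  have res: "represented_by \<gamma> M" if "represented_by ?\<delta> M" for M
    using represented_by_similar_curve[OF sim that] .
  show ?thesis
  proof (cases "?\<delta> 0 $ 2 \<le> 0")
    case True
    then show ?thesis using represented_by_normal_form[OF p cf' True] res by blast
  next
    case False
    \<comment> \<open>The normal form of the field is odd in the height, so the reflection preserves
      it. The reflected start lies below the axis, where the curvature is nonnegative, as at the
      model points used for matching.\<close>
    let ?R = "\<lambda>x::real^2. vector [x $ 1, - x $ 2] :: real^2"
    have cf'': "curvature_field (\<lambda>x. spow ?m (- x $ 2)) (\<lambda>t. ?R (?\<delta> t)) (\<lambda>t. c * r t) (\<lambda>t. ?R (?T t))"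
      by (rule curvature_field_reflect[OF cf']) (simp add: spow_minus)
    have res': "represented_by \<gamma> M" if "represented_by (\<lambda>t. ?R (?\<delta> t)) M" for M
      using res represented_by_similar_curve[OF similarity_reflection_2 that] by blast
    have "?R (?\<delta> 0) $ 2 \<le> 0" using False by simp
    from represented_by_normal_form[OF p cf'' this] res' show ?thesis by blast
  qed
qed

theorem theorem1p2:
  fixes p :: real and \<gamma> :: "real \<Rightarrow> real^2"
  assumes "1 < p" and "p \<le> 2" and "p_elastica p \<gamma>"
  shows "(represented_by \<gamma> linear_curve
        \<or> (\<exists>q\<in>{0<..<1}. represented_by \<gamma> (wavelike_curve p q))
        \<or> represented_by \<gamma> (borderline_curve p)
        \<or> (\<exists>q\<in>{0<..<1}. represented_by \<gamma> (orbitlike_curve p q))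
        \<or> represented_by \<gamma> circular_curve)
    \<and> (\<exists>\<theta>. has_angle_curvature linear_curve \<theta> (\<lambda>s. 0))
    \<and> (\<forall>q\<in>{0<..<1}. has_angle_curvature (wavelike_curve p q)
         (\<lambda>s. 2 * arcsin (q * sn p s q)) (\<lambda>s. 2 * q * cn p s q))
    \<and> has_angle_curvature (borderline_curve p) (\<lambda>s. 2 * am1 p s 1) (\<lambda>s. 2 * sech_p p s)
    \<and> (\<forall>s. 2 * am1 p s 1 = 2 * am2 p s 1)
    \<and> (\<forall>q\<in>{0<..<1}. has_angle_curvature (orbitlike_curve p q)
         (\<lambda>s. 2 * am2 p s q) (\<lambda>s. 2 * dn p s q))
    \<and> (\<exists>\<theta>. has_angle_curvature circular_curve \<theta> (\<lambda>s. 1))"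
proof (intro conjI ballI allI)
  obtain b1 b2 \<beta> r T where "curvature_field (\<lambda>x. spow (1 / (p - 1)) (b1 * x $ 1 + b2 * x $ 2 + \<beta>)) \<gamma> r T"
    by (rule p_elastica_curvature_field[OF assms(1,3)]) blast
  from represented_by_classification[OF assms(1,2) this]
  show "represented_by \<gamma> linear_curve
        \<or> (\<exists>q\<in>{0<..<1}. represented_by \<gamma> (wavelike_curve p q))
        \<or> represented_by \<gamma> (borderline_curve p)
        \<or> (\<exists>q\<in>{0<..<1}. represented_by \<gamma> (orbitlike_curve p q))
        \<or> represented_by \<gamma> circular_curve" .
  show "\<exists>\<theta>. has_angle_curvature linear_curve \<theta> (\<lambda>s. 0)" using has_angle_curvature_linear by blast
  show "\<exists>\<theta>. has_angle_curvature circular_curve \<theta> (\<lambda>s. 1)" using has_angle_curvature_circular by blast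
  show "has_angle_curvature (borderline_curve p) (\<lambda>s. 2 * am1 p s 1) (\<lambda>s. 2 * sech_p p s)"
    using assms(1,2) by (rule has_angle_curvature_borderline)
  show "2 * am1 p s 1 = 2 * am2 p s 1" for s by (simp add: am1_1_eq_am2[OF assms(1,2)])
  fix q :: real assume q: "q \<in> {0<..<1}"
  show "has_angle_curvature (wavelike_curve p q) (\<lambda>s. 2 * arcsin (q * sn p s q)) (\<lambda>s. 2 * q * cn p s q)"
    using assms(1,2) q by (intro has_angle_curvature_wavelike) auto
  show "has_angle_curvature (orbitlike_curve p q) (\<lambda>s. 2 * am2 p s q) (\<lambda>s. 2 * dn p s q)"
    using assms(1,2) q by (intro has_angle_curvature_orbitlike) auto
qed

end
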